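(* Let $n\in\mathbb{N}$, $n\geq 2$. Let $\Omega$ be a bounded open subset of $\mathbb{R}^n$ of class $C^{1,1}$. Then the following statements hold. (i) For each $(k,\mu)\in \mathcal{K}^{1,1}_{-(n-1);o}\times C^{0,1}(\partial\Omega)$, the function $$K[k,\mu]_{|\Omega}(x)=\int_{\partial\Omega}k(x-y)\mu(y)\,d\sigma_y\qquad\forall x\in\Omega$$ can be extended to a unique $\omega_1$-Hölder continuous function $K[k,\mu]^+$ on $\overline{\Omega}$. Moreover, the map from $\mathcal{K}^{1,1}_{-(n-1);o}\times C^{0,1}(\partial\Omega)$ to $C^{0,\omega_1}(\overline{\Omega})$ taking $(k,\mu)$ to $K[k,\mu]^+$ is bilinear and continuous. (ii) For each $(k,\mu)\in \mathcal{K}^{1,1}_{-(n-1);o}\times C^{0,1}(\partial\Omega)$, the function $$K[k,\mu]_{|\mathbb{R}^n\setminus\overline{\Omega}}(x)=\int_{\partial\Omega}k(x-y)\mu(y)\,d\sigma_y\qquad\forall x\in\mathbb{R}^n\setminus\overline{\Omega}$$ can be extended to a unique continuous function $K[k,\mu]^-$ on $\mathbb{R}^n\setminus\Omega$. Moreover, if $r\in]0,+\infty[$ and $\overline{\Omega}\subseteq\mathbb{B}_n(0,r)$, then the restriction $K[k,\mu]^-_{|\overline{\mathbb{B}_n(0,r)}\setminus\Omega}$ is $\omega_1$-Hölder continuous and the map from $\mathcal{K}^{1,1}_{-(n-1);o}\times C^{0,1}(\partial\Omega)$ to $C^{0,\omega_1}(\overline{\mathbb{B}_n(0,r)}\setminus\Omega)$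 taking $(k,\mu)$ to $K[k,\mu]^-_{|\overline{\mathbb{B}_n(0,r)}\setminus\Omega}$ is bilinear and continuous.
   Context: Functions are complex-valued; $]a,b[$ denotes an open interval; $\mathbb{B}_n(x,r)$ is the open Euclidean ball in $\mathbb{R}^n$ with center $x$ and radius $r$; $d\sigma$ is the $(n-1)$-dimensional surface measure on $\partial\Omega$. The function $\omega_1:[0,+\infty[\to[0,+\infty[$ is defined by $\omega_1(0)=0$, $\omega_1(r)=r|\ln r|$ for $r\in]0,e^{-1}]$, and $\omega_1(r)=e^{-1}$ for $r>e^{-1}$. For $\mathbb{D}\subseteq\mathbb{R}^n$ and $f:\mathbb{D}\to\mathbb{C}$ set $|f:\mathbb{D}|_{\omega_1}=\sup\{|f(x)-f(y)|/\omega_1(|x-y|):x,y\in\mathbb{D},x\neq y\}$. The function $f$ is called $\omega_1$-Hölder continuous if $|f:\mathbb{D}|_{\omega_1}<+\infty$. If $\mathbb{D}$ is compact, $C^{0,\omega_1}(\mathbb{D})$ is the space of $\omega_1$-Hölder continuous functions on $\mathbb{D}$, with norm $\sup_{\mathbb{D}}|f|+|f:\mathbb{D}|_{\omega_1}$. $C^{0,1}(\partial\Omega)$ is the space of Lipschitz continuous functions on $\partial\Omega$, with norm the sum of the sup-norm and the Lipschitz constant. Open set of class $C^{1,1}$: for each $p\in\partial\Omega$ there exist an orthogonal matrix $R_p\in O_n(\mathbb{R})$, $r,\delta\in]0,+\infty[$ and a function $\gamma_p:\mathbb{B}_{n-1}(0,r)\to]-\delta,\delta[$ of class $C^{1,1}$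 (i.e. $C^1$ up to the closure with Lipschitz continuous first order derivatives) such that $\gamma_p(0)=0$, $|\gamma_p|<\delta/2$, and $R_p(\Omega-p)\cap(\mathbb{B}_{n-1}(0,r)\times]-\delta,\delta[)=\{(\eta,y)\in\mathbb{B}_{n-1}(0,r)\times]-\delta,\delta[:\ y<\gamma_p(\eta)\}$. A function $k:\mathbb{R}^n\setminus\{0\}\to\mathbb{C}$ is positively homogeneous of degree $h\in\mathbb{R}$ if $k(tx)=t^hk(x)$ for all $t\in]0,+\infty[$ and $x\in\mathbb{R}^n\setminus\{0\}$. $C^{1,1}_{\mathrm{loc}}(\mathbb{R}^n\setminus\{0\})$ is the set of functions in $C^1(\mathbb{R}^n\setminus\{0\})$ whose restriction to $\overline{\Omega'}$ has Lipschitz continuous first order derivatives for every bounded open $\Omega'\subseteq\mathbb{R}^n$ with $\overline{\Omega'}\subseteq\mathbb{R}^n\setminus\{0\}$. $\mathcal{K}^{1,1}_{-(n-1)}$ is the Banach space of all $k\in C^{1,1}_{\mathrm{loc}}(\mathbb{R}^n\setminus\{0\})$ that are positively homogeneous of degree $-(n-1)$, with norm $\|k\|_{\mathcal{K}^{1,1}_{-(n-1)}}=\|k\|_{C^{1,1}(\partial\mathbb{B}_n(0,1))}$, the usual $C^{1,1}$ Schauder norm on the unit sphere, defined up to equivalence through local parametrizations (on this space it is equivalent to $\sup_{|x|=1}|k|+\sup_{|x|=1}|\nabla k|$ plus the Lipschitz constant of $\nabla k$ on the unit sphere). $\mathcal{K}^{1,1}_{-(n-1);o}$ is its closed subspace of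 odd functions, with the same norm. *)

theory Defs
  imports "HOL-Analysis.Analysis"
begin

(* R^n is rendered as R^(n-1) x R, on which the product type carries the Euclidean
   norm.  As 'm ranges over the (nonempty) finite types, n = CARD('m) + 1 ranges over
   all integers n >= 2. *)
type_synonym 'm rn = "(real ^ 'm) \<times> real"

definition total_deriv ::
  "('a::euclidean_space \<Rightarrow> 'b::real_normed_vector) \<Rightarrow> 'a \<Rightarrow> ('a \<Rightarrow>\<^sub>L 'b)" where
  "total_deriv f x = Blinfun (frechet_derivative f (at x))"


section \<open>Generalized Hoelder spaces\<close>

definition omega1 :: "real \<Rightarrow> real" where
  "omega1 r = (if r \<le> 0 then 0 else if r \<le> exp (-1) then r * \<bar>ln r\<bar> else exp (-1))"

(* The seminorms and norms take values in [0, +infinity]; in particular a supremum over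
   the empty set is 0 and an unbounded supremum is infinite. *)
definition sup_norm :: "'a set \<Rightarrow> ('a \<Rightarrow> 'b::real_normed_vector) \<Rightarrow> ennreal" where
  "sup_norm D f = (SUP x\<in>D. ennreal (norm (f x)))"

definition hoelder_seminorm ::
  "(real \<Rightarrow> real) \<Rightarrow> 'a::metric_space set \<Rightarrow> ('a \<Rightarrow> 'b::real_normed_vector) \<Rightarrow> ennreal" where
  "hoelder_seminorm \<omega> D f =
     (SUP (x, y)\<in>{(x, y). x \<in> D \<and> y \<in> D \<and> x \<noteq> y}. ennreal (norm (f x - f y) / \<omega> (dist x y)))"

definition hoelder_on ::
  "(real \<Rightarrow> real) \<Rightarrow> 'a::metric_space set \<Rightarrow> ('a \<Rightarrow> 'b::real_normed_vector) \<Rightarrow> bool" where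
  "hoelder_on \<omega> D f \<longleftrightarrow> hoelder_seminorm \<omega> D f < \<infinity>"

definition hoelder_norm ::
  "(real \<Rightarrow> real) \<Rightarrow> 'a::metric_space set \<Rightarrow> ('a \<Rightarrow> 'b::real_normed_vector) \<Rightarrow> ennreal" where
  "hoelder_norm \<omega> D f = sup_norm D f + hoelder_seminorm \<omega> D f"

(* C^{0,1}(D) for compact D.  Elements are total functions of which only the values on D
   are relevant. *)
definition lipschitz_space :: "'a::metric_space set \<Rightarrow> ('a \<Rightarrow> complex) set" where
  "lipschitz_space D = {\<mu>. \<exists>L. L-lipschitz_on D \<mu>}"

definition lipschitz_norm :: "'a::metric_space set \<Rightarrow> ('a \<Rightarrow> complex) \<Rightarrow> ennreal" where
  "lipschitz_norm D \<mu> = hoelder_norm (\<lambda>r. r) D \<mu>"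


section \<open>Open sets of class \<open>C\<^sup>1\<^sup>,\<^sup>1\<close> and their surface measure\<close>

(* C^1 up to the closure of the open set U, with Lipschitz continuous first order
   derivatives; f itself is only considered on U. *)
definition C11_up_to_closure ::
  "'a::euclidean_space set \<Rightarrow> ('a \<Rightarrow> 'b::real_normed_vector) \<Rightarrow> bool" where
  "C11_up_to_closure U f \<longleftrightarrow>
     (\<forall>x\<in>U. f differentiable (at x)) \<and>
     (\<exists>g. continuous_on (closure U) g \<and> (\<forall>x\<in>U. g x = f x)) \<and>
     (\<exists>D L. L-lipschitz_on (closure U) D \<and> (\<forall>x\<in>U. D x = total_deriv f x))"

definition local_graph ::
  "('m::finite) rn set \<Rightarrow> 'm rn \<Rightarrow> ('m rn \<Rightarrow> 'm rn) \<Rightarrow> real \<Rightarrow> real \<Rightarrow> (real ^ 'm \<Rightarrow> real) \<Rightarrow> bool" where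
  "local_graph \<Omega> p R r \<delta> \<gamma> \<longleftrightarrow>
     orthogonal_transformation R \<and> 0 < r \<and> 0 < \<delta> \<and>
     C11_up_to_closure (ball 0 r) \<gamma> \<and> \<gamma> 0 = 0 \<and> (\<forall>\<eta>\<in>ball 0 r. \<bar>\<gamma> \<eta>\<bar> < \<delta> / 2) \<and>
     (\<lambda>x. R (x - p)) ` \<Omega> \<inter> (ball 0 r \<times> {-\<delta><..<\<delta>}) =
       {(\<eta>, y). \<eta> \<in> ball 0 r \<and> y \<in> {-\<delta><..<\<delta>} \<and> y < \<gamma> \<eta>}"

definition class_C11 :: "('m::finite) rn set \<Rightarrow> bool" where
  "class_C11 \<Omega> \<longleftrightarrow> (\<forall>p\<in>frontier \<Omega>. \<exists>R r \<delta> \<gamma>. local_graph \<Omega> p R r \<delta> \<gamma>)"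

(* The (n-1)-dimensional surface measure: the Borel measure on R^n that is concentrated on
   the boundary and in every local graph representation has the usual area element
   sqrt (1 + |grad gamma|^2).  The operator norm of the total derivative of the real valued
   function gamma is the Euclidean norm of its gradient. *)
definition is_surface_measure :: "('m::finite) rn set \<Rightarrow> 'm rn measure \<Rightarrow> bool" where
  "is_surface_measure \<Omega> \<sigma> \<longleftrightarrow>
     sets \<sigma> = sets borel \<and> emeasure \<sigma> (- frontier \<Omega>) = 0 \<and>
     (\<forall>p\<in>frontier \<Omega>. \<forall>R r \<delta> \<gamma>. local_graph \<Omega> p R r \<delta> \<gamma> \<longrightarrow>
       (\<forall>A\<in>sets borel. (\<lambda>x. R (x - p)) ` A \<subseteq> ball 0 r \<times> {-\<delta><..<\<delta>} \<longrightarrow>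
         emeasure \<sigma> A =
           (\<integral>\<^sup>+\<eta>\<in>ball 0 r. (indicator ((\<lambda>x. R (x - p)) ` A) (\<eta>, \<gamma> \<eta>) *
               ennreal (sqrt (1 + (norm (total_deriv \<gamma> \<eta>))\<^sup>2))) \<partial>lborel)))"

definition surface_measure :: "('m::finite) rn set \<Rightarrow> 'm rn measure" where
  "surface_measure \<Omega> = (THE \<sigma>. is_surface_measure \<Omega> \<sigma>)"


section \<open>Homogeneous kernels\<close>

(* Functions on R^n without the origin are total functions whose value at 0 is irrelevant. *)
definition pos_homogeneous ::
  "real \<Rightarrow> ('a::real_normed_vector \<Rightarrow> complex) \<Rightarrow> bool" where
  "pos_homogeneous h k \<longleftrightarrow> (\<forall>t>0. \<forall>x. x \<noteq> 0 \<longrightarrow> k (t *\<^sub>R x) = (t powr h) *\<^sub>R k x)"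

definition C11_loc_punctured :: "('a::euclidean_space \<Rightarrow> complex) \<Rightarrow> bool" where
  "C11_loc_punctured k \<longleftrightarrow>
     (\<forall>x\<in>-{0}. k differentiable (at x)) \<and> continuous_on (-{0}) (total_deriv k) \<and>
     (\<forall>U. open U \<and> bounded U \<and> closure U \<subseteq> -{0} \<longrightarrow>
        (\<exists>L. L-lipschitz_on (closure U) (total_deriv k)))"

definition kernel_space :: "('a::euclidean_space \<Rightarrow> complex) set" where
  "kernel_space = {k. C11_loc_punctured k \<and> pos_homogeneous (- (real DIM('a) - 1)) k}"

definition odd_kernel_space :: "('a::euclidean_space \<Rightarrow> complex) set" where
  "odd_kernel_space = {k \<in> kernel_space. \<forall>x. x \<noteq> 0 \<longrightarrow> k (- x) = - k x}"

(* A representative of the C^{1,1} norm on the unit sphere, which is only defined up to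
   equivalence; for homogeneous k the full derivative of k may be used on the sphere. *)
definition kernel_norm :: "('a::euclidean_space \<Rightarrow> complex) \<Rightarrow> ennreal" where
  "kernel_norm k =
     sup_norm (sphere 0 1) k + sup_norm (sphere 0 1) (total_deriv k) +
     hoelder_seminorm (\<lambda>r. r) (sphere 0 1) (total_deriv k)"


section \<open>Layer potentials\<close>

definition potential ::
  "('m::finite) rn set \<Rightarrow> ('m rn \<Rightarrow> complex) \<Rightarrow> ('m rn \<Rightarrow> complex) \<Rightarrow> 'm rn \<Rightarrow> complex" where
  "potential \<Omega> k \<mu> x = (LINT y:frontier \<Omega>|surface_measure \<Omega>. k (x - y) * \<mu> y)"

(* Functions on a subset of R^n are represented by the elements of extensional, so that
   uniqueness of an extension is uniqueness of its values on that subset. *)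
definition interior_ext ::
  "('m::finite) rn set \<Rightarrow> ('m rn \<Rightarrow> complex) \<Rightarrow> ('m rn \<Rightarrow> complex) \<Rightarrow> ('m rn \<Rightarrow> complex) \<Rightarrow> bool" where
  "interior_ext \<Omega> k \<mu> F \<longleftrightarrow>
     F \<in> extensional (closure \<Omega>) \<and> hoelder_on omega1 (closure \<Omega>) F \<and>
     (\<forall>x\<in>\<Omega>. F x = potential \<Omega> k \<mu> x)"

definition exterior_ext ::
  "('m::finite) rn set \<Rightarrow> ('m rn \<Rightarrow> complex) \<Rightarrow> ('m rn \<Rightarrow> complex) \<Rightarrow> ('m rn \<Rightarrow> complex) \<Rightarrow> bool" where
  "exterior_ext \<Omega> k \<mu> F \<longleftrightarrow>
     F \<in> extensional (- \<Omega>) \<and> continuous_on (- \<Omega>) F \<and>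
     (\<forall>x\<in>- closure \<Omega>. F x = potential \<Omega> k \<mu> x)"

definition potential_plus ::
  "('m::finite) rn set \<Rightarrow> ('m rn \<Rightarrow> complex) \<Rightarrow> ('m rn \<Rightarrow> complex) \<Rightarrow> 'm rn \<Rightarrow> complex" where
  "potential_plus \<Omega> k \<mu> = (THE F. interior_ext \<Omega> k \<mu> F)"

definition potential_minus ::
  "('m::finite) rn set \<Rightarrow> ('m rn \<Rightarrow> complex) \<Rightarrow> ('m rn \<Rightarrow> complex) \<Rightarrow> 'm rn \<Rightarrow> complex" where
  "potential_minus \<Omega> k \<mu> = (THE F. exterior_ext \<Omega> k \<mu> F)"


section \<open>Bilinear and continuous maps between function spaces\<close>

(* Complex bilinearity of B on X x Y, the values of B being regarded as functions on D. *)
definition bilinear_map_on ::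
  "('a \<Rightarrow> complex) set \<Rightarrow> ('b \<Rightarrow> complex) set \<Rightarrow> 'c set \<Rightarrow>
   (('a \<Rightarrow> complex) \<Rightarrow> ('b \<Rightarrow> complex) \<Rightarrow> 'c \<Rightarrow> complex) \<Rightarrow> bool" where
  "bilinear_map_on X Y D B \<longleftrightarrow>
     (\<forall>f\<in>X. \<forall>g\<in>X. \<forall>h\<in>Y. \<forall>a b. \<forall>x\<in>D.
        B (\<lambda>z. a * f z + b * g z) h x = a * B f h x + b * B g h x) \<and>
     (\<forall>f\<in>X. \<forall>g\<in>Y. \<forall>h\<in>Y. \<forall>a b. \<forall>x\<in>D.
        B f (\<lambda>z. a * g z + b * h z) x = a * B f g x + b * B f h x)"

(* Continuity of B from X x Y to Z with respect to the distances induced by NX, NY, NZ. *)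
definition continuous_map_on ::
  "('a \<Rightarrow> complex) set \<Rightarrow> (('a \<Rightarrow> complex) \<Rightarrow> ennreal) \<Rightarrow>
   ('b \<Rightarrow> complex) set \<Rightarrow> (('b \<Rightarrow> complex) \<Rightarrow> ennreal) \<Rightarrow>
   (('c \<Rightarrow> complex) \<Rightarrow> ennreal) \<Rightarrow>
   (('a \<Rightarrow> complex) \<Rightarrow> ('b \<Rightarrow> complex) \<Rightarrow> 'c \<Rightarrow> complex) \<Rightarrow> bool" where
  "continuous_map_on X NX Y NY NZ B \<longleftrightarrow>
     (\<forall>f0\<in>X. \<forall>g0\<in>Y. \<forall>\<epsilon>>0. \<exists>\<delta>>0. \<forall>f\<in>X. \<forall>g\<in>Y.
        NX (\<lambda>z. f z - f0 z) < ennreal \<delta> \<and> NY (\<lambda>z. g z - g0 z) < ennreal \<delta> \<longrightarrow>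
        NZ (\<lambda>z. B f g z - B f0 g0 z) < ennreal \<epsilon>)"

end

theory Submission
  imports Defs "HOL-Analysis.Analysis"
begin

text \<open>
  The potential is Lipschitz continuous away from the boundary, so only the part of the integral near a boundary
  point matters.  In a chart it is a potential over the graph of \<gamma>, evaluated at vertical distance
  t from the point of the graph above \<xi>.  Subtract the integral of the kernel, with the density
  frozen at \<xi>, over a disc in the tangent plane above \<xi>.  By homogeneity the latter is an
  integral over a disc of radius proportional to 1/t in a plane at height 1; since the kernel is odd, its
  values at opposite points of the disc nearly cancel, and the integral stays bounded and depends on
  \<xi> and t in a controlled way.  In the remainder the
  \<open>C\<^sup>1\<^sup>,\<^sup>1\<close> regularity of \<gamma> and the Lipschitz continuity of the density gain one
  order of the singularity.  For two evaluation points at distance h the part of the remainder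
  within distance h of them is O(h), and outside it a further derivative of the
  kernel produces the integral of h/s over h < s < 1, which is h |ln h|.  All constants are linear
  in the norms of the kernel and of the density, hence the potential on either side is
  uniformly continuous and its extension to the closure is a continuous bilinear map.
\<close>

section \<open>Odd homogeneous kernels\<close>

text \<open>What shapes the proof is uniformity. Joint continuity is obtained by applying the same
  estimates to \<open>f - f0\<close> and \<open>g - g0\<close>, so every bound must hold for
  arbitrary kernels and densities and depend on them only through the factors N and M; hence the
  predicate \<open>kernel_bounds N\<close>, and hence radii and constants that are fixed before
  kernel and density. The derivative of the kernel is merely Lipschitz, so changes of kernel
  differences are treated as second differences. The discs are centred at the foot of the evaluation
  point so that oddness applies; they therefore move with \<xi>, and where only one of two discs
  contains \<eta> no cancellation is left, but this happens in a shell of thickness of order h.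
  Heights t of opposite sign are never compared: the flat integral is odd in t, so the two boundary
  values differ in general. Finally, the surface measure is given by a definite description, so
  nothing can be said about it before its existence and uniqueness are established; this amounts to
  showing that two charts assign the same area to common sets.\<close>

lemma one_minus_power_le:
  fixes q :: real
  assumes "0 \<le> q" "q \<le> 1"
  shows "1 - q ^ j \<le> real j * (1 - q)"
proof -
  have "1 + real j * (q - 1) \<le> (1 + (q - 1)) ^ j"
    using assms by (intro Bernoulli_inequality) simp
  then have "1 + real j * (q - 1) \<le> q ^ j" by simp
  then show ?thesis unfolding right_diff_distrib by linarith
qed

lemma power_DIM_Suc: "r ^ DIM('a::euclidean_space) = r * (r::real) ^ (DIM('a) - 1)"
  by (simp flip: power_Suc)

text \<open>Both points are split into radius and direction. The directions differ by at most 2|z -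
  z'|/a, with a the smaller radius, and the radial factors are compared by Bernoulli's inequality,
  which yields the factor j. The segment from z to z' may pass through the origin, so no mean value
  argument along it is available.\<close>

lemma homogeneous_lipschitz:
  fixes f :: "'a::real_normed_vector \<Rightarrow> 'b::real_normed_vector"
  assumes hom: "\<And>t z. 0 < t \<Longrightarrow> z \<noteq> 0 \<Longrightarrow> f (t *\<^sub>R z) = (1 / t ^ j) *\<^sub>R f z"
    and bound: "\<And>z. norm z = 1 \<Longrightarrow> norm (f z) \<le> A"
    and lip: "\<And>z z'. norm z = 1 \<Longrightarrow> norm z' = 1 \<Longrightarrow> norm (f z - f z') \<le> A * norm (z - z')"
    and "0 < \<rho>" "\<rho> \<le> norm z" "\<rho> \<le> norm z'"
  shows "norm (f z - f z') \<le> (real j + 2) * A * norm (z - z') / \<rho> ^ (j + 1)"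
proof -
  \<comment> \<open>The smaller of the two norms serves as the reference radius; the other case
    follows by exchanging the points.\<close>
  have main: "norm (f z - f z') \<le> (real j + 2) * A * norm (z - z') / \<rho> ^ (j + 1)"
    if le: "norm z \<le> norm z'" and \<rho>: "\<rho> \<le> norm z" for z z'
  proof -
    define a b where "a = norm z" and "b = norm z'"
    have ab: "0 < a" "a \<le> b" "\<rho> \<le> a" "0 < b" using that \<open>0 < \<rho>\<close> by (auto simp: a_def b_def)
    define u v where "u = (1 / a) *\<^sub>R z" and "v = (1 / b) *\<^sub>R z'"
    have uv: "norm u = 1" "norm v = 1" "z = a *\<^sub>R u" "z' = b *\<^sub>R v"
      using ab by (auto simp: u_def v_def a_def b_def)
    have A: "0 \<le> A" using bound[OF uv(1)] norm_ge_zero order_trans by blast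
    have ba: "b - a \<le> norm (z - z')"
      unfolding a_def b_def by (metis norm_minus_commute norm_triangle_ineq2)
    have uv_diff: "norm (u - v) \<le> 2 * norm (z - z') / a"
    proof -
      have "u - v = (1 / a) *\<^sub>R (z - z') + (1 / a - 1 / b) *\<^sub>R z'"
        by (simp add: u_def v_def algebra_simps)
      then have "norm (u - v) \<le> norm ((1 / a) *\<^sub>R (z - z')) + norm ((1 / a - 1 / b) *\<^sub>R z')"
        by (metis norm_triangle_ineq)
      also have "norm ((1 / a - 1 / b) *\<^sub>R z') = (b - a) / a"
        using ab by (auto simp: b_def[symmetric] field_simps frac_le)
      also have "norm ((1 / a) *\<^sub>R (z - z')) = norm (z - z') / a" using ab by simp
      also have "norm (z - z') / a + (b - a) / a \<le> 2 * norm (z - z') / a"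
        using ba ab by (simp add: divide_simps)
      finally show ?thesis .
    qed
    have pw: "1 / a ^ j - 1 / b ^ j \<le> (1 / a ^ j) * (real j * norm (z - z') / a)"
    proof -
      have "1 / a ^ j - 1 / b ^ j = (1 / a ^ j) * (1 - (a / b) ^ j)"
        using ab by (simp add: power_divide field_simps)
      also have "\<dots> \<le> (1 / a ^ j) * (real j * (1 - a / b))"
        using ab by (intro mult_left_mono one_minus_power_le) auto
      also have "1 - a / b = (b - a) / b" using ab by (simp add: field_simps)
      also have "(1 / a ^ j) * (real j * ((b - a) / b)) \<le> (1 / a ^ j) * (real j * (norm (z - z') / a))"
        using ab ba by (intro mult_left_mono frac_le) auto
      finally show ?thesis by simp
    qed
    have "f z - f z' = (1 / a ^ j) *\<^sub>R (f u - f v) + (1 / a ^ j - 1 / b ^ j) *\<^sub>R f v"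
    proof -
      have "u \<noteq> 0" "v \<noteq> 0" using uv by auto
      then have "f z = (1 / a ^ j) *\<^sub>R f u" "f z' = (1 / b ^ j) *\<^sub>R f v"
        using hom ab uv by auto
      then show ?thesis by (simp add: algebra_simps)
    qed
    then have "norm (f z - f z') \<le> norm ((1 / a ^ j) *\<^sub>R (f u - f v)) + norm ((1 / a ^ j - 1 / b ^ j) *\<^sub>R f v)"
      by (metis norm_triangle_ineq)
    moreover have "norm ((1 / a ^ j) *\<^sub>R (f u - f v)) \<le> (1 / a ^ j) * (A * (2 * norm (z - z') / a))"
    proof -
      have "norm (f u - f v) \<le> A * (2 * norm (z - z') / a)"
        using lip[OF uv(1,2)] mult_left_mono[OF uv_diff A] by linarith
      then have "(1 / a ^ j) * norm (f u - f v) \<le> (1 / a ^ j) * (A * (2 * norm (z - z') / a))"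
        using ab by (intro mult_left_mono) auto
      then show ?thesis using ab by simp
    qed
    moreover have "norm ((1 / a ^ j - 1 / b ^ j) *\<^sub>R f v) \<le> (1 / a ^ j) * (real j * norm (z - z') / a) * A"
    proof -
      have "0 \<le> 1 / a ^ j - 1 / b ^ j" using ab by (simp add: frac_le power_mono)
      then show ?thesis
        using mult_mono[OF pw bound[OF uv(2)]] ab by simp
    qed
    ultimately have "norm (f z - f z') \<le> (1 / a ^ j) * (A * (2 * norm (z - z') / a)) +
        (1 / a ^ j) * (real j * norm (z - z') / a) * A"
      by linarith
    also have "(1 / a ^ j) * (A * (2 * norm (z - z') / a)) + (1 / a ^ j) * (real j * norm (z - z') / a) * A
        = (real j + 2) * A * norm (z - z') / a ^ (j + 1)"
      using ab by (simp add: field_simps)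
    also have "\<dots> \<le> (real j + 2) * A * norm (z - z') / \<rho> ^ (j + 1)"
      using ab A \<open>0 < \<rho>\<close> by (intro divide_left_mono mult_nonneg_nonneg power_mono) auto
    finally show ?thesis .
  qed
  show ?thesis
  proof (cases "norm z \<le> norm z'")
    case True then show ?thesis using main assms by blast
  next
    case False
    then have "norm (f z' - f z) \<le> (real j + 2) * A * norm (z' - z) / \<rho> ^ (j + 1)"
      using main assms by auto
    then show ?thesis by (simp add: norm_minus_commute)
  qed
qed

(* Everything the estimates need to know about a kernel.  The last condition bounds a
   second difference over two segments by means of the Lipschitz constant of the derivative. *)
definition kernel_bounds :: "real \<Rightarrow> ('a::euclidean_space \<Rightarrow> complex) \<Rightarrow> bool" where
  "kernel_bounds N k \<longleftrightarrow> 0 \<le> N \<and>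
     (\<forall>z. z \<noteq> 0 \<longrightarrow> k (- z) = - k z) \<and>
     (\<forall>t z. 0 < t \<longrightarrow> z \<noteq> 0 \<longrightarrow> k (t *\<^sub>R z) = (1 / t ^ (DIM('a) - 1)) *\<^sub>R k z) \<and>
     continuous_on (- {0}) k \<and>
     (\<forall>z. z \<noteq> 0 \<longrightarrow> norm (k z) \<le> N / norm z ^ (DIM('a) - 1)) \<and>
     (\<forall>z a \<rho>. 0 < \<rho> \<longrightarrow> (\<forall>s\<in>{0..1}. \<rho> \<le> norm (z + s *\<^sub>R a)) \<longrightarrow>
        norm (k (z + a) - k z) \<le> N * norm a / \<rho> ^ DIM('a)) \<and>
     (\<forall>z a z' a' \<rho>. 0 < \<rho> \<longrightarrow> (\<forall>s\<in>{0..1}. \<rho> \<le> norm (z + s *\<^sub>R a) \<and> \<rho> \<le> norm (z' + s *\<^sub>R a')) \<longrightarrow>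
        norm (k (z + a) - k z - (k (z' + a') - k z')) \<le>
          N * (norm (a - a') / \<rho> ^ DIM('a) + norm a' * (norm (z - z') + norm (a - a')) / \<rho> ^ (DIM('a) + 1)))"

lemma kernel_boundsD:
  fixes k :: "'a::euclidean_space \<Rightarrow> complex"
  assumes "kernel_bounds N k"
  shows kernel_bounds_nonneg: "0 \<le> N"
    and kernel_bounds_odd: "z \<noteq> 0 \<Longrightarrow> k (- z) = - k z"
    and kernel_bounds_homogeneous:
      "0 < t \<Longrightarrow> z \<noteq> 0 \<Longrightarrow> k (t *\<^sub>R z) = (1 / t ^ (DIM('a) - 1)) *\<^sub>R k z"
    and kernel_bounds_continuous: "continuous_on (- {0}) k"
    and kernel_bounds_size: "z \<noteq> 0 \<Longrightarrow> norm (k z) \<le> N / norm z ^ (DIM('a) - 1)"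
    and kernel_bounds_diff: "0 < \<rho> \<Longrightarrow> (\<And>s. s \<in> {0..1} \<Longrightarrow> \<rho> \<le> norm (z + s *\<^sub>R a)) \<Longrightarrow>
        norm (k (z + a) - k z) \<le> N * norm a / \<rho> ^ DIM('a)"
    and kernel_bounds_diff2: "0 < \<rho> \<Longrightarrow>
        (\<And>s. s \<in> {0..1} \<Longrightarrow> \<rho> \<le> norm (z + s *\<^sub>R a) \<and> \<rho> \<le> norm (z' + s *\<^sub>R a')) \<Longrightarrow>
        norm (k (z + a) - k z - (k (z' + a') - k z')) \<le>
          N * (norm (a - a') / \<rho> ^ DIM('a) + norm a' * (norm (z - z') + norm (a - a')) / \<rho> ^ (DIM('a) + 1))"
proof -
  note c = assms[unfolded kernel_bounds_def]
  show "0 \<le> N"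
    using c[THEN conjunct1] by blast
  show "z \<noteq> 0 \<Longrightarrow> k (- z) = - k z"
    using c[THEN conjunct2, THEN conjunct1] by blast
  show "0 < t \<Longrightarrow> z \<noteq> 0 \<Longrightarrow> k (t *\<^sub>R z) = (1 / t ^ (DIM('a) - 1)) *\<^sub>R k z"
    using c[THEN conjunct2, THEN conjunct2, THEN conjunct1] by blast
  show "continuous_on (- {0}) k"
    using c[THEN conjunct2, THEN conjunct2, THEN conjunct2, THEN conjunct1] by blast
  show "z \<noteq> 0 \<Longrightarrow> norm (k z) \<le> N / norm z ^ (DIM('a) - 1)"
    using c[THEN conjunct2, THEN conjunct2, THEN conjunct2, THEN conjunct2, THEN conjunct1] by blast
  show "norm (k (z + a) - k z) \<le> N * norm a / \<rho> ^ DIM('a)"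
    if "0 < \<rho>" "\<And>s. s \<in> {0..1} \<Longrightarrow> \<rho> \<le> norm (z + s *\<^sub>R a)"
    using c[THEN conjunct2, THEN conjunct2, THEN conjunct2, THEN conjunct2, THEN conjunct2, THEN conjunct1] that by blast
  show "norm (k (z + a) - k z - (k (z' + a') - k z')) \<le>
          N * (norm (a - a') / \<rho> ^ DIM('a) + norm a' * (norm (z - z') + norm (a - a')) / \<rho> ^ (DIM('a) + 1))"
    if "0 < \<rho>" "\<And>s. s \<in> {0..1} \<Longrightarrow> \<rho> \<le> norm (z + s *\<^sub>R a) \<and> \<rho> \<le> norm (z' + s *\<^sub>R a')"
    using c[THEN conjunct2, THEN conjunct2, THEN conjunct2, THEN conjunct2, THEN conjunct2, THEN conjunct2] that by blast
qed

text \<open>Differentiating the homogeneity relation shows that D is homogeneous of degree -n with n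
  = \<open>DIM('a)\<close>, so bounds on the unit sphere control D everywhere. The mean value
  inequality along the segments then bounds first and second differences. The factor
  \<open>DIM('a) + 2\<close> is the one of \<open>homogeneous_lipschitz\<close> for j = n.\<close>

lemma kernel_boundsI:
  fixes k :: "'a::euclidean_space \<Rightarrow> complex"
  assumes odd: "\<And>z. z \<noteq> 0 \<Longrightarrow> k (- z) = - k z"
    and hom: "\<And>t z. 0 < t \<Longrightarrow> z \<noteq> 0 \<Longrightarrow> k (t *\<^sub>R z) = (1 / t ^ (DIM('a) - 1)) *\<^sub>R k z"
    and der: "\<And>z. z \<noteq> 0 \<Longrightarrow> (k has_derivative blinfun_apply (D z)) (at z)"
    and bound: "\<And>z. norm z = 1 \<Longrightarrow> norm (k z) \<le> A"
    and D_bound: "\<And>z. norm z = 1 \<Longrightarrow> norm (D z) \<le> A"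
    and D_lip: "\<And>z z'. norm z = 1 \<Longrightarrow> norm z' = 1 \<Longrightarrow> norm (D z - D z') \<le> A * norm (z - z')"
    and A: "0 \<le> A"
  shows "kernel_bounds ((real DIM('a) + 2) * A) k"
proof -
  let ?N = "(real DIM('a) + 2) * A"
  have AN: "A \<le> ?N" using A by (simp add: algebra_simps)
  have scal: "z = norm z *\<^sub>R ((1 / norm z) *\<^sub>R z)" "norm ((1 / norm z) *\<^sub>R z) = 1"
    if "z \<noteq> 0" for z :: 'a using that by auto
  \<comment> \<open>The derivative of x \<mapsto> k (t x) is computed once by the chain rule and
    once from homogeneity of k; uniqueness of derivatives compares the two.\<close>
  have D_hom: "D (t *\<^sub>R z) = (1 / t ^ DIM('a)) *\<^sub>R D z" if t: "0 < t" and z: "z \<noteq> 0" for t z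
  proof -
    have 1: "((\<lambda>x. k (t *\<^sub>R x)) has_derivative (\<lambda>h. D (t *\<^sub>R z) (t *\<^sub>R h))) (at z)"
    proof -
      have "((\<lambda>x. t *\<^sub>R x) has_derivative (\<lambda>h. t *\<^sub>R h)) (at z)"
        by (auto intro!: derivative_eq_intros)
      moreover have "t *\<^sub>R z \<noteq> 0" using t z by simp
      ultimately show ?thesis using has_derivative_compose[OF _ der] by blast
    qed
    have 2: "((\<lambda>x. k (t *\<^sub>R x)) has_derivative (\<lambda>h. (1 / t ^ (DIM('a) - 1)) *\<^sub>R D z h)) (at z)"
    proof (rule has_derivative_transform_within_open[of _ _ _ _ "- {0}"])
      show "((\<lambda>x. (1 / t ^ (DIM('a) - 1)) *\<^sub>R k x) has_derivative
            (\<lambda>h. (1 / t ^ (DIM('a) - 1)) *\<^sub>R D z h)) (at z)"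
        using der[OF z] by (auto intro!: derivative_eq_intros)
    qed (use z t hom in auto)
    have "D (t *\<^sub>R z) (t *\<^sub>R h) = (1 / t ^ (DIM('a) - 1)) *\<^sub>R D z h" for h
      using has_derivative_unique[OF 1 2] by metis
    then have *: "t *\<^sub>R D (t *\<^sub>R z) h = (1 / t ^ (DIM('a) - 1)) *\<^sub>R D z h" for h
      by (simp add: blinfun.scaleR_right)
    have "D (t *\<^sub>R z) h = (1 / t ^ DIM('a)) *\<^sub>R D z h" for h
    proof -
      have "D (t *\<^sub>R z) h = (1 / t) *\<^sub>R (t *\<^sub>R D (t *\<^sub>R z) h)"
        using t by simp
      also have "\<dots> = (1 / t) *\<^sub>R ((1 / t ^ (DIM('a) - 1)) *\<^sub>R D z h)"
        by (simp only: *)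
      finally show ?thesis by (simp add: power_DIM_Suc)
    qed
    then show ?thesis
      by (intro blinfun_eqI) (auto simp: blinfun.scaleR_left)
  qed
  have kb: "norm (k z) \<le> A / norm z ^ (DIM('a) - 1)" if z: "z \<noteq> 0" for z
  proof -
    have "k z = (1 / norm z ^ (DIM('a) - 1)) *\<^sub>R k ((1 / norm z) *\<^sub>R z)"
      by (metis hom scal norm_zero zero_less_norm_iff z zero_neq_one)
    then show ?thesis using bound[OF scal(2)[OF z]] by (simp add: divide_right_mono)
  qed
  have Db: "norm (D z) \<le> A / \<rho> ^ DIM('a)" if "0 < \<rho>" "\<rho> \<le> norm z" for z \<rho>
  proof -
    have z: "z \<noteq> 0" using that by auto
    have "D z = (1 / norm z ^ DIM('a)) *\<^sub>R D ((1 / norm z) *\<^sub>R z)"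
      by (metis D_hom scal norm_zero zero_less_norm_iff z zero_neq_one)
    then have "norm (D z) \<le> A / norm z ^ DIM('a)"
      using D_bound[OF scal(2)[OF z]] by (simp add: divide_right_mono)
    also have "\<dots> \<le> A / \<rho> ^ DIM('a)"
      using that A z by (intro divide_left_mono power_mono) auto
    finally show ?thesis .
  qed
  have Dl: "norm (D z - D z') \<le> ?N * norm (z - z') / \<rho> ^ (DIM('a) + 1)"
    if "0 < \<rho>" "\<rho> \<le> norm z" "\<rho> \<le> norm z'" for z z' \<rho>
    by (rule homogeneous_lipschitz[where f = D and j = "DIM('a)" and A = A, OF D_hom D_bound D_lip that])
  have K2: "norm (k (z + a) - k z) \<le> A * norm a / \<rho> ^ DIM('a)"
    if \<rho>: "0 < \<rho>" and seg: "\<And>s. s \<in> {0..1} \<Longrightarrow> \<rho> \<le> norm (z + s *\<^sub>R a)" for z a \<rho>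
  proof -
    let ?\<psi> = "\<lambda>s. k (z + s *\<^sub>R a)"
    have "(?\<psi> has_derivative (\<lambda>h. D (z + s *\<^sub>R a) (h *\<^sub>R a))) (at s within {0..1})" if "s \<in> {0..1}" for s
    proof -
      have "((\<lambda>s. z + s *\<^sub>R a) has_derivative (\<lambda>h. h *\<^sub>R a)) (at s within {0..1})"
        by (auto intro!: derivative_eq_intros)
      moreover have "z + s *\<^sub>R a \<noteq> 0" using seg[OF that] \<rho> by auto
      ultimately show ?thesis using has_derivative_compose[OF _ der] by blast
    qed
    then have "norm (?\<psi> 1 - ?\<psi> 0) \<le> (A * norm a / \<rho> ^ DIM('a)) * norm (1 - 0 :: real)"
    proof (rule differentiable_bound[OF convex_real_interval(5)])
      fix s :: real assume s: "s \<in> {0..1}"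
      show "onorm (\<lambda>h. D (z + s *\<^sub>R a) (h *\<^sub>R a)) \<le> A * norm a / \<rho> ^ DIM('a)"
      proof (rule onorm_le)
        fix h :: real
        have "norm (D (z + s *\<^sub>R a) (h *\<^sub>R a)) \<le> norm (D (z + s *\<^sub>R a)) * norm (h *\<^sub>R a)"
          by (rule norm_blinfun)
        also have "\<dots> \<le> A / \<rho> ^ DIM('a) * norm (h *\<^sub>R a)"
          using Db[OF \<rho> seg[OF s]] by (intro mult_right_mono) auto
        finally show "norm (D (z + s *\<^sub>R a) (h *\<^sub>R a)) \<le> A * norm a / \<rho> ^ DIM('a) * norm h"
          by (simp add: mult_ac)
      qed
    qed auto
    then show ?thesis by simp
  qed
  have K3: "norm (k (z + a) - k z - (k (z' + a') - k z')) \<le>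
          ?N * (norm (a - a') / \<rho> ^ DIM('a) + norm a' * (norm (z - z') + norm (a - a')) / \<rho> ^ (DIM('a) + 1))"
    if \<rho>: "0 < \<rho>" and seg: "\<And>s. s \<in> {0..1} \<Longrightarrow> \<rho> \<le> norm (z + s *\<^sub>R a) \<and> \<rho> \<le> norm (z' + s *\<^sub>R a')"
    for z a z' a' \<rho>
  proof -
    let ?\<psi> = "\<lambda>s. k (z + s *\<^sub>R a) - k (z' + s *\<^sub>R a')"
    let ?B = "?N * (norm (a - a') / \<rho> ^ DIM('a) + norm a' * (norm (z - z') + norm (a - a')) / \<rho> ^ (DIM('a) + 1))"
    have "(?\<psi> has_derivative (\<lambda>h. D (z + s *\<^sub>R a) (h *\<^sub>R a) - D (z' + s *\<^sub>R a') (h *\<^sub>R a')))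
       (at s within {0..1})" if s: "s \<in> {0..1}" for s
    proof -
      have "((\<lambda>s. z + s *\<^sub>R a) has_derivative (\<lambda>h. h *\<^sub>R a)) (at s within {0..1})" for z a :: 'a
        by (auto intro!: derivative_eq_intros)
      moreover have "z + s *\<^sub>R a \<noteq> 0" "z' + s *\<^sub>R a' \<noteq> 0" using seg[OF s] \<rho> by auto
      ultimately show ?thesis
        using has_derivative_compose[OF _ der] by (intro has_derivative_diff) blast+
    qed
    then have "norm (?\<psi> 1 - ?\<psi> 0) \<le> ?B * norm (1 - 0 :: real)"
    proof (rule differentiable_bound[OF convex_real_interval(5)])
      fix s :: real assume s: "s \<in> {0..1}"
      show "onorm (\<lambda>h. D (z + s *\<^sub>R a) (h *\<^sub>R a) - D (z' + s *\<^sub>R a') (h *\<^sub>R a')) \<le> ?B"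
      proof (rule onorm_le)
        fix h :: real
        \<comment> \<open>The increment is split so that the size of D multiplies a - a', and only
          a' meets the Lipschitz estimate for D.\<close>
        have "D (z + s *\<^sub>R a) (h *\<^sub>R a) - D (z' + s *\<^sub>R a') (h *\<^sub>R a') =
            h *\<^sub>R (D (z + s *\<^sub>R a) (a - a') + (D (z + s *\<^sub>R a) - D (z' + s *\<^sub>R a')) a')"
          by (simp add: blinfun.scaleR_right blinfun.diff_right blinfun.diff_left algebra_simps)
        also have "norm \<dots> \<le> \<bar>h\<bar> * (norm (D (z + s *\<^sub>R a) (a - a')) + norm ((D (z + s *\<^sub>R a) - D (z' + s *\<^sub>R a')) a'))"
          by (auto intro!: mult_left_mono norm_triangle_ineq)
        also have "\<dots> \<le> \<bar>h\<bar> * (?N / \<rho> ^ DIM('a) * norm (a - a') +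
            (?N * (norm (z - z') + norm (a - a')) / \<rho> ^ (DIM('a) + 1)) * norm a')"
        proof (intro mult_left_mono add_mono)
          have "norm (D (z + s *\<^sub>R a) (a - a')) \<le> norm (D (z + s *\<^sub>R a)) * norm (a - a')"
            by (rule norm_blinfun)
          also have "norm (D (z + s *\<^sub>R a)) \<le> ?N / \<rho> ^ DIM('a)"
            using Db[OF \<rho>, of "z + s *\<^sub>R a"] seg[OF s] AN \<rho>
            by (meson divide_right_mono order_trans zero_le_power less_imp_le)
          finally show "norm (D (z + s *\<^sub>R a) (a - a')) \<le> ?N / \<rho> ^ DIM('a) * norm (a - a')"
            by (simp add: mult_right_mono)
          have "norm (D (z + s *\<^sub>R a) - D (z' + s *\<^sub>R a'))
              \<le> ?N * norm ((z + s *\<^sub>R a) - (z' + s *\<^sub>R a')) / \<rho> ^ (DIM('a) + 1)"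
            using Dl[OF \<rho>] seg[OF s] by blast
          also have "\<dots> \<le> ?N * (norm (z - z') + norm (a - a')) / \<rho> ^ (DIM('a) + 1)"
          proof -
            have "(z + s *\<^sub>R a) - (z' + s *\<^sub>R a') = (z - z') + s *\<^sub>R (a - a')"
              by (simp add: algebra_simps)
            then have "norm ((z + s *\<^sub>R a) - (z' + s *\<^sub>R a')) \<le> norm (z - z') + norm (s *\<^sub>R (a - a'))"
              by (metis norm_triangle_ineq)
            also have "\<dots> \<le> norm (z - z') + norm (a - a')"
              using s by (auto intro!: mult_left_le_one_le)
            finally show ?thesis
              using A \<rho> by (intro divide_right_mono mult_left_mono) auto
          qed
          finally show "norm ((D (z + s *\<^sub>R a) - D (z' + s *\<^sub>R a')) a')
             \<le> (?N * (norm (z - z') + norm (a - a')) / \<rho> ^ (DIM('a) + 1)) * norm a'"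
            by (meson norm_blinfun mult_right_mono norm_ge_zero order_trans)
        qed auto
        finally show "norm (D (z + s *\<^sub>R a) (h *\<^sub>R a) - D (z' + s *\<^sub>R a') (h *\<^sub>R a')) \<le> ?B * norm h"
          by (simp add: algebra_simps add_divide_distrib)
      qed
    qed auto
    then have "norm (?\<psi> 1 - ?\<psi> 0) \<le> ?B" by (simp only: diff_zero norm_one mult_1_right)
    moreover have "k (z + a) - k z - (k (z' + a') - k z') = ?\<psi> 1 - ?\<psi> 0" by simp
    ultimately show ?thesis by (simp only:)
  qed
  show ?thesis
    unfolding kernel_bounds_def
  proof (intro conjI allI impI)
    show "0 \<le> ?N" using A by simp
    show "continuous_on (- {0}) k"
      by (intro continuous_at_imp_continuous_on ballI has_derivative_continuous[OF der]) auto
    show "norm (k z) \<le> ?N / norm z ^ (DIM('a) - 1)" if "z \<noteq> 0" for z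
      using kb[OF that] AN by (meson divide_right_mono order_trans zero_le_power norm_ge_zero)
    show "norm (k (z + a) - k z) \<le> ?N * norm a / \<rho> ^ DIM('a)"
      if "0 < \<rho>" "\<forall>s\<in>{0..1}. \<rho> \<le> norm (z + s *\<^sub>R a)" for z a \<rho>
    proof -
      have "norm (k (z + a) - k z) \<le> A * norm a / \<rho> ^ DIM('a)" using K2 that by blast
      also have "\<dots> \<le> ?N * norm a / \<rho> ^ DIM('a)"
        using AN that by (intro divide_right_mono mult_right_mono) auto
      finally show ?thesis .
    qed
    show "norm (k (z + a) - k z - (k (z' + a') - k z')) \<le>
          ?N * (norm (a - a') / \<rho> ^ DIM('a) + norm a' * (norm (z - z') + norm (a - a')) / \<rho> ^ (DIM('a) + 1))"
      if "0 < \<rho>" "\<forall>s\<in>{0..1}. \<rho> \<le> norm (z + s *\<^sub>R a) \<and> \<rho> \<le> norm (z' + s *\<^sub>R a')" for z a z' a' \<rho>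
      using K3 that by blast
  qed (fact odd hom)+
qed

text \<open>Passing to a chart composes the kernel with the inverse of the chart rotation. All
  conditions speak of norms and segments only, so the same N serves.\<close>

lemma kernel_bounds_isometry:
  fixes k :: "'a::euclidean_space \<Rightarrow> complex" and Q :: "'a \<Rightarrow> 'a"
  assumes k: "kernel_bounds N k" and Q: "orthogonal_transformation Q"
  shows "kernel_bounds N (\<lambda>z. k (Q z))"
proof -
  have lin: "linear Q" and nrm: "norm (Q z) = norm z" for z
    using Q by (auto simp: orthogonal_transformation)
  have nz: "Q z \<noteq> 0" if "z \<noteq> 0" for z using nrm that by (metis norm_eq_zero)
  have Qs: "Q (z + s *\<^sub>R a) = Q z + s *\<^sub>R Q a" "Q (z + a) = Q z + Q a" for z a s
    by (auto simp: linear_add[OF lin] linear_scale[OF lin])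
  have nrm2: "norm (Q z + s *\<^sub>R Q a) = norm (z + s *\<^sub>R a)" "norm (Q z - Q a) = norm (z - a)" for z a s
    by (simp_all only: Qs(1)[symmetric] linear_diff[OF lin, symmetric] nrm)
  have cont: "continuous_on (- {0}) (\<lambda>z. k (Q z))"
  proof (rule continuous_on_compose2[where g = k and t = "- {0}"])
    show "continuous_on (- {0}) k" using k by (simp add: kernel_bounds_def)
    show "continuous_on (- {0}) Q"
      using lin by (simp add: linear_continuous_on linear_linear)
    show "Q ` (- {0}) \<subseteq> - {0}" by (rule image_subsetI) (simp add: nz)
  qed
  have "norm (k (Q (z + a)) - k (Q z)) \<le> N * norm a / \<rho> ^ DIM('a)"
    if "0 < \<rho>" "\<forall>s\<in>{0..1}. \<rho> \<le> norm (z + s *\<^sub>R a)" for z a \<rho>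
  proof -
    have "norm (k (Q z + Q a) - k (Q z)) \<le> N * norm (Q a) / \<rho> ^ DIM('a)"
      by (rule kernel_bounds_diff[OF k that(1)]) (use that(2) in \<open>simp add: nrm2\<close>)
    then show ?thesis by (simp add: Qs nrm)
  qed
  moreover have "norm (k (Q (z + a)) - k (Q z) - (k (Q (z' + a')) - k (Q z'))) \<le>
          N * (norm (a - a') / \<rho> ^ DIM('a) + norm a' * (norm (z - z') + norm (a - a')) / \<rho> ^ (DIM('a) + 1))"
    if "0 < \<rho>" "\<forall>s\<in>{0..1}. \<rho> \<le> norm (z + s *\<^sub>R a) \<and> \<rho> \<le> norm (z' + s *\<^sub>R a')" for z a z' a' \<rho>
  proof -
    have "norm (k (Q z + Q a) - k (Q z) - (k (Q z' + Q a') - k (Q z'))) \<le>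
          N * (norm (Q a - Q a') / \<rho> ^ DIM('a) + norm (Q a') * (norm (Q z - Q z') + norm (Q a - Q a')) / \<rho> ^ (DIM('a) + 1))"
      by (rule kernel_bounds_diff2[OF k that(1)]) (use that(2) in \<open>simp add: nrm2\<close>)
    then show ?thesis by (simp add: Qs nrm nrm2)
  qed
  ultimately show ?thesis
    using cont kernel_bounds_nonneg[OF k] kernel_bounds_odd[OF k nz] kernel_bounds_homogeneous[OF k _ nz]
      kernel_bounds_size[OF k nz]
    unfolding kernel_bounds_def
    by (auto simp: linear_neg[OF lin] linear_scale[OF lin] nrm)
qed

section \<open>Radial integrals\<close>

definition sphere_area :: "'a::euclidean_space itself \<Rightarrow> real" where
  "sphere_area _ = real DIM('a) * unit_ball_vol (real DIM('a))"

lemma sphere_area_nonneg [simp]: "0 \<le> sphere_area TYPE('a::euclidean_space)"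
  by (simp add: sphere_area_def unit_ball_vol_nonneg)

text \<open>Polar coordinates for radial functions: both measures give the half line up to a the
  volume of the ball of radius a, since the density is the derivative of that volume. Agreement on
  half lines suffices because they generate the Borel sets and are stable under
  intersection.\<close>

lemma distr_norm_lborel:
  "distr (lborel :: 'a::euclidean_space measure) borel norm =
     density lborel (\<lambda>r. ennreal (sphere_area TYPE('a) * r ^ (DIM('a) - 1)) * indicator {0..} r)"
    (is "?M = ?N")
proof (rule measure_eqI_generator_eq_countable[where E = "range (\<lambda>a::real. {..a})"
        and \<Omega> = UNIV and A = "range (\<lambda>n::nat. {..real n})"])
  have M: "emeasure ?M {..a} = ennreal (unit_ball_vol (real DIM('a)) * a ^ DIM('a))" if "0 \<le> a" for a
  proof -
    have "norm -` {..a} \<inter> space (lborel :: 'a measure) = cball 0 a"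
      by (auto simp: dist_norm)
    then show ?thesis
      using that by (subst emeasure_distr) (auto simp: emeasure_cball)
  qed
  have N: "emeasure ?N {..a} = ennreal (unit_ball_vol (real DIM('a)) * a ^ DIM('a))" if "0 \<le> a" for a
  proof -
    have "emeasure ?N {..a} =
        (\<integral>\<^sup>+r. ennreal (sphere_area TYPE('a) * r ^ (DIM('a) - 1)) * indicator {0..} r * indicator {..a} r \<partial>lborel)"
      by (subst emeasure_density) auto
    also have "\<dots> = (\<integral>\<^sup>+r. ennreal (sphere_area TYPE('a) * r ^ (DIM('a) - 1)) * indicator {0..a} r \<partial>lborel)"
      by (intro nn_integral_cong) (auto simp: indicator_def)
    also have "\<dots> = ennreal (unit_ball_vol (real DIM('a)) * a ^ DIM('a) - unit_ball_vol (real DIM('a)) * 0 ^ DIM('a))"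
      using that by (intro nn_integral_FTC_Icc)
        (auto intro!: derivative_eq_intros mult_nonneg_nonneg simp: sphere_area_def)
    finally show ?thesis by (simp add: zero_power)
  qed
  have neg: "emeasure ?M {..a} = 0" "emeasure ?N {..a} = 0" if "a < 0" for a
  proof -
    have "norm -` {..a} \<inter> space (lborel :: 'a measure) = {}"
      using that by (auto simp: not_le) (meson norm_ge_zero order.strict_trans1 not_le)
    then show "emeasure ?M {..a} = 0" by (subst emeasure_distr) auto
    have "emeasure ?N {..a} =
        (\<integral>\<^sup>+r. ennreal (sphere_area TYPE('a) * r ^ (DIM('a) - 1)) * indicator {0..} r * indicator {..a} r \<partial>lborel)"
      by (subst emeasure_density) auto
    also have "\<dots> = (\<integral>\<^sup>+(r::real). 0 \<partial>lborel)"
      using that by (intro nn_integral_cong) (auto simp: indicator_def)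
    finally show "emeasure ?N {..a} = 0" by simp
  qed
  fix X :: "real set" assume "X \<in> range (\<lambda>a. {..a})"
  then show "emeasure ?M X = emeasure ?N X"
    using M N neg by (metis (no_types, lifting) image_iff linorder_not_le)
next
  fix a assume "a \<in> range (\<lambda>n::nat. {..real n})"
  then obtain n where a: "a = {..real n}" by auto
  have "norm -` {..real n} \<inter> space (lborel :: 'a measure) = cball 0 (real n)"
    by (auto simp: dist_norm)
  then show "emeasure ?M a \<noteq> \<infinity>"
    unfolding a by (subst emeasure_distr) (auto simp: emeasure_cball)
next
  show "(\<Union>(range (\<lambda>n::nat. {..real n}))) = UNIV"
    by (auto intro: real_arch_simple)
qed (auto simp: Int_stable_def borel_eq_atMost intro!: sets_measure_of)

lemma nn_integral_norm:
  fixes f :: "real \<Rightarrow> ennreal"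
  assumes [measurable]: "f \<in> borel_measurable borel"
  shows "(\<integral>\<^sup>+(x::'a::euclidean_space). f (norm x) \<partial>lborel) =
    (\<integral>\<^sup>+r. ennreal (sphere_area TYPE('a) * r ^ (DIM('a) - 1)) * indicator {0..} r * f r \<partial>lborel)"
proof -
  have "(\<integral>\<^sup>+(x::'a). f (norm x) \<partial>lborel) = (\<integral>\<^sup>+r. f r \<partial>distr (lborel :: 'a measure) borel norm)"
    by (subst nn_integral_distr) auto
  then show ?thesis
    unfolding distr_norm_lborel by (simp add: nn_integral_density)
qed

text \<open>Only the majorant g needs an antiderivative. The inequality between
  \<open>r ^ (DIM('a) - 1) * f r\<close> and \<open>g r\<close>, in place of an equality, also
  admits r = 0, where a quotient with zero denominator has the value 0.\<close>

lemma radial_integral_le: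
  fixes f F :: "real \<Rightarrow> real"
  assumes [measurable]: "f \<in> borel_measurable borel" and "a \<le> b" "0 \<le> a"
    and f: "\<And>r. a \<le> r \<Longrightarrow> r \<le> b \<Longrightarrow> 0 \<le> f r \<and> r ^ (DIM('a) - 1) * f r \<le> g r"
    and F: "\<And>r. a \<le> r \<Longrightarrow> r \<le> b \<Longrightarrow> (F has_real_derivative g r) (at r)"
    and [measurable]: "g \<in> borel_measurable borel"
  shows "(\<integral>\<^sup>+(x::'a::euclidean_space). ennreal (f (norm x)) * indicator {a..b} (norm x) \<partial>lborel)
    \<le> ennreal (sphere_area TYPE('a) * (F b - F a))"
proof -
  let ?c = "sphere_area TYPE('a)"
  have g: "0 \<le> g r" if "a \<le> r" "r \<le> b" for r
    using f[OF that] that \<open>0 \<le> a\<close> by (meson order_trans zero_le_power mult_nonneg_nonneg)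
  have "(\<integral>\<^sup>+(x::'a). ennreal (f (norm x)) * indicator {a..b} (norm x) \<partial>lborel) =
    (\<integral>\<^sup>+r. ennreal (?c * r ^ (DIM('a) - 1)) * indicator {0..} r * (ennreal (f r) * indicator {a..b} r) \<partial>lborel)"
    by (rule nn_integral_norm) auto
  also have "\<dots> \<le> (\<integral>\<^sup>+r. ennreal (?c * g r) * indicator {a..b} r \<partial>lborel)"
  proof (intro nn_integral_mono, goal_cases)
    case (1 r)
    show ?case
    proof (cases "a \<le> r \<and> r \<le> b")
      case True
      then have "?c * (r ^ (DIM('a) - 1) * f r) \<le> ?c * g r"
        using f by (intro mult_left_mono) auto
      with True f[of r] \<open>0 \<le> a\<close> show ?thesis
        by (auto simp: indicator_def ennreal_mult[symmetric] mult.assoc intro!: ennreal_leI)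
    qed (auto simp: indicator_def)
  qed
  also have "\<dots> = ennreal (?c * F b - ?c * F a)"
    using assms g by (intro nn_integral_FTC_Icc) (auto intro!: derivative_eq_intros)
  finally show ?thesis by (simp add: right_diff_distrib)
qed

lemma radial_integral_le_linear:
  assumes "0 \<le> a" "a \<le> b"
  shows "(\<integral>\<^sup>+(x::'a::euclidean_space). ennreal (1 / norm x ^ (DIM('a) - 1)) * indicator {a..b} (norm x) \<partial>lborel)
    \<le> ennreal (sphere_area TYPE('a) * (b - a))"
  using assms
  by (intro radial_integral_le[where f = "\<lambda>r. 1 / r ^ (DIM('a) - 1)" and F = "\<lambda>r. r" and g = "\<lambda>_. 1"])
     (auto intro!: derivative_eq_intros)

text \<open>The borderline exponent: this integral is the source of the logarithm in
  \<open>omega1\<close>, and a has to stay positive.\<close>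

lemma radial_integral_le_ln:
  assumes "0 < a" "a \<le> b"
  shows "(\<integral>\<^sup>+(x::'a::euclidean_space). ennreal (1 / norm x ^ DIM('a)) * indicator {a..b} (norm x) \<partial>lborel)
    \<le> ennreal (sphere_area TYPE('a) * (ln b - ln a))"
proof (intro radial_integral_le[where f = "\<lambda>r. 1 / r ^ DIM('a)" and F = ln and g = "\<lambda>r. 1 / r"])
  show "0 \<le> 1 / r ^ DIM('a) \<and> r ^ (DIM('a) - 1) * (1 / r ^ DIM('a)) \<le> 1 / r" if "a \<le> r" "r \<le> b" for r
    using that assms by (auto simp: power_DIM_Suc)
qed (use assms in \<open>auto intro!: derivative_eq_intros\<close>)

text \<open>The exponent that remains after oddness has gained one order. For a = t the bound 1/a
  cancels a factor t in the integrand.\<close>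

lemma radial_integral_le_inverse:
  assumes "0 < a" "a \<le> b"
  shows "(\<integral>\<^sup>+(x::'a::euclidean_space). ennreal (1 / norm x ^ (DIM('a) + 1)) * indicator {a..b} (norm x) \<partial>lborel)
    \<le> ennreal (sphere_area TYPE('a) * (1 / a - 1 / b))"
proof -
  have "(\<integral>\<^sup>+(x::'a). ennreal (1 / norm x ^ (DIM('a) + 1)) * indicator {a..b} (norm x) \<partial>lborel)
    \<le> ennreal (sphere_area TYPE('a) * ((- 1 / b) - (- 1 / a)))"
  proof (intro radial_integral_le[where f = "\<lambda>r. 1 / r ^ (DIM('a) + 1)" and F = "\<lambda>r. - 1 / r" and g = "\<lambda>r. 1 / r^2"])
    show "0 \<le> 1 / r ^ (DIM('a) + 1) \<and> r ^ (DIM('a) - 1) * (1 / r ^ (DIM('a) + 1)) \<le> 1 / r\<^sup>2"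
      if "a \<le> r" "r \<le> b" for r
      using that assms by (auto simp: power_DIM_Suc power2_eq_square)
    show "((\<lambda>r. - 1 / r) has_real_derivative 1 / r\<^sup>2) (at r)" if "a \<le> r" "r \<le> b" for r
      using that assms by (auto intro!: derivative_eq_intros simp: power2_eq_square)
  qed (use assms in auto)
  then show ?thesis by simp
qed

section \<open>Integrals over flat discs\<close>

lemma lborel_integral_affine:
  fixes f :: "'v::euclidean_space \<Rightarrow> 'b::{banach, second_countable_topology}"
  assumes [measurable]: "f \<in> borel_measurable borel" and c: "c \<noteq> 0"
  shows "(\<integral>x. f x \<partial>lborel) = \<bar>c\<bar> ^ DIM('v) *\<^sub>R (\<integral>x. f (t + c *\<^sub>R x) \<partial>lborel)"
proof -
  have "(\<integral>x. f x \<partial>lborel) =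
      (\<integral>x. f x \<partial>density (distr lborel borel (\<lambda>x. t + c *\<^sub>R x)) (\<lambda>_. \<bar>c\<bar> ^ DIM('v)))"
    using lborel_affine[OF c, of t] by simp
  also have "\<dots> = (\<integral>x. \<bar>c\<bar> ^ DIM('v) *\<^sub>R f x \<partial>distr lborel borel (\<lambda>x. t + c *\<^sub>R x))"
    by (subst integral_density) auto
  also have "\<dots> = (\<integral>x. \<bar>c\<bar> ^ DIM('v) *\<^sub>R f (t + c *\<^sub>R x) \<partial>lborel)"
    by (subst integral_distr) auto
  finally show ?thesis by simp
qed

lemma lborel_integral_scale:
  fixes f :: "'v::euclidean_space \<Rightarrow> 'b::{banach, second_countable_topology}"
  assumes "f \<in> borel_measurable borel" and "c \<noteq> 0"
  shows "(\<integral>x. f x \<partial>lborel) = \<bar>c\<bar> ^ DIM('v) *\<^sub>R (\<integral>x. f (c *\<^sub>R x) \<partial>lborel)"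
  using lborel_integral_affine[OF assms, of 0] by simp

lemma nn_integral_lborel_reflect_shift:
  fixes f :: "'v::euclidean_space \<Rightarrow> ennreal"
  assumes [measurable]: "f \<in> borel_measurable borel"
  shows "(\<integral>\<^sup>+x. f (\<xi> - x) \<partial>lborel) = (\<integral>\<^sup>+x. f x \<partial>lborel)"
proof -
  have "(\<integral>\<^sup>+x. f x \<partial>lborel) = (\<integral>\<^sup>+x. f x \<partial>density (distr lborel borel (\<lambda>x. \<xi> + (-1) *\<^sub>R x)) (\<lambda>_. \<bar>-1 :: real\<bar> ^ DIM('v)))"
    using lborel_affine[of "-1" \<xi>] by simp
  also have "\<dots> = (\<integral>\<^sup>+x. f (\<xi> - x) \<partial>lborel)"
    by (simp add: nn_integral_density nn_integral_distr)
  finally show ?thesis by simp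
qed

lemma set_lborel_integral_reflect:
  fixes f :: "'v::euclidean_space \<Rightarrow> 'b::{banach, second_countable_topology}"
  assumes [measurable]: "f \<in> borel_measurable borel" "S \<in> sets borel"
    and S: "\<And>x. - x \<in> S \<longleftrightarrow> x \<in> S"
  shows "(LINT x:S|lborel. f x) = (LINT x:S|lborel. f (- x))"
proof -
  have "(LINT x:S|lborel. f x) = (\<integral>x. indicator S (- x) *\<^sub>R f (- x) \<partial>lborel)"
    unfolding set_lebesgue_integral_def by (subst lborel_integral_scale[where c = "-1"]) auto
  also have "(\<lambda>x. indicator S (- x) :: real) = indicator S"
    using S by (auto simp: indicator_def)
  finally show ?thesis unfolding set_lebesgue_integral_def by metis
qed

lemma norm_set_integral_le:
  fixes f :: "'v::euclidean_space \<Rightarrow> 'b::{banach, second_countable_topology}"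
  assumes f: "set_integrable lborel S f"
    and le: "\<And>x. x \<in> S \<Longrightarrow> ennreal (norm (f x)) \<le> g x"
    and g: "(\<integral>\<^sup>+x. g x \<partial>lborel) \<le> ennreal B" and B: "0 \<le> B"
  shows "norm (LINT x:S|lborel. f x) \<le> B"
proof -
  have "ennreal (norm (LINT x:S|lborel. f x)) \<le> (\<integral>\<^sup>+x. ennreal (norm (indicator S x *\<^sub>R f x)) \<partial>lborel)"
    using f unfolding set_lebesgue_integral_def set_integrable_def by (rule integral_norm_bound_ennreal)
  also have "\<dots> \<le> (\<integral>\<^sup>+x. g x \<partial>lborel)"
    using le by (intro nn_integral_mono) (auto simp: indicator_def)
  also have "\<dots> \<le> ennreal B" by (rule g)
  finally show ?thesis using B by (simp add: ennreal_le_iff)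
qed

lemma set_integrable_bounded_ball:
  fixes f :: "'v::euclidean_space \<Rightarrow> 'b::{banach, second_countable_topology}"
  assumes [measurable]: "f \<in> borel_measurable borel" "S \<in> sets borel"
    and "bounded S" and "\<And>x. x \<in> S \<Longrightarrow> norm (f x) \<le> B"
  shows "set_integrable lborel S f"
  unfolding set_integrable_def
proof (rule integrableI_bounded_set[where A = S and B = B])
  show "emeasure lborel S < \<infinity>"
    using \<open>bounded S\<close> by (rule emeasure_bounded_finite)
qed (use assms in \<open>auto simp: indicator_def\<close>)

text \<open>The first summand is the near zone, a pointwise bound times the volume of the ball of
  radius t; the second is the far zone, where t times the integral of
  \<open>1 / norm x ^ (DIM('v) + 1)\<close> beyond radius t is at most the area of the unit
  sphere.\<close>

definition flat_const :: "'v::euclidean_space itself \<Rightarrow> real \<Rightarrow> real" where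
  "flat_const T \<Lambda> = (1 + \<Lambda>) ^ (DIM('v) + 1) * unit_ball_vol (real DIM('v)) + sphere_area T"

text \<open>The two bounds describe a profile of width t and height of order
  \<open>1 / t ^ DIM('v)\<close>, so its integral is bounded independently of t and \<rho>. Inside
  radius t the volume of the ball cancels the denominator; outside, t times the integral of r^(-2)
  from t on is at most 1.\<close>

lemma two_zone_integral_le:
  fixes f :: "'v::euclidean_space \<Rightarrow> complex"
  assumes f: "set_integrable lborel (ball 0 \<rho>) f"
    and near: "\<And>x. norm x \<le> t \<Longrightarrow> norm (f x) \<le> A * (1 + \<Lambda>) ^ (DIM('v) + 1) / t ^ DIM('v)"
    and far: "\<And>x. t \<le> norm x \<Longrightarrow> norm (f x) \<le> A * t / norm x ^ (DIM('v) + 1)"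
    and t: "0 < t" and A: "0 \<le> A" and \<Lambda>: "0 \<le> \<Lambda>"
  shows "norm (LINT x:ball 0 \<rho>|lborel. f x) \<le> A * flat_const TYPE('v) \<Lambda>"
proof (rule norm_set_integral_le[OF f])
  \<comment> \<open>The maximum covers the case \<rho> < t: the disc then has no point in the far
    zone, but the radial integral still needs ordered limits.\<close>
  let ?L = "(1 + \<Lambda>) ^ (DIM('v) + 1)" and ?m = "max t \<rho>"
  let ?g = "\<lambda>x::'v. ennreal (A * ?L / t ^ DIM('v)) * indicator (cball 0 t) x +
      ennreal (A * t) * (ennreal (1 / norm x ^ (DIM('v) + 1)) * indicator {t..?m} (norm x))"
  show "ennreal (norm (f x)) \<le> ?g x" if x: "x \<in> ball 0 \<rho>" for x
  proof (cases "norm x \<le> t")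
    case True
    then have "ennreal (norm (f x)) \<le> ennreal (A * ?L / t ^ DIM('v)) * indicator (cball 0 t) x"
      using near[OF True] by (auto simp: dist_norm intro!: ennreal_leI)
    then show ?thesis by (simp add: add_increasing2)
  next
    case False
    then have "ennreal (norm (f x)) \<le> ennreal (A * t * (1 / norm x ^ (DIM('v) + 1)))"
      using far[of x] by (auto intro!: ennreal_leI)
    also have "\<dots> = ennreal (A * t) * (ennreal (1 / norm x ^ (DIM('v) + 1)) * indicator {t..?m} (norm x))"
      using False x A t by (subst ennreal_mult) (auto simp: dist_norm)
    finally show ?thesis by (simp add: add_increasing)
  qed
  have [measurable]: "cball (0::'v) t \<in> sets borel" by simp
  have "(\<integral>\<^sup>+x. ?g x \<partial>lborel) = ennreal (A * ?L / t ^ DIM('v)) * emeasure lborel (cball (0::'v) t) +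
     ennreal (A * t) * (\<integral>\<^sup>+(x::'v). ennreal (1 / norm x ^ (DIM('v) + 1)) * indicator {t..?m} (norm x) \<partial>lborel)"
    by (subst nn_integral_add)
      (auto simp: nn_integral_cmult nn_integral_cmult_indicator simp del: power_Suc)
  also have "\<dots> \<le> ennreal (A * ?L * unit_ball_vol (real DIM('v))) + ennreal (A * t) * ennreal (sphere_area TYPE('v) * (1 / t))"
  proof (intro add_mono mult_left_mono)
    show "ennreal (A * ?L / t ^ DIM('v)) * emeasure lborel (cball (0::'v) t) \<le> ennreal (A * ?L * unit_ball_vol (real DIM('v)))"
      using t A \<Lambda> by (simp add: emeasure_cball ennreal_mult[symmetric])
    have "sphere_area TYPE('v) * (1 / t - 1 / ?m) \<le> sphere_area TYPE('v) * (1 / t)"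
      using t by (intro mult_left_mono) auto
    then show "(\<integral>\<^sup>+(x::'v). ennreal (1 / norm x ^ (DIM('v) + 1)) * indicator {t..?m} (norm x) \<partial>lborel)
        \<le> ennreal (sphere_area TYPE('v) * (1 / t))"
      using radial_integral_le_inverse[where 'a = 'v, of t ?m] t by (meson ennreal_leI max.cobounded1 order_trans)
  qed auto
  also have "\<dots> = ennreal (A * flat_const TYPE('v) \<Lambda>)"
    using t A \<Lambda> by (subst ennreal_mult[symmetric])
      (auto simp: flat_const_def algebra_simps simp flip: ennreal_plus)
  finally show "(\<integral>\<^sup>+x. ?g x \<partial>lborel) \<le> ennreal (A * flat_const TYPE('v) \<Lambda>)" .
  show "0 \<le> A * flat_const TYPE('v) \<Lambda>"
    using A \<Lambda> by (simp add: flat_const_def)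
qed

lemma norm_half_diff_le:
  fixes a b :: "'a::real_normed_vector"
  assumes "norm a \<le> X" "norm b \<le> X"
  shows "norm ((1 / 2) *\<^sub>R (a - b)) \<le> X"
  using norm_triangle_ineq4[of a b] assms by simp

text \<open>|t| is at most the absolute value of the last coordinate plus |l \<zeta>|, and the
  latter is at most \<Lambda> times the norm of the pair. The bound keeps the plane at height t away
  from the singularity, uniformly in the slope.\<close>

lemma norm_graph_ge:
  fixes l :: "'v::euclidean_space \<Rightarrow>\<^sub>L real"
  assumes l: "norm l \<le> \<Lambda>"
  shows "\<bar>t\<bar> / (1 + \<Lambda>) \<le> norm (\<zeta>, l \<zeta> - t)"
proof -
  have \<Lambda>: "0 \<le> \<Lambda>" using l norm_ge_zero order_trans by blast
  have "\<bar>l \<zeta>\<bar> \<le> \<Lambda> * norm \<zeta>"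
    using norm_blinfun[of l \<zeta>] mult_right_mono[OF l norm_ge_zero[of \<zeta>]] by simp
  also have "\<dots> \<le> \<Lambda> * norm (\<zeta>, l \<zeta> - t)"
    using \<Lambda> norm_fst_le[of \<zeta> "l \<zeta> - t"] by (intro mult_left_mono) auto
  finally have "\<bar>t\<bar> \<le> norm (\<zeta>, l \<zeta> - t) + \<Lambda> * norm (\<zeta>, l \<zeta> - t)"
    using norm_snd_le[of "l \<zeta> - t" \<zeta>] by auto
  then show ?thesis using \<Lambda> by (simp add: divide_le_eq algebra_simps)
qed

text \<open>The variable is the difference of two base points, so the disc is centred at 0 and
  invariant under reflection. The area element of the plane does not occur; it is part of the weight
  by which the integral is later multiplied.\<close>

definition flat_integral ::
  "('v::euclidean_space \<times> real \<Rightarrow> complex) \<Rightarrow> real \<Rightarrow> ('v \<Rightarrow>\<^sub>L real) \<Rightarrow> real \<Rightarrow> complex" where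
  "flat_integral k \<rho> l t = (LINT \<zeta>:ball 0 \<rho>|lborel. k (\<zeta>, l \<zeta> - t))"

context
  fixes k :: "'v::euclidean_space \<times> real \<Rightarrow> complex" and N :: real
  assumes k: "kernel_bounds N k"
begin

lemma flat_kernel_measurable:
  assumes "t \<noteq> 0"
  shows "(\<lambda>\<zeta>. k (\<zeta>, blinfun_apply l \<zeta> - t)) \<in> borel_measurable borel"
proof (intro borel_measurable_continuous_onI continuous_on_compose2[OF kernel_bounds_continuous[OF k]])
  show "continuous_on UNIV (\<lambda>\<zeta>. (\<zeta>, blinfun_apply l \<zeta> - t))"
    by (intro continuous_intros)
  show "(\<lambda>\<zeta>. (\<zeta>, blinfun_apply l \<zeta> - t)) ` UNIV \<subseteq> - {0}"
    using assms by (rule_tac image_subsetI) (auto simp: zero_prod_def)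
qed

lemma flat_kernel_le:
  assumes t: "t \<noteq> 0" and l: "norm l \<le> \<Lambda>"
  shows "norm (k (\<zeta>, blinfun_apply l \<zeta> - t)) \<le> N * (1 + \<Lambda>) ^ DIM('v) / \<bar>t\<bar> ^ DIM('v)"
proof -
  have \<Lambda>: "0 \<le> \<Lambda>" using l norm_ge_zero order_trans by blast
  let ?z = "(\<zeta>, blinfun_apply l \<zeta> - t)"
  have pos: "0 < \<bar>t\<bar> / (1 + \<Lambda>)" using t \<Lambda> by simp
  then have "?z \<noteq> 0" using norm_graph_ge[OF l, of t \<zeta>] by (metis norm_zero not_le)
  then have "norm (k ?z) \<le> N / norm ?z ^ DIM('v)"
    using kernel_bounds_size[OF k, of ?z] by simp
  also have "\<dots> \<le> N / (\<bar>t\<bar> / (1 + \<Lambda>)) ^ DIM('v)"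
    using norm_graph_ge[OF l, of t \<zeta>] pos kernel_bounds_nonneg[OF k]
    by (intro divide_left_mono power_mono mult_pos_pos zero_less_power) auto
  finally show ?thesis by (simp add: power_divide)
qed

lemma flat_kernel_integrable:
  assumes "t \<noteq> 0" "S \<in> sets borel" "bounded S"
  shows "set_integrable lborel S (\<lambda>\<zeta>. k (\<zeta>, blinfun_apply l \<zeta> - t))"
  by (rule set_integrable_bounded_ball[OF flat_kernel_measurable _ _ flat_kernel_le[OF _ order_refl]])
     (use assms in auto)

lemma flat_kernel_diff_integrable:
  assumes "t \<noteq> 0" "S \<in> sets borel" "bounded S"
  shows "set_integrable lborel S
    (\<lambda>\<zeta>. (1 / 2) *\<^sub>R (k (\<zeta>, blinfun_apply l \<zeta> - t) - k (\<zeta>, blinfun_apply l \<zeta> + t)))"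
proof (intro set_integrable_scaleR_right set_integral_diff impI)
  show "set_integrable lborel S (\<lambda>\<zeta>. k (\<zeta>, blinfun_apply l \<zeta> - t))"
    using assms by (rule flat_kernel_integrable)
  show "set_integrable lborel S (\<lambda>\<zeta>. k (\<zeta>, blinfun_apply l \<zeta> + t))"
    using flat_kernel_integrable[of "- t" S l] assms by simp
qed

text \<open>Reflection of \<zeta> together with oddness of k turns the integral at height t into
  minus the one at height -t. The half difference that replaces the kernel decays one order faster
  for large \<zeta>.\<close>

lemma flat_kernel_symmetrize:
  assumes t: "t \<noteq> 0" and S: "S \<in> sets borel" "bounded S" "\<And>x. - x \<in> S \<longleftrightarrow> x \<in> S"
  shows "(LINT \<zeta>:S|lborel. k (\<zeta>, blinfun_apply l \<zeta> - t)) =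
    (LINT \<zeta>:S|lborel. (1 / 2) *\<^sub>R (k (\<zeta>, blinfun_apply l \<zeta> - t) - k (\<zeta>, blinfun_apply l \<zeta> + t)))"
proof -
  let ?f = "\<lambda>t \<zeta>. k (\<zeta>, blinfun_apply l \<zeta> - t)"
  have eq: "?f t (- \<zeta>) = - ?f (- t) \<zeta>" for \<zeta>
  proof -
    have "(\<zeta>, blinfun_apply l \<zeta> + t) \<noteq> 0" using t by (auto simp: zero_prod_def)
    then have "k (- (\<zeta>, blinfun_apply l \<zeta> + t)) = - k (\<zeta>, blinfun_apply l \<zeta> + t)"
      by (rule kernel_bounds_odd[OF k])
    then show ?thesis by (simp add: blinfun.minus_right)
  qed
  have "(LINT \<zeta>:S|lborel. ?f t \<zeta>) = (LINT \<zeta>:S|lborel. ?f t (- \<zeta>))"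
    using S by (intro set_lborel_integral_reflect flat_kernel_measurable[OF t])
  also have "\<dots> = - (LINT \<zeta>:S|lborel. ?f (- t) \<zeta>)"
    unfolding eq by (simp add: set_lebesgue_integral_def)
  finally have 1: "(LINT \<zeta>:S|lborel. ?f t \<zeta>) = - (LINT \<zeta>:S|lborel. ?f (- t) \<zeta>)" .
  have int: "set_integrable lborel S (?f t)" "set_integrable lborel S (?f (- t))"
    using t S by (auto intro!: flat_kernel_integrable simp del: diff_minus_eq_add)
  have "(LINT \<zeta>:S|lborel. (1 / 2) *\<^sub>R (?f t \<zeta> - ?f (- t) \<zeta>)) =
      (1 / 2) *\<^sub>R ((LINT \<zeta>:S|lborel. ?f t \<zeta>) - (LINT \<zeta>:S|lborel. ?f (- t) \<zeta>))"
    using set_integral_diff(2)[OF int] by simp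
  also have "\<dots> = (LINT \<zeta>:S|lborel. ?f t \<zeta>)"
    unfolding 1 by (simp add: algebra_simps scaleR_2[symmetric])
  finally show ?thesis by simp
qed

text \<open>For |\<zeta>| \<le> |t| the distance to the origin is at least |t|/(1 + \<Lambda>),
  which controls the kernel itself. Beyond |t| the symmetrized integrand is half a kernel difference
  over a vertical step 2 t. This is the two-zone situation.\<close>

lemma norm_flat_integral_le:
  assumes t: "t \<noteq> 0" and l: "norm l \<le> \<Lambda>"
  shows "norm (flat_integral k \<rho> l t) \<le> N * flat_const TYPE('v) \<Lambda>"
proof -
  have \<Lambda>: "0 \<le> \<Lambda>" using l norm_ge_zero order_trans by blast
  have N: "0 \<le> N" by (rule kernel_bounds_nonneg[OF k])
  let ?f = "\<lambda>\<zeta>. (1 / 2) *\<^sub>R (k (\<zeta>, blinfun_apply l \<zeta> - t) - k (\<zeta>, blinfun_apply l \<zeta> + t))"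
  have eq: "flat_integral k \<rho> l t = (LINT \<zeta>:ball 0 \<rho>|lborel. ?f \<zeta>)"
    unfolding flat_integral_def using t by (intro flat_kernel_symmetrize) auto
  show ?thesis unfolding eq
  proof (rule two_zone_integral_le[where t = "\<bar>t\<bar>"])
    show "set_integrable lborel (ball 0 \<rho>) ?f"
      using t by (rule flat_kernel_diff_integrable) auto
    fix \<zeta> :: 'v
    have "norm (k (\<zeta>, l \<zeta> - t)) \<le> N * (1 + \<Lambda>) ^ DIM('v) / \<bar>t\<bar> ^ DIM('v)"
         "norm (k (\<zeta>, l \<zeta> - (- t))) \<le> N * (1 + \<Lambda>) ^ DIM('v) / \<bar>- t\<bar> ^ DIM('v)"
      using t by (intro flat_kernel_le l; simp)+
    moreover have "norm (?f \<zeta>) = norm (k (\<zeta>, l \<zeta> - t) - k (\<zeta>, l \<zeta> + t)) / 2" by simp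
    ultimately have "norm (?f \<zeta>) \<le> N * (1 + \<Lambda>) ^ DIM('v) / \<bar>t\<bar> ^ DIM('v)"
      using norm_triangle_ineq4[of "k (\<zeta>, l \<zeta> - t)" "k (\<zeta>, l \<zeta> + t)"]
      unfolding abs_minus_cancel diff_minus_eq_add by linarith
    also have "\<dots> \<le> N * (1 + \<Lambda>) ^ (DIM('v) + 1) / \<bar>t\<bar> ^ DIM('v)"
      using N \<Lambda> by (intro divide_right_mono mult_left_mono power_increasing) auto
    finally show "norm (?f \<zeta>) \<le> N * (1 + \<Lambda>) ^ (DIM('v) + 1) / \<bar>t\<bar> ^ DIM('v)" .
    assume "\<bar>t\<bar> \<le> norm \<zeta>"
    then have \<zeta>: "0 < norm \<zeta>" using t by linarith
    have "norm (k ((\<zeta>, l \<zeta> - t) + (0, 2 * t)) - k (\<zeta>, l \<zeta> - t)) \<le> N * norm (0::'v, 2 * t) / norm \<zeta> ^ DIM('v \<times> real)"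
      by (rule kernel_bounds_diff[OF k \<zeta>]) (simp add: norm_fst_le)
    moreover have "(\<zeta>, l \<zeta> - t) + (0, 2 * t) = (\<zeta>, l \<zeta> + t)" by simp
    ultimately show "norm (?f \<zeta>) \<le> N * \<bar>t\<bar> / norm \<zeta> ^ (DIM('v) + 1)"
      by (simp only:) (simp add: norm_minus_commute abs_mult mult_ac)
  qed (use t N \<Lambda> in auto)
qed

text \<open>In the far zone the symmetrized integrands form a second difference whose two vertical
  steps coincide, so only the product of the step with |(l - l') \<zeta>| remains; its factor
  |\<zeta>| cancels one power of the denominator. The two-zone estimate then applies with N |l - l'|
  in place of N.\<close>

lemma flat_integral_lipschitz_slope:
  assumes t: "t \<noteq> 0" and l: "norm l \<le> \<Lambda>" "norm l' \<le> \<Lambda>"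
  shows "norm (flat_integral k \<rho> l t - flat_integral k \<rho> l' t) \<le> N * norm (l - l') * flat_const TYPE('v) \<Lambda>"
proof -
  have \<Lambda>: "0 \<le> \<Lambda>" using l(1) norm_ge_zero order_trans by blast
  have N: "0 \<le> N" by (rule kernel_bounds_nonneg[OF k])
  let ?f = "\<lambda>l \<zeta>. (1 / 2) *\<^sub>R (k (\<zeta>, blinfun_apply l \<zeta> - t) - k (\<zeta>, blinfun_apply l \<zeta> + t))"
  have int: "set_integrable lborel (ball 0 \<rho>) (?f l)" for l
    using t by (rule flat_kernel_diff_integrable) auto
  have eq: "flat_integral k \<rho> l t = (LINT \<zeta>:ball 0 \<rho>|lborel. ?f l \<zeta>)" for l
    unfolding flat_integral_def using t by (intro flat_kernel_symmetrize) auto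
  have eq2: "flat_integral k \<rho> l t - flat_integral k \<rho> l' t = (LINT \<zeta>:ball 0 \<rho>|lborel. ?f l \<zeta> - ?f l' \<zeta>)"
    unfolding eq using int by (subst set_integral_diff(2)) auto
  show ?thesis unfolding eq2
  proof (rule two_zone_integral_le[where t = "\<bar>t\<bar>"])
    show "set_integrable lborel (ball 0 \<rho>) (\<lambda>\<zeta>. ?f l \<zeta> - ?f l' \<zeta>)"
      using int by (intro set_integral_diff)
    fix \<zeta> :: 'v
    have ll: "\<bar>(l - l') \<zeta>\<bar> \<le> norm (l - l') * norm \<zeta>"
      using norm_blinfun[of "l - l'" \<zeta>] by simp
    {
      assume near: "norm \<zeta> \<le> \<bar>t\<bar>"
      have vert: "norm (k (\<zeta>, l \<zeta> - t) - k (\<zeta>, l' \<zeta> - t)) \<le>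
         N * norm (l - l') * (1 + \<Lambda>) ^ (DIM('v) + 1) / \<bar>t\<bar> ^ DIM('v)" if t: "t \<noteq> 0" and near: "norm \<zeta> \<le> \<bar>t\<bar>" for t
      proof -
        have pos: "0 < \<bar>t\<bar> / (1 + \<Lambda>)" using t \<Lambda> by simp
        have "norm (k ((\<zeta>, l' \<zeta> - t) + (0, (l - l') \<zeta>)) - k (\<zeta>, l' \<zeta> - t)) \<le>
          N * norm (0::'v, (l - l') \<zeta>) / (\<bar>t\<bar> / (1 + \<Lambda>)) ^ DIM('v \<times> real)"
        proof (rule kernel_bounds_diff[OF k pos])
          fix s :: real assume s: "s \<in> {0..1}"
          \<comment> \<open>The intermediate points belong to slopes between l' and l, whose norms
            are at most \<Lambda> by convexity; so the lower bound for the distance to the origin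
            holds along the whole step.\<close>
          have "norm ((1 - s) *\<^sub>R l' + s *\<^sub>R l) \<le> (1 - s) * norm l' + s * norm l"
            using s norm_triangle_ineq[of "(1 - s) *\<^sub>R l'" "s *\<^sub>R l"] by simp
          also have "\<dots> \<le> (1 - s) * \<Lambda> + s * \<Lambda>"
            using s l by (intro add_mono mult_left_mono) auto
          finally have "norm ((1 - s) *\<^sub>R l' + s *\<^sub>R l) \<le> \<Lambda>" by (simp add: algebra_simps)
          from norm_graph_ge[OF this, of t \<zeta>]
          show "\<bar>t\<bar> / (1 + \<Lambda>) \<le> norm ((\<zeta>, l' \<zeta> - t) + s *\<^sub>R (0, (l - l') \<zeta>))"
            by (simp add: blinfun.add_left blinfun.scaleR_left blinfun.diff_left algebra_simps)
        qed
        also have "\<dots> \<le> N * (norm (l - l') * \<bar>t\<bar>) / (\<bar>t\<bar> / (1 + \<Lambda>)) ^ DIM('v \<times> real)"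
        proof (intro divide_right_mono mult_left_mono)
          show "norm (0::'v, (l - l') \<zeta>) \<le> norm (l - l') * \<bar>t\<bar>"
            using ll mult_left_mono[OF near norm_ge_zero[of "l - l'"]] by (simp add: norm_Pair)
        qed (use N \<Lambda> in simp_all)
        also have "\<dots> = N * norm (l - l') * (1 + \<Lambda>) ^ (DIM('v) + 1) / \<bar>t\<bar> ^ DIM('v)"
          using t by (simp add: power_divide)
        finally show ?thesis by (simp add: blinfun.diff_left)
      qed
      have "?f l \<zeta> - ?f l' \<zeta> = (1 / 2) *\<^sub>R ((k (\<zeta>, l \<zeta> - t) - k (\<zeta>, l' \<zeta> - t)) - (k (\<zeta>, l \<zeta> - (-t)) - k (\<zeta>, l' \<zeta> - (-t))))"
        by (simp add: algebra_simps)
      also have "norm \<dots> \<le> N * norm (l - l') * (1 + \<Lambda>) ^ (DIM('v) + 1) / \<bar>t\<bar> ^ DIM('v)"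
        using vert[OF t near] vert[of "- t"] t near by (intro norm_half_diff_le) simp_all
      finally show "norm (?f l \<zeta> - ?f l' \<zeta>) \<le> N * norm (l - l') * (1 + \<Lambda>) ^ (DIM('v) + 1) / \<bar>t\<bar> ^ DIM('v)" .
    }
    assume "\<bar>t\<bar> \<le> norm \<zeta>"
    then have \<zeta>: "0 < norm \<zeta>" using t by linarith
    have "norm (k ((\<zeta>, l \<zeta> - t) + (0, 2 * t)) - k (\<zeta>, l \<zeta> - t) -
               (k ((\<zeta>, l' \<zeta> - t) + (0, 2 * t)) - k (\<zeta>, l' \<zeta> - t))) \<le>
        N * (norm ((0::'v, 2 * t) - (0, 2 * t)) / norm \<zeta> ^ DIM('v \<times> real) +
          norm (0::'v, 2 * t) * (norm ((\<zeta>, l \<zeta> - t) - (\<zeta>, l' \<zeta> - t)) + norm ((0::'v, 2 * t) - (0, 2 * t)))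
            / norm \<zeta> ^ (DIM('v \<times> real) + 1))"
      by (rule kernel_bounds_diff2[OF k \<zeta>]) (simp add: norm_fst_le)
    also have "\<dots> = 2 * (N * \<bar>t\<bar> * \<bar>(l - l') \<zeta>\<bar> / norm \<zeta> ^ (DIM('v) + 2))"
      by (simp add: blinfun.diff_left abs_mult)
    also have "\<dots> \<le> 2 * (N * \<bar>t\<bar> * (norm (l - l') * norm \<zeta>) / norm \<zeta> ^ (DIM('v) + 2))"
      using ll N by (intro mult_left_mono divide_right_mono) auto
    also have "\<dots> = 2 * (N * norm (l - l') * \<bar>t\<bar> / norm \<zeta> ^ (DIM('v) + 1))"
      using \<zeta> by simp
    finally have "norm (k (\<zeta>, l \<zeta> + t) - k (\<zeta>, l \<zeta> - t) - (k (\<zeta>, l' \<zeta> + t) - k (\<zeta>, l' \<zeta> - t)))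
        \<le> 2 * (N * norm (l - l') * \<bar>t\<bar> / norm \<zeta> ^ (DIM('v) + 1))" by (simp add: add.commute)
    moreover have "?f l \<zeta> - ?f l' \<zeta> = (- 1 / 2) *\<^sub>R (k (\<zeta>, l \<zeta> + t) - k (\<zeta>, l \<zeta> - t) - (k (\<zeta>, l' \<zeta> + t) - k (\<zeta>, l' \<zeta> - t)))"
      by (simp add: algebra_simps)
    ultimately show "norm (?f l \<zeta> - ?f l' \<zeta>) \<le> N * norm (l - l') * \<bar>t\<bar> / norm \<zeta> ^ (DIM('v) + 1)"
      by (simp add: mult_ac)
  qed (use t N \<Lambda> in auto)
qed

(* By homogeneity the distance to the hyperplane can be normalized to 1. *)
lemma flat_integral_eq_unit_height:
  assumes t: "0 < t"
  shows "flat_integral k \<rho> l t = (LINT \<zeta>:ball 0 (\<rho> / t)|lborel. k (\<zeta>, l \<zeta> - 1))"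
proof -
  have meas: "(\<lambda>\<zeta>. k (\<zeta>, blinfun_apply l \<zeta> - t)) \<in> borel_measurable borel"
    using t by (intro flat_kernel_measurable) auto
  have "flat_integral k \<rho> l t = \<bar>t\<bar> ^ DIM('v) *\<^sub>R
      (\<integral>\<zeta>. indicator (ball 0 \<rho>) (t *\<^sub>R \<zeta>) *\<^sub>R k (t *\<^sub>R \<zeta>, l (t *\<^sub>R \<zeta>) - t) \<partial>lborel)"
    unfolding flat_integral_def set_lebesgue_integral_def
    using t by (intro lborel_integral_scale borel_measurable_scaleR borel_measurable_indicator meas) auto
  also have "\<dots> = (\<integral>\<zeta>. \<bar>t\<bar> ^ DIM('v) *\<^sub>R (indicator (ball 0 \<rho>) (t *\<^sub>R \<zeta>) *\<^sub>R k (t *\<^sub>R \<zeta>, l (t *\<^sub>R \<zeta>) - t)) \<partial>lborel)"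
    by (rule integral_scaleR_right[symmetric])
  also have "\<dots> = (LINT \<zeta>:ball 0 (\<rho> / t)|lborel. k (\<zeta>, l \<zeta> - 1))"
    unfolding set_lebesgue_integral_def
  proof (intro Bochner_Integration.integral_cong refl)
    fix \<zeta> :: 'v
    have "(\<zeta>, l \<zeta> - 1) \<noteq> 0" by (auto simp: zero_prod_def)
    then have "k (t *\<^sub>R (\<zeta>, l \<zeta> - 1)) = (1 / t ^ DIM('v)) *\<^sub>R k (\<zeta>, l \<zeta> - 1)"
      using kernel_bounds_homogeneous[OF k t, of "(\<zeta>, l \<zeta> - 1)"] by simp
    moreover have "t *\<^sub>R (\<zeta>, l \<zeta> - 1) = (t *\<^sub>R \<zeta>, l (t *\<^sub>R \<zeta>) - t)"
      by (simp add: blinfun.scaleR_right right_diff_distrib)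
    moreover have "indicator (ball 0 \<rho>) (t *\<^sub>R \<zeta>) = (indicator (ball 0 (\<rho> / t)) \<zeta> :: real)"
      using t by (auto simp: indicator_def dist_norm field_simps)
    ultimately show "\<bar>t\<bar> ^ DIM('v) *\<^sub>R (indicator (ball 0 \<rho>) (t *\<^sub>R \<zeta>) *\<^sub>R k (t *\<^sub>R \<zeta>, l (t *\<^sub>R \<zeta>) - t)) =
      indicator (ball 0 (\<rho> / t)) \<zeta> *\<^sub>R k (\<zeta>, l \<zeta> - 1)"
      using t by (simp only:) simp
  qed
  finally show ?thesis .
qed

text \<open>At unit height t enters only through the radius \<rho>/t, so the difference is an
  integral over an annulus. The symmetrized integrand is at most
  \<open>N / norm \<zeta> ^ (DIM('v) + 1)\<close> there, and the radial integral from \<rho>/t' to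
  \<rho>/t gives t'/\<rho> - t/\<rho>.\<close>

lemma flat_integral_lipschitz_height_pos:
  assumes t: "0 < t" "t \<le> t'" and \<rho>: "0 < \<rho>"
  shows "norm (flat_integral k \<rho> l t - flat_integral k \<rho> l t') \<le> N * sphere_area TYPE('v) * (t' - t) / \<rho>"
proof -
  have N: "0 \<le> N" by (rule kernel_bounds_nonneg[OF k])
  let ?f = "\<lambda>\<zeta>. k (\<zeta>, blinfun_apply l \<zeta> - 1)"
  let ?g = "\<lambda>\<zeta>. (1 / 2) *\<^sub>R (k (\<zeta>, blinfun_apply l \<zeta> - 1) - k (\<zeta>, blinfun_apply l \<zeta> + 1))"
  let ?S = "ball 0 (\<rho> / t) - ball (0::'v) (\<rho> / t')"
  have sub: "ball 0 (\<rho> / t') \<subseteq> ball (0::'v) (\<rho> / t)"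
    using t \<rho> by (intro subset_ball frac_le) auto
  have le: "\<rho> / t' \<le> \<rho> / t" using t \<rho> by (intro frac_le) auto
  have "flat_integral k \<rho> l t = (LINT \<zeta>:ball 0 (\<rho> / t') \<union> ?S|lborel. ?f \<zeta>)"
    using flat_integral_eq_unit_height[OF t(1)] sub by (simp add: Un_absorb1)
  also have "\<dots> = (LINT \<zeta>:ball 0 (\<rho> / t')|lborel. ?f \<zeta>) + (LINT \<zeta>:?S|lborel. ?f \<zeta>)"
    by (intro set_integral_Un flat_kernel_integrable) auto
  also have "(LINT \<zeta>:ball 0 (\<rho> / t')|lborel. ?f \<zeta>) = flat_integral k \<rho> l t'"
    using flat_integral_eq_unit_height t by simp
  finally have "flat_integral k \<rho> l t - flat_integral k \<rho> l t' = (LINT \<zeta>:?S|lborel. ?f \<zeta>)" by simp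
  also have "\<dots> = (LINT \<zeta>:?S|lborel. ?g \<zeta>)"
    by (rule flat_kernel_symmetrize) (auto simp: dist_norm)
  also have "norm \<dots> \<le> N * (sphere_area TYPE('v) * ((t' - t) / \<rho>))"
  proof (rule norm_set_integral_le)
    show "set_integrable lborel ?S ?g"
      by (rule flat_kernel_diff_integrable) auto
    let ?h = "\<lambda>\<zeta>::'v. ennreal N * (ennreal (1 / norm \<zeta> ^ (DIM('v) + 1)) * indicator {\<rho> / t'..\<rho> / t} (norm \<zeta>))"
    show "ennreal (norm (?g \<zeta>)) \<le> ?h \<zeta>" if "\<zeta> \<in> ?S" for \<zeta>
    proof -
      have "0 < \<rho> / t'" using t \<rho> by simp
      then have \<zeta>: "0 < norm \<zeta>" "norm \<zeta> \<in> {\<rho> / t'..\<rho> / t}" using that by (auto simp: dist_norm)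
      have "norm (k ((\<zeta>, l \<zeta> - 1) + (0, 2)) - k (\<zeta>, l \<zeta> - 1)) \<le> N * norm (0::'v, 2::real) / norm \<zeta> ^ DIM('v \<times> real)"
        by (rule kernel_bounds_diff[OF k \<zeta>(1)]) (simp add: norm_fst_le)
      moreover have "(\<zeta>, l \<zeta> - 1) + (0, 2) = (\<zeta>, l \<zeta> + 1)" by simp
      ultimately have "norm (?g \<zeta>) \<le> N * (1 / norm \<zeta> ^ (DIM('v) + 1))"
        by (simp only:) (simp add: norm_minus_commute)
      then show ?thesis using \<zeta> N by (simp add: ennreal_mult[symmetric] ennreal_leI)
    qed
    have "(\<integral>\<^sup>+\<zeta>. ?h \<zeta> \<partial>lborel) = ennreal N * (\<integral>\<^sup>+(\<zeta>::'v). ennreal (1 / norm \<zeta> ^ (DIM('v) + 1)) * indicator {\<rho> / t'..\<rho> / t} (norm \<zeta>) \<partial>lborel)"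
      by (rule nn_integral_cmult) auto
    also have "\<dots> \<le> ennreal N * ennreal (sphere_area TYPE('v) * (1 / (\<rho> / t') - 1 / (\<rho> / t)))"
      using t \<rho> le by (intro mult_left_mono radial_integral_le_inverse) auto
    also have "\<dots> = ennreal (N * (sphere_area TYPE('v) * ((t' - t) / \<rho>)))"
      using N t \<rho> divide_right_mono[of t t' \<rho>] by (simp add: ennreal_mult[symmetric] diff_divide_distrib)
    finally show "(\<integral>\<^sup>+\<zeta>. ?h \<zeta> \<partial>lborel) \<le> ennreal (N * (sphere_area TYPE('v) * ((t' - t) / \<rho>)))" .
  qed (use N t \<rho> in auto)
  finally show ?thesis by simp
qed

text \<open>The symmetrized integrand is odd in t. The values on the two sides of the plane are thus
  opposite to each other, which is why the comparison of heights requires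
  \<open>0 < t * t'\<close>.\<close>

lemma flat_integral_uminus:
  assumes t: "t \<noteq> 0"
  shows "flat_integral k \<rho> l (- t) = - flat_integral k \<rho> l t"
proof -
  let ?f = "\<lambda>t \<zeta>. (1 / 2) *\<^sub>R (k (\<zeta>, blinfun_apply l \<zeta> - t) - k (\<zeta>, blinfun_apply l \<zeta> + t))"
  have eq: "flat_integral k \<rho> l s = (LINT \<zeta>:ball 0 \<rho>|lborel. ?f s \<zeta>)" if "s \<noteq> 0" for s
    unfolding flat_integral_def using that by (intro flat_kernel_symmetrize) auto
  have "?f (- t) = (\<lambda>\<zeta>. - ?f t \<zeta>)" by (simp add: fun_eq_iff algebra_simps)
  then show ?thesis
    using t set_integral_uminus[OF flat_kernel_diff_integrable[OF t, of "ball 0 \<rho>" l]]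
    by (simp only: eq neg_equal_0_iff_equal not_False_eq_True) simp
qed

lemma flat_integral_lipschitz_height:
  assumes t: "0 < t * t'" and \<rho>: "0 < \<rho>"
  shows "norm (flat_integral k \<rho> l t - flat_integral k \<rho> l t') \<le> N * sphere_area TYPE('v) * \<bar>t - t'\<bar> / \<rho>"
proof -
  have pos: "norm (flat_integral k \<rho> l t - flat_integral k \<rho> l t') \<le> N * sphere_area TYPE('v) * \<bar>t - t'\<bar> / \<rho>"
    if "0 < t" "0 < t'" for t t'
    using flat_integral_lipschitz_height_pos[OF that(1) _ \<rho>, of t' l]
      flat_integral_lipschitz_height_pos[OF that(2) _ \<rho>, of t l]
    by (cases "t \<le> t'") (auto simp: norm_minus_commute)
  show ?thesis
  proof (cases "0 < t")
    case True
    then show ?thesis using t pos by (simp add: zero_less_mult_iff)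
  next
    case False
    then have "t < 0" "t' < 0" using t by (auto simp: zero_less_mult_iff)
    then show ?thesis
      using pos[of "- t" "- t'"] flat_integral_uminus[of t \<rho> l] flat_integral_uminus[of t' \<rho> l]
      by (simp add: norm_minus_commute abs_minus_commute)
  qed
qed

end

section \<open>Layer potentials of a graph\<close>

text \<open>The mean value inequality for \<gamma> minus its linear part at x, whose derivative on
  the segment is at most \<Lambda> |x - y|. A Lipschitz derivative replaces the second order Taylor
  formula.\<close>

lemma linear_remainder_le:
  fixes \<gamma> :: "'v::euclidean_space \<Rightarrow> real" and D :: "'v \<Rightarrow> 'v \<Rightarrow>\<^sub>L real"
  assumes S: "convex S" and xy: "x \<in> S" "y \<in> S"
    and der: "\<And>z. z \<in> S \<Longrightarrow> (\<gamma> has_derivative blinfun_apply (D z)) (at z)"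
    and lip: "\<And>z z'. z \<in> S \<Longrightarrow> z' \<in> S \<Longrightarrow> norm (D z - D z') \<le> \<Lambda> * norm (z - z')"
    and "0 \<le> \<Lambda>"
  shows "\<bar>\<gamma> x - \<gamma> y - D x (x - y)\<bar> \<le> \<Lambda> * norm (x - y) ^ 2"
proof -
  let ?S = "closed_segment x y" and ?g = "\<lambda>z. \<gamma> z - D x z"
  have sub: "?S \<subseteq> S" using S xy by (simp add: closed_segment_subset)
  have "norm (?g x - ?g y) \<le> \<Lambda> * norm (x - y) * norm (x - y)"
  proof (rule differentiable_bound[where S = ?S and f' = "\<lambda>z h. (D z - D x) h"])
    fix z assume z: "z \<in> ?S"
    show "(?g has_derivative (\<lambda>h. (D z - D x) h)) (at z within ?S)"
      unfolding blinfun.diff_left using sub z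
      by (intro has_derivative_diff has_derivative_at_withinI[OF der]
          bounded_linear_imp_has_derivative[OF blinfun.bounded_linear_right]) auto
    have "norm (D z - D x) \<le> \<Lambda> * norm (z - x)" using lip sub z xy by auto
    also have "\<dots> \<le> \<Lambda> * norm (x - y)"
      using \<open>0 \<le> \<Lambda>\<close> segment_bound(1)[OF z] by (intro mult_left_mono) (auto simp: norm_minus_commute)
    finally show "onorm (\<lambda>h. (D z - D x) h) \<le> \<Lambda> * norm (x - y)"
      by (simp add: norm_blinfun.rep_eq)
  qed auto
  then show ?thesis
    by (simp add: blinfun.diff_right power2_eq_square algebra_simps)
qed

text \<open>f may fail to be measurable off S, so the criterion for bounded functions is applied to
  its extension by zero.\<close>

lemma set_integrable_continuous_bounded:
  fixes f :: "'v::euclidean_space \<Rightarrow> 'b::{banach, second_countable_topology}"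
  assumes S: "S \<in> sets borel" "bounded S" and "continuous_on S f"
    and "\<And>x. x \<in> S \<Longrightarrow> norm (f x) \<le> B"
  shows "set_integrable lborel S f"
proof -
  have "(\<lambda>x. indicator S x *\<^sub>R f x) \<in> borel_measurable borel"
    using assms by (intro borel_measurable_continuous_on_indicator)
  then have "set_integrable lborel S (\<lambda>x. indicator S x *\<^sub>R f x)"
    using assms by (intro set_integrable_bounded_ball[where B = B]) auto
  moreover have "(\<lambda>x. indicator S x *\<^sub>R indicator S x *\<^sub>R f x) = (\<lambda>x. indicator S x *\<^sub>R f x)"
    by (auto simp: fun_eq_iff indicator_def)
  ultimately show ?thesis unfolding set_integrable_def by (simp only:)
qed

lemma nn_integral_shift_indicator:
  fixes \<xi> :: "'v::euclidean_space"
  assumes [measurable]: "f \<in> borel_measurable borel"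
    and "(\<integral>\<^sup>+(x::'v). ennreal (f (norm x)) * indicator {a..b} (norm x) \<partial>lborel) \<le> ennreal B"
  shows "(\<integral>\<^sup>+x. ennreal (f (norm (\<xi> - x))) * indicator {a..b} (norm (\<xi> - x)) \<partial>lborel) \<le> ennreal B"
proof -
  have "(\<integral>\<^sup>+x. ennreal (f (norm (\<xi> - x))) * indicator {a..b} (norm (\<xi> - x)) \<partial>lborel) =
      (\<integral>\<^sup>+(x::'v). ennreal (f (norm x)) * indicator {a..b} (norm x) \<partial>lborel)"
    by (rule nn_integral_lborel_reflect_shift) measurable
  then show ?thesis using assms(2) by (simp only:)
qed

(* chord is the vector from the point on the graph above \<eta> to the point at height t below
   the graph over \<xi>; tangent is its approximation by means of the tangent plane over \<xi>. *)
definition chord :: "('v::euclidean_space \<Rightarrow> real) \<Rightarrow> 'v \<Rightarrow> real \<Rightarrow> 'v \<Rightarrow> 'v \<times> real" where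
  "chord \<gamma> \<xi> t \<eta> = (\<xi> - \<eta>, \<gamma> \<xi> - \<gamma> \<eta> - t)"

definition tangent :: "('v::euclidean_space \<Rightarrow> 'v \<Rightarrow>\<^sub>L real) \<Rightarrow> 'v \<Rightarrow> real \<Rightarrow> 'v \<Rightarrow> 'v \<times> real" where
  "tangent D \<xi> t \<eta> = (\<xi> - \<eta>, D \<xi> (\<xi> - \<eta>) - t)"

definition remainder ::
  "('v::euclidean_space \<Rightarrow> real) \<Rightarrow> ('v \<Rightarrow> 'v \<Rightarrow>\<^sub>L real) \<Rightarrow> 'v \<Rightarrow> 'v \<Rightarrow> real" where
  "remainder \<gamma> D \<xi> \<eta> = \<gamma> \<xi> - \<gamma> \<eta> - D \<xi> (\<xi> - \<eta>)"

text \<open>The domain has radius 2 \<rho> while the estimates take \<xi> within \<rho> of the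
  centre, so that the full disc of radius \<rho> about \<xi> fits into it.\<close>

definition graph_potential ::
  "('v::euclidean_space \<times> real \<Rightarrow> complex) \<Rightarrow> real \<Rightarrow> ('v \<Rightarrow> real) \<Rightarrow> ('v \<Rightarrow> complex) \<Rightarrow> 'v \<Rightarrow> real \<Rightarrow> complex" where
  "graph_potential k \<rho> \<gamma> w \<xi> t = (LINT \<eta>:ball 0 (2 * \<rho>)|lborel. k (chord \<gamma> \<xi> t \<eta>) * w \<eta>)"

(* What remains of the integrand after subtracting the potential, with constant density, of
   a disc in the tangent plane. *)
definition correction ::
  "('v::euclidean_space \<times> real \<Rightarrow> complex) \<Rightarrow> real \<Rightarrow> ('v \<Rightarrow> real) \<Rightarrow> ('v \<Rightarrow> 'v \<Rightarrow>\<^sub>L real) \<Rightarrow>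
   ('v \<Rightarrow> complex) \<Rightarrow> 'v \<Rightarrow> real \<Rightarrow> 'v \<Rightarrow> complex" where
  "correction k \<rho> \<gamma> D w \<xi> t \<eta> =
     k (chord \<gamma> \<xi> t \<eta>) * w \<eta> - indicator (ball \<xi> \<rho>) \<eta> *\<^sub>R (w \<xi> * k (tangent D \<xi> t \<eta>))"

text \<open>1 stems from the oscillation of the density, \<Lambda> from the deviation of the graph
  from its tangent plane, 1/\<rho> from points outside the disc.\<close>

definition corr_const :: "real \<Rightarrow> real \<Rightarrow> real" where
  "corr_const \<Lambda> \<rho> = 1 + \<Lambda> + 1 / \<rho>"

text \<open>The bracket collects the four terms of \<open>correction_diff_inside\<close> and, as (1
  + \<Lambda>)/\<rho>, the case outside both discs. The power of 2 dominates all those that arise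
  from replacing r by r/2 in denominators.\<close>

definition mid_const :: "'v::euclidean_space itself \<Rightarrow> real \<Rightarrow> real \<Rightarrow> real" where
  "mid_const T \<Lambda> \<rho> = 2 ^ (DIM('v) + 4) *
    (2 + 2 * \<Lambda> + \<Lambda> * (1 + \<Lambda> + 3 * \<Lambda> * \<rho>) + \<Lambda> * \<rho> + (1 + \<Lambda>) / \<rho>)"

text \<open>The first three summands account for the flat part: density, slope and height. In the
  fourth, 5 = 2 + 3 comes from balls of radii 2 h and 3 h, and the last 2 from the shell of width 2
  h. The radius 3 \<rho> reaches from \<xi> to every point of the domain.\<close>

definition hoelder_const :: "'v::euclidean_space itself \<Rightarrow> real \<Rightarrow> real \<Rightarrow> real" where
  "hoelder_const T \<Lambda> \<rho> = 2 * flat_const T \<Lambda> + \<Lambda> * flat_const T \<Lambda> + sphere_area T / \<rho> +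
     corr_const \<Lambda> \<rho> * sphere_area T * (5 + 2 * 2 ^ DIM('v)) + mid_const T \<Lambda> \<rho> * sphere_area T * \<bar>ln (3 * \<rho>)\<bar>"

lemma norm_kernel_le:
  fixes k :: "'v::euclidean_space \<times> real \<Rightarrow> complex"
  assumes k: "kernel_bounds N k" and r: "0 < r" "r \<le> norm z"
  shows "norm (k z) \<le> N / r ^ DIM('v)"
proof -
  have "norm (k z) \<le> N / norm z ^ DIM('v)"
    using kernel_bounds_size[OF k, of z] r by (cases "z = 0") auto
  also have "\<dots> \<le> N / r ^ DIM('v)"
    using kernel_bounds_nonneg[OF k] r by (intro divide_left_mono power_mono mult_pos_pos zero_less_power) auto
  finally show ?thesis .
qed

section \<open>Estimates for one graph and one density, with constants linear in N and W\<close>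

context
  fixes k :: "'v::euclidean_space \<times> real \<Rightarrow> complex" and N W \<Lambda> \<rho> :: real
    and \<gamma> :: "'v \<Rightarrow> real" and D :: "'v \<Rightarrow> 'v \<Rightarrow>\<^sub>L real" and w :: "'v \<Rightarrow> complex"
  assumes k: "kernel_bounds N k" and \<rho>: "0 < \<rho>" and \<Lambda>: "0 \<le> \<Lambda>" and W: "0 \<le> W"
    and der: "\<And>x. x \<in> ball 0 (2 * \<rho>) \<Longrightarrow> (\<gamma> has_derivative blinfun_apply (D x)) (at x)"
    and D_bound: "\<And>x. x \<in> ball 0 (2 * \<rho>) \<Longrightarrow> norm (D x) \<le> \<Lambda>"
    and D_lip: "\<And>x y. x \<in> ball 0 (2 * \<rho>) \<Longrightarrow> y \<in> ball 0 (2 * \<rho>) \<Longrightarrow> norm (D x - D y) \<le> \<Lambda> * norm (x - y)"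
    and w_bound: "\<And>x. x \<in> ball 0 (2 * \<rho>) \<Longrightarrow> norm (w x) \<le> W"
    and w_lip: "\<And>x y. x \<in> ball 0 (2 * \<rho>) \<Longrightarrow> y \<in> ball 0 (2 * \<rho>) \<Longrightarrow> norm (w x - w y) \<le> W * norm (x - y)"
begin

abbreviation B where "B \<equiv> ball (0::'v) (2 * \<rho>)"

lemma N_nonneg: "0 \<le> N" by (rule kernel_bounds_nonneg[OF k])

lemma chord_eq: "chord \<gamma> \<xi> t \<eta> = tangent D \<xi> t \<eta> + (0, remainder \<gamma> D \<xi> \<eta>)"
  by (simp add: chord_def tangent_def remainder_def)

lemma graph_lipschitz:
  assumes "x \<in> B" "y \<in> B"
  shows "\<bar>\<gamma> x - \<gamma> y\<bar> \<le> \<Lambda> * norm (x - y)"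
  using differentiable_bound[OF convex_ball, of 0 "2 * \<rho>" \<gamma> "\<lambda>x. blinfun_apply (D x)" \<Lambda> x y]
    der D_bound assms by (simp add: has_derivative_at_withinI norm_blinfun.rep_eq)

lemma remainder_le:
  assumes "x \<in> B" "y \<in> B"
  shows "\<bar>remainder \<gamma> D x y\<bar> \<le> \<Lambda> * norm (x - y) ^ 2"
  unfolding remainder_def using assms der D_lip \<Lambda>
  by (intro linear_remainder_le[where S = B]) auto

lemma chord_ge:
  assumes "\<xi> \<in> B" "\<eta> \<in> B"
  shows "\<bar>t\<bar> / (1 + \<Lambda>) \<le> norm (chord \<gamma> \<xi> t \<eta>)"
proof -
  have "\<bar>\<gamma> \<xi> - \<gamma> \<eta>\<bar> \<le> \<Lambda> * norm (\<xi> - \<eta>)" by (rule graph_lipschitz[OF assms])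
  also have "\<dots> \<le> \<Lambda> * norm (chord \<gamma> \<xi> t \<eta>)"
    using \<Lambda> unfolding chord_def by (intro mult_left_mono norm_fst_le) auto
  finally have "\<bar>t\<bar> \<le> norm (chord \<gamma> \<xi> t \<eta>) + \<Lambda> * norm (chord \<gamma> \<xi> t \<eta>)"
    using norm_snd_le[of "\<gamma> \<xi> - \<gamma> \<eta> - t" "\<xi> - \<eta>"] unfolding chord_def by auto
  then show ?thesis using \<Lambda> by (simp add: divide_le_eq algebra_simps)
qed

lemma fst_le_chord: "norm (\<xi> - \<eta>) \<le> norm (chord \<gamma> \<xi> t \<eta>)" "norm (\<xi> - \<eta>) \<le> norm (tangent D \<xi> t \<eta>)"
  by (auto simp: chord_def tangent_def norm_fst_le)

text \<open>Chord and tangent differ only in the last coordinate, so the whole segment between them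
  stays at distance at least |\<xi> - \<eta>| from the origin, whatever t is.\<close>

lemma norm_kernel_vertical_diff_le:
  assumes "0 < norm (\<xi> - \<eta>)"
  shows "norm (k (chord \<gamma> \<xi> t \<eta>) - k (tangent D \<xi> t \<eta>)) \<le> N * \<bar>remainder \<gamma> D \<xi> \<eta>\<bar> / norm (\<xi> - \<eta>) ^ (DIM('v) + 1)"
proof -
  have "norm (k (tangent D \<xi> t \<eta> + (0, remainder \<gamma> D \<xi> \<eta>)) - k (tangent D \<xi> t \<eta>))
      \<le> N * norm (0::'v, remainder \<gamma> D \<xi> \<eta>) / norm (\<xi> - \<eta>) ^ DIM('v \<times> real)"
    by (rule kernel_bounds_diff[OF k assms]) (simp add: tangent_def norm_fst_le)
  then show ?thesis by (simp add: chord_eq)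
qed

lemma graph_potential_integrable:
  assumes \<xi>: "\<xi> \<in> B" and t: "t \<noteq> 0"
  shows "set_integrable lborel B (\<lambda>\<eta>. k (chord \<gamma> \<xi> t \<eta>) * w \<eta>)"
proof (rule set_integrable_continuous_bounded)
  have pos: "0 < \<bar>t\<bar> / (1 + \<Lambda>)" using t \<Lambda> by simp
  have \<gamma>: "continuous_on B \<gamma>"
    using der by (intro continuous_at_imp_continuous_on ballI has_derivative_continuous)
  have w: "continuous_on B w"
    using w_lip W by (intro lipschitz_on_continuous_on[where L = W] lipschitz_onI) (auto simp: dist_norm)
  have "continuous_on B (\<lambda>\<eta>. k (chord \<gamma> \<xi> t \<eta>))"
  proof (rule continuous_on_compose2[OF kernel_bounds_continuous[OF k]])
    show "continuous_on B (chord \<gamma> \<xi> t)" unfolding chord_def by (intro continuous_intros \<gamma>)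
    show "chord \<gamma> \<xi> t ` B \<subseteq> - {0}"
    proof (rule image_subsetI)
      fix \<eta> assume "\<eta> \<in> B"
      then show "chord \<gamma> \<xi> t \<eta> \<in> - {0}"
        using chord_ge[OF \<xi>, of \<eta> t] pos by auto
    qed
  qed
  then show "continuous_on B (\<lambda>\<eta>. k (chord \<gamma> \<xi> t \<eta>) * w \<eta>)" using w by (rule continuous_on_mult)
  show "norm (k (chord \<gamma> \<xi> t \<eta>) * w \<eta>) \<le> N / (\<bar>t\<bar> / (1 + \<Lambda>)) ^ DIM('v) * W" if "\<eta> \<in> B" for \<eta>
    unfolding norm_mult using norm_kernel_le[OF k pos chord_ge[OF \<xi> that]] w_bound[OF that] N_nonneg pos
    by (intro mult_mono) (auto intro!: divide_nonneg_nonneg zero_le_power)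
qed auto

lemma half_ball:
  assumes "\<xi> \<in> ball 0 \<rho>"
  shows "\<xi> \<in> B" "ball \<xi> \<rho> \<subseteq> B"
proof -
  show "\<xi> \<in> B" using assms \<rho> by (auto simp: dist_norm)
  show "ball \<xi> \<rho> \<subseteq> B"
  proof
    fix \<eta> assume "\<eta> \<in> ball \<xi> \<rho>"
    then have "norm (\<xi> - \<eta>) < \<rho>" "norm \<xi> < \<rho>" using assms by (auto simp: dist_norm)
    then have "norm \<eta> < 2 * \<rho>" using norm_triangle_ineq2[of \<eta> \<xi>] by (simp add: norm_minus_commute)
    then show "\<eta> \<in> B" by (simp add: dist_norm)
  qed
qed

text \<open>The substitution \<zeta> = \<xi> - \<eta> carries the disc about \<xi> to the disc about
  0; nothing is cut off since \<open>ball \<xi> \<rho>\<close> lies inside the domain of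
  integration.\<close>

lemma flat_part:
  assumes \<xi>: "\<xi> \<in> ball 0 \<rho>" and t: "t \<noteq> 0"
  shows "set_integrable lborel B (\<lambda>\<eta>. indicator (ball \<xi> \<rho>) \<eta> *\<^sub>R (w \<xi> * k (tangent D \<xi> t \<eta>)))" (is ?int)
    and "(LINT \<eta>:B|lborel. indicator (ball \<xi> \<rho>) \<eta> *\<^sub>R (w \<xi> * k (tangent D \<xi> t \<eta>))) =
      w \<xi> * flat_integral k \<rho> (D \<xi>) t" (is ?eq)
proof -
  let ?f = "\<lambda>\<zeta>. k (\<zeta>, D \<xi> \<zeta> - t)"
  have meas: "?f \<in> borel_measurable borel" by (rule flat_kernel_measurable[OF k t])
  have meas2: "(\<lambda>\<eta>. k (tangent D \<xi> t \<eta>)) \<in> borel_measurable borel"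
    unfolding tangent_def using measurable_compose[OF _ meas, of "\<lambda>\<eta>. \<xi> - \<eta>" borel] by simp
  have le: "norm (k (tangent D \<xi> t \<eta>)) \<le> N * (1 + \<Lambda>) ^ DIM('v) / \<bar>t\<bar> ^ DIM('v)" for \<eta>
    unfolding tangent_def by (rule flat_kernel_le[OF k t D_bound[OF half_ball(1)[OF \<xi>]]])
  have ind: "(indicator B \<eta> :: real) * indicator (ball \<xi> \<rho>) \<eta> = indicator (ball \<xi> \<rho>) \<eta>" for \<eta>
    using half_ball(2)[OF \<xi>] by (auto simp: indicator_def)
  have ind2: "indicator (ball \<xi> \<rho>) \<eta> = (indicator (ball 0 \<rho>) (\<xi> - \<eta>) :: real)" for \<eta>
    by (auto simp: indicator_def dist_norm norm_minus_commute)
  have "set_integrable lborel (ball \<xi> \<rho>) (\<lambda>\<eta>. w \<xi> * k (tangent D \<xi> t \<eta>))"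
  proof (rule set_integrable_bounded_ball)
    show "(\<lambda>\<eta>. w \<xi> * k (tangent D \<xi> t \<eta>)) \<in> borel_measurable borel" using meas2 by simp
    show "norm (w \<xi> * k (tangent D \<xi> t \<eta>)) \<le> norm (w \<xi>) * (N * (1 + \<Lambda>) ^ DIM('v) / \<bar>t\<bar> ^ DIM('v))" for \<eta>
      unfolding norm_mult by (intro mult_left_mono le) auto
  qed auto
  then show ?int
    unfolding set_integrable_def by (simp only: scaleR_scaleR ind)
  have "(LINT \<eta>:B|lborel. indicator (ball \<xi> \<rho>) \<eta> *\<^sub>R (w \<xi> * k (tangent D \<xi> t \<eta>))) =
      (\<integral>\<eta>. w \<xi> * (indicator (ball 0 \<rho>) (\<xi> - \<eta>) *\<^sub>R ?f (\<xi> - \<eta>)) \<partial>lborel)"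
    unfolding set_lebesgue_integral_def scaleR_scaleR ind by (simp add: tangent_def ind2)
  also have "\<dots> = w \<xi> * (\<integral>\<eta>. indicator (ball 0 \<rho>) (\<xi> - \<eta>) *\<^sub>R ?f (\<xi> - \<eta>) \<partial>lborel)"
    by (rule integral_mult_right_zero)
  also have "(\<integral>\<eta>. indicator (ball 0 \<rho>) (\<xi> - \<eta>) *\<^sub>R ?f (\<xi> - \<eta>) \<partial>lborel) = flat_integral k \<rho> (D \<xi>) t"
  proof -
    have "(\<lambda>\<zeta>. indicator (ball 0 \<rho>) \<zeta> *\<^sub>R ?f \<zeta>) \<in> borel_measurable borel"
      by (intro borel_measurable_scaleR borel_measurable_indicator meas) auto
    from lborel_integral_affine[OF this, of "-1" \<xi>] show ?thesis
      by (simp add: flat_integral_def set_lebesgue_integral_def)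
  qed
  finally show ?eq .
qed

lemma graph_potential_decomposition:
  assumes \<xi>: "\<xi> \<in> ball 0 \<rho>" and t: "t \<noteq> 0"
  shows "set_integrable lborel B (correction k \<rho> \<gamma> D w \<xi> t)"
    and "graph_potential k \<rho> \<gamma> w \<xi> t = w \<xi> * flat_integral k \<rho> (D \<xi>) t + (LINT \<eta>:B|lborel. correction k \<rho> \<gamma> D w \<xi> t \<eta>)"
proof -
  note int = graph_potential_integrable[OF half_ball(1)[OF \<xi>] t] flat_part(1)[OF \<xi> t]
  show "set_integrable lborel B (correction k \<rho> \<gamma> D w \<xi> t)"
    using set_integral_diff(1)[OF int] by (simp add: correction_def[abs_def])
  show "graph_potential k \<rho> \<gamma> w \<xi> t = w \<xi> * flat_integral k \<rho> (D \<xi>) t + (LINT \<eta>:B|lborel. correction k \<rho> \<gamma> D w \<xi> t \<eta>)"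
    using set_integral_diff(2)[OF int] flat_part(2)[OF \<xi> t]
    by (simp add: correction_def[abs_def] graph_potential_def)
qed

lemma corr_const_nonneg: "0 \<le> corr_const \<Lambda> \<rho>" using \<rho> \<Lambda> by (simp add: corr_const_def)

text \<open>The kernel is of order r^(-m) with m = \<open>DIM('v)\<close> and r = |\<xi> - \<eta>|.
  Inside the disc the Lipschitz density gains a factor r in one term, and the remainder of order r^2
  gains it in the other; outside the disc 1/r \<le> 1/\<rho>. The resulting bound does not involve
  t, and its integral over a ball of radius R about \<xi> is of order R.\<close>

lemma norm_correction_le:
  assumes \<xi>: "\<xi> \<in> ball 0 \<rho>" and \<eta>: "\<eta> \<in> B"
  shows "norm (correction k \<rho> \<gamma> D w \<xi> t \<eta>) \<le> N * W * corr_const \<Lambda> \<rho> * (1 / norm (\<xi> - \<eta>) ^ (DIM('v) - 1))"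
proof (cases "\<xi> = \<eta>")
  case True
  \<comment> \<open>Chord and tangent coincide here. In dimension above 1 the right-hand side is
    also 0, by division by zero, so the exact vanishing matters.\<close>
  then have "correction k \<rho> \<gamma> D w \<xi> t \<eta> = 0" using \<rho> by (simp add: correction_def chord_def tangent_def)
  then show ?thesis using N_nonneg W corr_const_nonneg by simp
next
  case False
  let ?r = "norm (\<xi> - \<eta>)" and ?p = "norm (\<xi> - \<eta>) ^ (DIM('v) - 1)"
  have r: "0 < ?r" using False by simp
  have pw: "?r ^ DIM('v) = ?r * ?p" "?r ^ (DIM('v) + 1) = ?r * (?r * ?p)"
    by (auto simp: power_DIM_Suc[where 'a = 'v])
  have kc: "norm (k (chord \<gamma> \<xi> t \<eta>)) \<le> N / (?r * ?p)"
    using norm_kernel_le[OF k r fst_le_chord(1)] pw by simp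
  note \<xi>B = half_ball(1)[OF \<xi>]
  show ?thesis
  proof (cases "\<eta> \<in> ball \<xi> \<rho>")
    case True
    then have "correction k \<rho> \<gamma> D w \<xi> t \<eta> = k (chord \<gamma> \<xi> t \<eta>) * (w \<eta> - w \<xi>) + w \<xi> * (k (chord \<gamma> \<xi> t \<eta>) - k (tangent D \<xi> t \<eta>))"
      by (simp add: correction_def algebra_simps)
    then have "norm (correction k \<rho> \<gamma> D w \<xi> t \<eta>) \<le> norm (k (chord \<gamma> \<xi> t \<eta>)) * norm (w \<eta> - w \<xi>) +
        norm (w \<xi>) * norm (k (chord \<gamma> \<xi> t \<eta>) - k (tangent D \<xi> t \<eta>))"
      by (metis norm_triangle_ineq norm_mult)
    also have "\<dots> \<le> N / (?r * ?p) * (W * ?r) + W * (N * (\<Lambda> * ?r ^ 2) / (?r * (?r * ?p)))"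
    proof (intro add_mono mult_mono)
      show "norm (w \<eta> - w \<xi>) \<le> W * ?r" using w_lip[OF \<eta> \<xi>B] by (simp add: norm_minus_commute)
      have "norm (k (chord \<gamma> \<xi> t \<eta>) - k (tangent D \<xi> t \<eta>)) \<le> N * \<bar>remainder \<gamma> D \<xi> \<eta>\<bar> / (?r * (?r * ?p))"
        using norm_kernel_vertical_diff_le[OF r] unfolding pw .
      also have "\<dots> \<le> N * (\<Lambda> * ?r ^ 2) / (?r * (?r * ?p))"
        using remainder_le[OF \<xi>B \<eta>] N_nonneg r by (intro divide_right_mono mult_left_mono) auto
      finally show "norm (k (chord \<gamma> \<xi> t \<eta>) - k (tangent D \<xi> t \<eta>)) \<le> N * (\<Lambda> * ?r ^ 2) / (?r * (?r * ?p))" .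
    qed (use kc w_bound[OF \<xi>B] N_nonneg W r in auto)
    also have "\<dots> = N * W * (1 + \<Lambda>) * (1 / ?p)"
      using r by (simp add: field_simps power2_eq_square)
    also have "\<dots> \<le> N * W * corr_const \<Lambda> \<rho> * (1 / ?p)"
      unfolding corr_const_def using \<rho> N_nonneg W by (intro mult_right_mono mult_left_mono) auto
    finally show ?thesis .
  next
    case False
    then have far: "\<rho> \<le> ?r" by (simp add: dist_norm)
    have "norm (correction k \<rho> \<gamma> D w \<xi> t \<eta>) \<le> N / (?r * ?p) * W"
    proof -
      have "norm (k (chord \<gamma> \<xi> t \<eta>)) * norm (w \<eta>) \<le> N / (?r * ?p) * W"
        using N_nonneg by (intro mult_mono kc w_bound[OF \<eta>]) auto
      then show ?thesis using False by (simp add: correction_def norm_mult)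
    qed
    also have "\<dots> \<le> N / (\<rho> * ?p) * W"
      using far \<rho> r N_nonneg W by (intro mult_right_mono divide_left_mono) auto
    also have "\<dots> = N * W * (1 / \<rho>) * (1 / ?p)" by simp
    also have "\<dots> \<le> N * W * corr_const \<Lambda> \<rho> * (1 / ?p)"
      unfolding corr_const_def using \<Lambda> N_nonneg W by (intro mult_right_mono mult_left_mono) auto
    finally show ?thesis .
  qed
qed

lemma norm_graph_potential_le:
  assumes \<xi>: "\<xi> \<in> ball 0 \<rho>" and t: "t \<noteq> 0"
  shows "norm (graph_potential k \<rho> \<gamma> w \<xi> t) \<le>
    N * W * (flat_const TYPE('v) \<Lambda> + corr_const \<Lambda> \<rho> * (sphere_area TYPE('v) * (3 * \<rho>)))"
proof -
  note dec = graph_potential_decomposition[OF \<xi> t]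
  note \<xi>B = half_ball(1)[OF \<xi>]
  have "norm (w \<xi> * flat_integral k \<rho> (D \<xi>) t) \<le> W * (N * flat_const TYPE('v) \<Lambda>)"
    unfolding norm_mult
    using w_bound[OF \<xi>B] norm_flat_integral_le[OF k t D_bound[OF \<xi>B], of \<rho>] W by (intro mult_mono) auto
  moreover have "norm (LINT \<eta>:B|lborel. correction k \<rho> \<gamma> D w \<xi> t \<eta>) \<le> (N * W * corr_const \<Lambda> \<rho>) * (sphere_area TYPE('v) * (3 * \<rho> - 0))"
  proof (rule norm_set_integral_le[OF dec(1)])
    let ?g = "\<lambda>\<eta>. ennreal (N * W * corr_const \<Lambda> \<rho>) *
      (ennreal (1 / norm (\<xi> - \<eta>) ^ (DIM('v) - 1)) * indicator {0..3 * \<rho>} (norm (\<xi> - \<eta>)))"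
    show "ennreal (norm (correction k \<rho> \<gamma> D w \<xi> t \<eta>)) \<le> ?g \<eta>" if \<eta>: "\<eta> \<in> B" for \<eta>
    proof -
      have "norm (\<xi> - \<eta>) \<le> 3 * \<rho>" using \<xi> \<eta> norm_triangle_ineq4[of \<xi> \<eta>] by (simp add: dist_norm)
      then show ?thesis
        using norm_correction_le[OF \<xi> \<eta>, of t] N_nonneg W corr_const_nonneg
        by (simp add: ennreal_mult[symmetric] ennreal_leI)
    qed
    have "(\<integral>\<^sup>+\<eta>. ?g \<eta> \<partial>lborel) = ennreal (N * W * corr_const \<Lambda> \<rho>) *
        (\<integral>\<^sup>+\<eta>. ennreal (1 / norm (\<xi> - \<eta>) ^ (DIM('v) - 1)) * indicator {0..3 * \<rho>} (norm (\<xi> - \<eta>)) \<partial>lborel)"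
      by (rule nn_integral_cmult) measurable
    also have "\<dots> \<le> ennreal (N * W * corr_const \<Lambda> \<rho>) * ennreal (sphere_area TYPE('v) * (3 * \<rho> - 0))"
      using \<rho> by (intro mult_left_mono nn_integral_shift_indicator[where f = "\<lambda>r. 1 / r ^ (DIM('v) - 1)"]
          radial_integral_le_linear) auto
    also have "\<dots> = ennreal ((N * W * corr_const \<Lambda> \<rho>) * (sphere_area TYPE('v) * (3 * \<rho> - 0)))"
      using \<rho> N_nonneg W corr_const_nonneg by (subst ennreal_mult) auto
    finally show "(\<integral>\<^sup>+\<eta>. ?g \<eta> \<partial>lborel) \<le> ennreal ((N * W * corr_const \<Lambda> \<rho>) * (sphere_area TYPE('v) * (3 * \<rho> - 0)))" .
  qed (use \<rho> N_nonneg W corr_const_nonneg in auto)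
  ultimately have "norm (graph_potential k \<rho> \<gamma> w \<xi> t) \<le> W * (N * flat_const TYPE('v) \<Lambda>) +
      (N * W * corr_const \<Lambda> \<rho>) * (sphere_area TYPE('v) * (3 * \<rho> - 0))"
    unfolding dec(2) by (intro norm_triangle_le add_mono)
  then show ?thesis by (simp add: algebra_simps)
qed

lemma mid_const_nonneg: "0 \<le> mid_const TYPE('v) \<Lambda> \<rho>" using \<rho> \<Lambda> by (simp add: mid_const_def)

section \<open>Increments of the correction at points \<eta> whose distance r from \<xi> is at least
  2 h\<close>

context
  fixes \<xi> \<xi>' \<eta> :: 'v and t t' h r q :: real
  assumes \<xi>: "\<xi> \<in> ball 0 \<rho>" and \<xi>': "\<xi>' \<in> ball 0 \<rho>" and \<eta>: "\<eta> \<in> ball 0 (2 * \<rho>)"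
    and h_def: "h = norm (\<xi> - \<xi>') + \<bar>t - t'\<bar>" and h: "0 < h"
    and r_def: "r = norm (\<xi> - \<eta>)" and far: "2 * h \<le> r" and q_def: "q = r / 2"
begin

lemma q_pos: "0 < q" "0 < r" using h far by (auto simp: q_def)

lemma dist_le_h: "norm (\<xi> - \<xi>') \<le> h" "\<bar>t - t'\<bar> \<le> h" using h_def by auto

text \<open>On the way from \<xi>' to \<xi> the base point is never further than h from \<xi>, and h
  \<le> r/2; hence the choice of q as half of r.\<close>

lemma segment_far:
  assumes "s \<in> {0..1}" shows "q \<le> norm (\<xi>' - \<eta> + s *\<^sub>R (\<xi> - \<xi>'))"
proof -
  have "\<xi>' - \<eta> + s *\<^sub>R (\<xi> - \<xi>') = (\<xi> - \<eta>) - (1 - s) *\<^sub>R (\<xi> - \<xi>')" by (simp add: algebra_simps)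
  then have "r - norm ((1 - s) *\<^sub>R (\<xi> - \<xi>')) \<le> norm (\<xi>' - \<eta> + s *\<^sub>R (\<xi> - \<xi>'))"
    by (simp only: r_def norm_triangle_ineq2)
  moreover have "norm ((1 - s) *\<^sub>R (\<xi> - \<xi>')) \<le> norm (\<xi> - \<xi>')"
    using assms by (auto intro!: mult_left_le_one_le)
  ultimately show ?thesis using dist_le_h far unfolding q_def by linarith
qed

lemma r'_bounds: "q \<le> norm (\<xi>' - \<eta>)" "norm (\<xi>' - \<eta>) \<le> 2 * r"
proof -
  show "q \<le> norm (\<xi>' - \<eta>)" using segment_far[of 0] by simp
  have "norm (\<xi>' - \<eta>) \<le> norm (\<xi>' - \<xi>) + r"
    using norm_triangle_ineq[of "\<xi>' - \<xi>" "\<xi> - \<eta>"] by (simp add: r_def)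
  then show "norm (\<xi>' - \<eta>) \<le> 2 * r" using dist_le_h far h by (simp add: norm_minus_commute)
qed

lemma q_power: "q ^ j = r ^ j / 2 ^ j" by (simp add: q_def power_divide)

lemma chord_kernel_diff:
  "norm (k (chord \<gamma> \<xi> t \<eta>) - k (chord \<gamma> \<xi>' t' \<eta>)) \<le> N * ((1 + \<Lambda>) * h) / q ^ (DIM('v) + 1)"
proof -
  let ?a = "(\<xi> - \<xi>', \<gamma> \<xi> - \<gamma> \<xi>' - (t - t'))"
  have "norm (k (chord \<gamma> \<xi>' t' \<eta> + ?a) - k (chord \<gamma> \<xi>' t' \<eta>)) \<le> N * norm ?a / q ^ DIM('v \<times> real)"
  proof (rule kernel_bounds_diff[OF k q_pos(1)])
    fix s :: real assume "s \<in> {0..1}"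
    from segment_far[OF this] show "q \<le> norm (chord \<gamma> \<xi>' t' \<eta> + s *\<^sub>R ?a)"
      by (rule order_trans) (simp add: chord_def norm_fst_le)
  qed
  also have "chord \<gamma> \<xi>' t' \<eta> + ?a = chord \<gamma> \<xi> t \<eta>" by (simp add: chord_def)
  also have "N * norm ?a / q ^ DIM('v \<times> real) \<le> N * ((1 + \<Lambda>) * h) / q ^ DIM('v \<times> real)"
  proof (intro divide_right_mono mult_left_mono)
    have "norm ?a \<le> norm (\<xi> - \<xi>') + \<bar>\<gamma> \<xi> - \<gamma> \<xi>' - (t - t')\<bar>"
      using norm_Pair_le[of "\<xi> - \<xi>'" "\<gamma> \<xi> - \<gamma> \<xi>' - (t - t')"] by simp
    also have "\<dots> \<le> h + \<Lambda> * norm (\<xi> - \<xi>')"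
      using graph_lipschitz[OF half_ball(1)[OF \<xi>] half_ball(1)[OF \<xi>']] h_def by linarith
    also have "\<dots> \<le> h + \<Lambda> * h" using \<Lambda> dist_le_h by (intro add_left_mono mult_left_mono) auto
    finally show "norm ?a \<le> (1 + \<Lambda>) * h" by (simp add: algebra_simps)
  qed (use N_nonneg q_pos in auto)
  finally show ?thesis by simp
qed

text \<open>The difference regroups into the remainder between \<xi>' and \<xi>, which is quadratic
  in h and hence at most of order h r, and the change of the derivative applied to \<xi> - \<eta>.
  Only the Lipschitz constant of D enters.\<close>

lemma remainder_diff: "\<bar>remainder \<gamma> D \<xi> \<eta> - remainder \<gamma> D \<xi>' \<eta>\<bar> \<le> 2 * \<Lambda> * h * r"
proof -
  have eq: "remainder \<gamma> D \<xi> \<eta> - remainder \<gamma> D \<xi>' \<eta> = - remainder \<gamma> D \<xi>' \<xi> + (D \<xi>' - D \<xi>) (\<xi> - \<eta>)"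
    by (simp add: remainder_def blinfun.diff_left blinfun.diff_right algebra_simps)
  have 1: "\<bar>remainder \<gamma> D \<xi>' \<xi>\<bar> \<le> \<Lambda> * h * r"
  proof -
    have "\<bar>remainder \<gamma> D \<xi>' \<xi>\<bar> \<le> \<Lambda> * norm (\<xi>' - \<xi>) ^ 2"
      by (rule remainder_le[OF half_ball(1)[OF \<xi>'] half_ball(1)[OF \<xi>]])
    also have "\<dots> = \<Lambda> * (norm (\<xi> - \<xi>') * norm (\<xi> - \<xi>'))"
      by (simp add: power2_eq_square norm_minus_commute)
    also have "\<dots> \<le> \<Lambda> * (h * r)"
      using \<Lambda> dist_le_h far h by (intro mult_left_mono mult_mono) auto
    finally show ?thesis by simp
  qed
  have "\<bar>(D \<xi>' - D \<xi>) (\<xi> - \<eta>)\<bar> \<le> norm (D \<xi>' - D \<xi>) * r"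
    using norm_blinfun[of "D \<xi>' - D \<xi>" "\<xi> - \<eta>"] by (simp add: r_def)
  also have "\<dots> \<le> (\<Lambda> * norm (\<xi>' - \<xi>)) * r"
    using D_lip half_ball(1)[OF \<xi>'] half_ball(1)[OF \<xi>] q_pos by (intro mult_right_mono) auto
  also have "\<dots> \<le> (\<Lambda> * h) * r"
    using \<Lambda> dist_le_h q_pos by (intro mult_right_mono mult_left_mono) (auto simp: norm_minus_commute)
  finally show ?thesis using 1 unfolding eq by linarith
qed

lemma tangent_diff: "norm (tangent D \<xi> t \<eta> - tangent D \<xi>' t' \<eta>) \<le> h * (1 + \<Lambda> + \<Lambda> * r)"
proof -
  let ?b = "(D \<xi> - D \<xi>') (\<xi> - \<eta>) + D \<xi>' (\<xi> - \<xi>') - (t - t')"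
  have "tangent D \<xi> t \<eta> - tangent D \<xi>' t' \<eta> = (\<xi> - \<xi>', ?b)"
    by (simp add: tangent_def blinfun.diff_left blinfun.diff_right algebra_simps)
  then have "norm (tangent D \<xi> t \<eta> - tangent D \<xi>' t' \<eta>) \<le> norm (\<xi> - \<xi>') + \<bar>?b\<bar>"
    using norm_Pair_le[of "\<xi> - \<xi>'" ?b] by simp
  also have "\<dots> \<le> h + \<bar>(D \<xi> - D \<xi>') (\<xi> - \<eta>)\<bar> + \<bar>D \<xi>' (\<xi> - \<xi>')\<bar>"
    using h_def by linarith
  also have "\<bar>(D \<xi> - D \<xi>') (\<xi> - \<eta>)\<bar> \<le> (\<Lambda> * h) * r"
  proof -
    have "\<bar>(D \<xi> - D \<xi>') (\<xi> - \<eta>)\<bar> \<le> norm (D \<xi> - D \<xi>') * r"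
      using norm_blinfun[of "D \<xi> - D \<xi>'" "\<xi> - \<eta>"] by (simp add: r_def)
    also have "\<dots> \<le> (\<Lambda> * norm (\<xi> - \<xi>')) * r"
      using D_lip half_ball(1)[OF \<xi>'] half_ball(1)[OF \<xi>] q_pos by (intro mult_right_mono) auto
    also have "\<dots> \<le> (\<Lambda> * h) * r"
      using \<Lambda> dist_le_h q_pos by (intro mult_right_mono mult_left_mono) auto
    finally show ?thesis .
  qed
  also have "\<bar>D \<xi>' (\<xi> - \<xi>')\<bar> \<le> \<Lambda> * h"
  proof -
    have "\<bar>D \<xi>' (\<xi> - \<xi>')\<bar> \<le> norm (D \<xi>') * norm (\<xi> - \<xi>')"
      using norm_blinfun[of "D \<xi>'" "\<xi> - \<xi>'"] by simp
    also have "\<dots> \<le> \<Lambda> * h"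
      using D_bound[OF half_ball(1)[OF \<xi>']] \<Lambda> dist_le_h by (intro mult_mono) auto
    finally show ?thesis .
  qed
  finally show ?thesis by (simp add: algebra_simps)
qed

lemma remainder'_le: "\<bar>remainder \<gamma> D \<xi>' \<eta>\<bar> \<le> 4 * \<Lambda> * r ^ 2"
proof -
  have "\<bar>remainder \<gamma> D \<xi>' \<eta>\<bar> \<le> \<Lambda> * norm (\<xi>' - \<eta>) ^ 2" by (rule remainder_le[OF half_ball(1)[OF \<xi>'] \<eta>])
  also have "\<dots> \<le> \<Lambda> * (2 * r) ^ 2" using r'_bounds \<Lambda> by (intro mult_left_mono power_mono) auto
  finally show ?thesis by (simp add: power2_eq_square)
qed

text \<open>The vertical steps are of order r^2 and differ by O(h r), while their starting points
  differ by O(h). With m = \<open>DIM('v)\<close>, the second-difference bound gives h r / r^(m+1)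
  and r^2 h / r^(m+2), both of order h / r^m.\<close>

lemma tangent_kernel_diff2:
  assumes "r \<le> \<rho>"
  shows "norm (k (chord \<gamma> \<xi> t \<eta>) - k (tangent D \<xi> t \<eta>) - (k (chord \<gamma> \<xi>' t' \<eta>) - k (tangent D \<xi>' t' \<eta>)))
    \<le> N * (h * ((\<Lambda> * 2 ^ (DIM('v) + 2) + \<Lambda> * (1 + \<Lambda> + 3 * \<Lambda> * \<rho>) * 2 ^ (DIM('v) + 4)) / r ^ DIM('v)))"
proof -
  let ?a = "(0::'v, remainder \<gamma> D \<xi> \<eta>)" and ?a' = "(0::'v, remainder \<gamma> D \<xi>' \<eta>)"
  have "norm (k (tangent D \<xi> t \<eta> + ?a) - k (tangent D \<xi> t \<eta>) - (k (tangent D \<xi>' t' \<eta> + ?a') - k (tangent D \<xi>' t' \<eta>)))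
    \<le> N * (norm (?a - ?a') / q ^ DIM('v \<times> real) +
        norm ?a' * (norm (tangent D \<xi> t \<eta> - tangent D \<xi>' t' \<eta>) + norm (?a - ?a')) / q ^ (DIM('v \<times> real) + 1))"
  proof (rule kernel_bounds_diff2[OF k q_pos(1)])
    fix s :: real
    have "q \<le> norm (\<xi> - \<eta>)" using q_pos by (simp add: q_def r_def)
    moreover have "norm (\<xi> - \<eta>) \<le> norm (tangent D \<xi> t \<eta> + s *\<^sub>R ?a)" for \<xi> t
      by (simp add: tangent_def norm_fst_le)
    moreover have "norm (\<xi>' - \<eta>) \<le> norm (tangent D \<xi>' t' \<eta> + s *\<^sub>R ?a')"
      by (simp add: tangent_def norm_fst_le)
    ultimately show "q \<le> norm (tangent D \<xi> t \<eta> + s *\<^sub>R ?a) \<and> q \<le> norm (tangent D \<xi>' t' \<eta> + s *\<^sub>R ?a')"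
      using r'_bounds order_trans by blast
  qed
  also have "\<dots> \<le> N * ((2 * \<Lambda> * h * r) / q ^ DIM('v \<times> real) +
      (4 * \<Lambda> * r ^ 2) * (h * (1 + \<Lambda> + \<Lambda> * \<rho>) + 2 * \<Lambda> * h * \<rho>) / q ^ (DIM('v \<times> real) + 1))"
  proof (intro mult_left_mono add_mono divide_right_mono mult_mono)
    show "norm (?a - ?a') \<le> 2 * \<Lambda> * h * r" using remainder_diff by simp
    then show "norm (?a - ?a') \<le> 2 * \<Lambda> * h * \<rho>"
      using mult_left_mono[OF assms, of "2 * \<Lambda> * h"] mult_nonneg_nonneg[OF \<Lambda> less_imp_le[OF h]] by linarith
    show "norm ?a' \<le> 4 * \<Lambda> * r ^ 2" using remainder'_le by simp
    have "h * (1 + \<Lambda> + \<Lambda> * r) \<le> h * (1 + \<Lambda> + \<Lambda> * \<rho>)"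
      using assms \<Lambda> h by (intro mult_left_mono add_left_mono) auto
    then show "norm (tangent D \<xi> t \<eta> - tangent D \<xi>' t' \<eta>) \<le> h * (1 + \<Lambda> + \<Lambda> * \<rho>)"
      using tangent_diff by linarith
  qed (use N_nonneg q_pos h \<Lambda> in auto)
  also have "\<dots> = N * (h * ((\<Lambda> * 2 ^ (DIM('v) + 2) + \<Lambda> * (1 + \<Lambda> + 3 * \<Lambda> * \<rho>) * 2 ^ (DIM('v) + 4)) / r ^ DIM('v)))"
    unfolding q_power using q_pos by (simp add: field_simps power2_eq_square power_add)
  finally show ?thesis by (simp add: chord_eq)
qed

text \<open>A remainder of order r^2 over r^(m+1) is r/r^m with m = \<open>DIM('v)\<close>. The
  factor r is given up for \<rho>, because a factor h from the density will accompany this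
  term.\<close>

lemma tangent_kernel_diff:
  assumes "r \<le> \<rho>"
  shows "norm (k (chord \<gamma> \<xi>' t' \<eta>) - k (tangent D \<xi>' t' \<eta>)) \<le> N * (\<Lambda> * \<rho> * 2 ^ (DIM('v) + 3) / r ^ DIM('v))"
proof -
  have r': "0 < norm (\<xi>' - \<eta>)" using r'_bounds q_pos by linarith
  have "norm (k (chord \<gamma> \<xi>' t' \<eta>) - k (tangent D \<xi>' t' \<eta>)) \<le> N * \<bar>remainder \<gamma> D \<xi>' \<eta>\<bar> / norm (\<xi>' - \<eta>) ^ (DIM('v) + 1)"
    by (rule norm_kernel_vertical_diff_le[OF r'])
  also have "\<dots> \<le> N * (4 * \<Lambda> * r ^ 2) / q ^ (DIM('v) + 1)"
    using N_nonneg remainder'_le r'_bounds q_pos \<Lambda> by (intro frac_le mult_left_mono power_mono zero_less_power) auto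
  also have "\<dots> = N * (\<Lambda> * r * 2 ^ (DIM('v) + 3) / r ^ DIM('v))"
    unfolding q_power using q_pos by (simp add: field_simps power2_eq_square power_add)
  also have "\<dots> \<le> N * (\<Lambda> * \<rho> * 2 ^ (DIM('v) + 3) / r ^ DIM('v))"
    using N_nonneg \<Lambda> q_pos assms by (intro mult_left_mono divide_right_mono mult_right_mono) auto
  finally show ?thesis .
qed

text \<open>With both indicators equal to 1 the increment is a sum of four products, each of order h
  / r^m with m = \<open>DIM('v)\<close>: kernel change times density oscillation, kernel times
  density change, density times second difference, and density change times chord-tangent
  difference.\<close>

lemma correction_diff_inside:
  assumes in1: "\<eta> \<in> ball \<xi> \<rho>" and in2: "\<eta> \<in> ball \<xi>' \<rho>"
  shows "norm (correction k \<rho> \<gamma> D w \<xi> t \<eta> - correction k \<rho> \<gamma> D w \<xi>' t' \<eta>) \<le> N * W * mid_const TYPE('v) \<Lambda> \<rho> * h * (1 / r ^ DIM('v))"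
proof -
  let ?P = "r ^ DIM('v)" and ?m = "DIM('v)"
  let ?c = "k (chord \<gamma> \<xi> t \<eta>)" and ?c' = "k (chord \<gamma> \<xi>' t' \<eta>)"
    and ?f = "k (tangent D \<xi> t \<eta>)" and ?f' = "k (tangent D \<xi>' t' \<eta>)"
  note B = half_ball(1)[OF \<xi>] half_ball(1)[OF \<xi>']
  have r\<rho>: "r \<le> \<rho>" using in1 by (simp add: r_def dist_norm)
  have "correction k \<rho> \<gamma> D w \<xi> t \<eta> - correction k \<rho> \<gamma> D w \<xi>' t' \<eta> =
     (?c - ?c') * (w \<eta> - w \<xi>) + ?c' * (w \<xi>' - w \<xi>) + w \<xi> * (?c - ?f - (?c' - ?f')) + (w \<xi> - w \<xi>') * (?c' - ?f')"
    using in1 in2 by (simp add: correction_def algebra_simps)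
  then have "norm (correction k \<rho> \<gamma> D w \<xi> t \<eta> - correction k \<rho> \<gamma> D w \<xi>' t' \<eta>) \<le>
     norm ((?c - ?c') * (w \<eta> - w \<xi>)) + norm (?c' * (w \<xi>' - w \<xi>)) + norm (w \<xi> * (?c - ?f - (?c' - ?f'))) + norm ((w \<xi> - w \<xi>') * (?c' - ?f'))"
    by (simp only:) (intro norm_triangle_le add_mono order_refl)
  moreover have "norm ((?c - ?c') * (w \<eta> - w \<xi>)) \<le> N * W * h / ?P * (2 ^ (?m + 4) * (1 + \<Lambda>))"
  proof -
    have "norm ((?c - ?c') * (w \<eta> - w \<xi>)) \<le> N * ((1 + \<Lambda>) * h) / q ^ (?m + 1) * (W * r)"
      unfolding norm_mult
    proof (intro mult_mono chord_kernel_diff)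
      show "norm (w \<eta> - w \<xi>) \<le> W * r" using w_lip[OF \<eta> B(1)] by (simp add: r_def norm_minus_commute)
    qed (use N_nonneg \<Lambda> h q_pos in auto)
    also have "\<dots> = N * W * h / ?P * (2 ^ (?m + 1) * (1 + \<Lambda>))"
      unfolding q_power using q_pos by (simp add: field_simps)
    also have "\<dots> \<le> N * W * h / ?P * (2 ^ (?m + 4) * (1 + \<Lambda>))"
      using N_nonneg W h q_pos \<Lambda> by (intro mult_left_mono mult_right_mono power_increasing) auto
    finally show ?thesis .
  qed
  moreover have "norm (?c' * (w \<xi>' - w \<xi>)) \<le> N * W * h / ?P * 2 ^ (?m + 4)"
  proof -
    have "norm (?c' * (w \<xi>' - w \<xi>)) \<le> N / q ^ ?m * (W * h)"
      unfolding norm_mult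
    proof (intro mult_mono)
      show "norm ?c' \<le> N / q ^ ?m"
        using r'_bounds(1) fst_le_chord(1) q_pos by (intro norm_kernel_le[OF k]) (auto intro: order_trans)
      show "norm (w \<xi>' - w \<xi>) \<le> W * h"
        using w_lip[OF B(2) B(1)] mult_left_mono[OF dist_le_h(1) W] by (simp add: norm_minus_commute)
    qed (use N_nonneg q_pos in auto)
    also have "\<dots> = N * W * h / ?P * 2 ^ ?m"
      unfolding q_power using q_pos by (simp add: field_simps)
    also have "\<dots> \<le> N * W * h / ?P * 2 ^ (?m + 4)"
      using N_nonneg W h q_pos by (intro mult_left_mono power_increasing) auto
    finally show ?thesis .
  qed
  moreover have "norm (w \<xi> * (?c - ?f - (?c' - ?f'))) \<le> N * W * h / ?P * (2 ^ (?m + 4) * (\<Lambda> + \<Lambda> * (1 + \<Lambda> + 3 * \<Lambda> * \<rho>)))"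
  proof -
    have "norm (w \<xi> * (?c - ?f - (?c' - ?f'))) \<le>
        W * (N * (h * ((\<Lambda> * 2 ^ (?m + 2) + \<Lambda> * (1 + \<Lambda> + 3 * \<Lambda> * \<rho>) * 2 ^ (?m + 4)) / ?P)))"
      unfolding norm_mult
      using w_bound[OF B(1)] tangent_kernel_diff2[OF r\<rho>] W by (intro mult_mono) auto
    also have "\<dots> = N * W * h / ?P * (2 ^ (?m + 2) * \<Lambda> + 2 ^ (?m + 4) * (\<Lambda> * (1 + \<Lambda> + 3 * \<Lambda> * \<rho>)))"
      by (simp add: algebra_simps add_divide_distrib)
    also have "\<dots> \<le> N * W * h / ?P * (2 ^ (?m + 4) * \<Lambda> + 2 ^ (?m + 4) * (\<Lambda> * (1 + \<Lambda> + 3 * \<Lambda> * \<rho>)))"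
      using N_nonneg W h q_pos \<Lambda> by (intro mult_left_mono add_mono mult_right_mono power_increasing order_refl) auto
    finally show ?thesis by (simp only: distrib_left)
  qed
  moreover have "norm ((w \<xi> - w \<xi>') * (?c' - ?f')) \<le> N * W * h / ?P * (2 ^ (?m + 4) * (\<Lambda> * \<rho>))"
  proof -
    have "norm ((w \<xi> - w \<xi>') * (?c' - ?f')) \<le> (W * h) * (N * (\<Lambda> * \<rho> * 2 ^ (?m + 3) / ?P))"
      unfolding norm_mult
    proof (intro mult_mono tangent_kernel_diff[OF r\<rho>])
      show "norm (w \<xi> - w \<xi>') \<le> W * h"
        using w_lip[OF B] mult_left_mono[OF dist_le_h(1) W] by simp
    qed (use W h in auto)
    also have "\<dots> = N * W * h / ?P * (2 ^ (?m + 3) * (\<Lambda> * \<rho>))" by simp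
    also have "\<dots> \<le> N * W * h / ?P * (2 ^ (?m + 4) * (\<Lambda> * \<rho>))"
      using N_nonneg W h q_pos \<Lambda> \<rho> by (intro mult_left_mono mult_right_mono power_increasing) auto
    finally show ?thesis .
  qed
  moreover have "N * W * h / ?P * (2 ^ (?m + 4) * (1 + \<Lambda>)) + N * W * h / ?P * 2 ^ (?m + 4) +
      N * W * h / ?P * (2 ^ (?m + 4) * (\<Lambda> + \<Lambda> * (1 + \<Lambda> + 3 * \<Lambda> * \<rho>))) + N * W * h / ?P * (2 ^ (?m + 4) * (\<Lambda> * \<rho>))
    = N * W * h / ?P * (2 ^ (?m + 4) * (2 + 2 * \<Lambda> + \<Lambda> * (1 + \<Lambda> + 3 * \<Lambda> * \<rho>) + \<Lambda> * \<rho>))"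
    by (simp only: distrib_left[symmetric]) (simp add: algebra_simps)
  moreover have "\<dots> \<le> N * W * h / ?P * mid_const TYPE('v) \<Lambda> \<rho>"
    unfolding mid_const_def using N_nonneg W h q_pos \<Lambda> \<rho> by (intro mult_left_mono) auto
  ultimately have "norm (correction k \<rho> \<gamma> D w \<xi> t \<eta> - correction k \<rho> \<gamma> D w \<xi>' t' \<eta>) \<le> N * W * h / ?P * mid_const TYPE('v) \<Lambda> \<rho>" by linarith
  then show ?thesis by (simp add: mult_ac)
qed

text \<open>Both flat terms vanish, so only the chord kernel moves. Its increment has one more power
  of r in the denominator, which costs 1/\<rho> as r \<ge> \<rho>.\<close>

lemma correction_diff_outside:
  assumes out1: "\<eta> \<notin> ball \<xi> \<rho>" and out2: "\<eta> \<notin> ball \<xi>' \<rho>"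
  shows "norm (correction k \<rho> \<gamma> D w \<xi> t \<eta> - correction k \<rho> \<gamma> D w \<xi>' t' \<eta>) \<le> N * W * mid_const TYPE('v) \<Lambda> \<rho> * h * (1 / r ^ DIM('v))"
proof -
  let ?P = "r ^ DIM('v)" and ?m = "DIM('v)"
  have r\<rho>: "\<rho> \<le> r" using out1 by (simp add: r_def dist_norm)
  have "correction k \<rho> \<gamma> D w \<xi> t \<eta> - correction k \<rho> \<gamma> D w \<xi>' t' \<eta> = (k (chord \<gamma> \<xi> t \<eta>) - k (chord \<gamma> \<xi>' t' \<eta>)) * w \<eta>"
    using out1 out2 by (simp add: correction_def left_diff_distrib)
  also have "norm \<dots> \<le> N * ((1 + \<Lambda>) * h) / q ^ (?m + 1) * W"
    unfolding norm_mult using w_bound[OF \<eta>] N_nonneg \<Lambda> h q_pos by (intro mult_mono chord_kernel_diff) auto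
  also have "\<dots> = N * W * h / ?P * (2 ^ (?m + 1) * ((1 + \<Lambda>) / r))"
    unfolding q_power using q_pos by (simp add: field_simps)
  also have "\<dots> \<le> N * W * h / ?P * (2 ^ (?m + 4) * ((1 + \<Lambda>) / \<rho>))"
    using N_nonneg W h q_pos \<Lambda> \<rho> r\<rho>
    by (intro mult_left_mono mult_mono power_increasing divide_left_mono) auto
  also have "\<dots> \<le> N * W * h / ?P * mid_const TYPE('v) \<Lambda> \<rho>"
    unfolding mid_const_def using N_nonneg W h q_pos \<Lambda> \<rho> by (intro mult_left_mono) auto
  finally show ?thesis by (simp add: mult_ac)
qed

text \<open>If the indicators differ, the two corrections need not cancel, and they are estimated
  separately. This suffices because the bound is used only on a shell whose width is of order
  h.\<close>

lemma correction_diff_shell: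
  shows "norm (correction k \<rho> \<gamma> D w \<xi> t \<eta> - correction k \<rho> \<gamma> D w \<xi>' t' \<eta>) \<le> N * W * corr_const \<Lambda> \<rho> * 2 ^ DIM('v) * (1 / r ^ (DIM('v) - 1))"
proof -
  let ?j = "DIM('v) - 1"
  have pos: "0 \<le> N * W * corr_const \<Lambda> \<rho>" using N_nonneg W corr_const_nonneg by simp
  have "norm (correction k \<rho> \<gamma> D w \<xi> t \<eta> - correction k \<rho> \<gamma> D w \<xi>' t' \<eta>) \<le> norm (correction k \<rho> \<gamma> D w \<xi> t \<eta>) + norm (correction k \<rho> \<gamma> D w \<xi>' t' \<eta>)"
    by (rule norm_triangle_ineq4)
  also have "\<dots> \<le> N * W * corr_const \<Lambda> \<rho> * (1 / r ^ ?j) + N * W * corr_const \<Lambda> \<rho> * (2 ^ ?j * (1 / r ^ ?j))"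
  proof (intro add_mono)
    show "norm (correction k \<rho> \<gamma> D w \<xi> t \<eta>) \<le> N * W * corr_const \<Lambda> \<rho> * (1 / r ^ ?j)"
      unfolding r_def by (rule norm_correction_le[OF \<xi> \<eta>])
    have "norm (correction k \<rho> \<gamma> D w \<xi>' t' \<eta>) \<le> N * W * corr_const \<Lambda> \<rho> * (1 / norm (\<xi>' - \<eta>) ^ ?j)"
      by (rule norm_correction_le[OF \<xi>' \<eta>])
    also have "\<dots> \<le> N * W * corr_const \<Lambda> \<rho> * (1 / q ^ ?j)"
      using r'_bounds q_pos pos
      by (intro mult_left_mono divide_left_mono power_mono mult_pos_pos zero_less_power) auto
    finally show "norm (correction k \<rho> \<gamma> D w \<xi>' t' \<eta>) \<le> N * W * corr_const \<Lambda> \<rho> * (2 ^ ?j * (1 / r ^ ?j))"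
      by (simp add: q_power)
  qed
  also have "\<dots> = N * W * corr_const \<Lambda> \<rho> * ((1 + 2 ^ ?j) * (1 / r ^ ?j))" by (simp add: algebra_simps)
  also have "\<dots> \<le> N * W * corr_const \<Lambda> \<rho> * (2 ^ DIM('v) * (1 / r ^ ?j))"
    using pos q_pos one_le_power[of "2::real" ?j]
    by (intro mult_left_mono mult_right_mono) (auto simp: power_DIM_Suc[where 'a = 'v])
  finally show ?thesis by simp
qed

end

text \<open>Within 2 h of \<xi> the two corrections are integrated separately, which costs O(h).
  Further out the increment is of order h / r^m, with m = \<open>DIM('v)\<close>, and integrates to
  h times a logarithm, except on the shell where the discs disagree; there thinness gives O(h)
  again.\<close>

lemma correction_integral_diff:
  assumes \<xi>: "\<xi> \<in> ball 0 \<rho>" and \<xi>': "\<xi>' \<in> ball 0 \<rho>" and t: "t \<noteq> 0" "t' \<noteq> 0"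
    and h_def: "h = norm (\<xi> - \<xi>') + \<bar>t - t'\<bar>" and h: "0 < h" "h \<le> \<rho>"
  shows "norm ((LINT \<eta>:B|lborel. correction k \<rho> \<gamma> D w \<xi> t \<eta>) - (LINT \<eta>:B|lborel. correction k \<rho> \<gamma> D w \<xi>' t' \<eta>)) \<le>
    N * W * corr_const \<Lambda> \<rho> * (sphere_area TYPE('v) * (2 * h)) + N * W * corr_const \<Lambda> \<rho> * (sphere_area TYPE('v) * (3 * h)) +
    N * W * corr_const \<Lambda> \<rho> * 2 ^ DIM('v) * (sphere_area TYPE('v) * (2 * h)) +
    N * W * mid_const TYPE('v) \<Lambda> \<rho> * h * (sphere_area TYPE('v) * (ln (3 * \<rho>) - ln (2 * h)))"
    (is "_ \<le> ?b1 + ?b2 + ?b3 + ?b4")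
proof -
  let ?m = "DIM('v)" and ?S = "sphere_area TYPE('v)"
  note int = graph_potential_decomposition(1)[OF \<xi> t(1)] graph_potential_decomposition(1)[OF \<xi>' t(2)]
  let ?A = "N * W * corr_const \<Lambda> \<rho>" and ?C = "N * W * mid_const TYPE('v) \<Lambda> \<rho> * h"
  have A: "0 \<le> ?A" using N_nonneg W corr_const_nonneg by simp
  have C: "0 \<le> ?C" using N_nonneg W mid_const_nonneg h by simp
  let ?u = "\<lambda>\<xi> a b (\<eta>::'v). ennreal (1 / norm (\<xi> - \<eta>) ^ (?m - 1)) * indicator {a..b} (norm (\<xi> - \<eta>))"
  let ?v = "\<lambda>\<eta>. ennreal (1 / norm (\<xi> - \<eta>) ^ ?m) * indicator {2 * h..3 * \<rho>} (norm (\<xi> - \<eta>))"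
  \<comment> \<open>?g1 and ?g2 majorize the corrections at \<xi> and \<xi>' near \<xi>, ?g3 the
    shell and ?g4 the remaining points. They are defined everywhere and may simply be added. The
    radius 3 h in ?g2 is 2 h plus the distance of the centres.\<close>
  let ?g1 = "\<lambda>\<eta>. ennreal ?A * ?u \<xi> 0 (2 * h) \<eta>" and ?g2 = "\<lambda>\<eta>. ennreal ?A * ?u \<xi>' 0 (3 * h) \<eta>"
    and ?g3 = "\<lambda>\<eta>. ennreal (?A * 2 ^ ?m) * ?u \<xi> (\<rho> - h) (\<rho> + h) \<eta>" and ?g4 = "\<lambda>\<eta>. ennreal ?C * ?v \<eta>"
  have ln: "ln (2 * h) \<le> ln (3 * \<rho>)" using h by simp
  have nonneg: "0 \<le> ?b1" "0 \<le> ?b2" "0 \<le> ?b3" "0 \<le> ?b4"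
    using A C h ln by (simp_all del: ln_mult)
  have lin: "(\<integral>\<^sup>+\<eta>. ennreal c * ?u x a b \<eta> \<partial>lborel) \<le> ennreal (c * (?S * (b - a)))"
    if "0 \<le> c" "0 \<le> a" "a \<le> b" for c a b x
  proof -
    have "(\<integral>\<^sup>+\<eta>. ennreal c * ?u x a b \<eta> \<partial>lborel) = ennreal c * (\<integral>\<^sup>+\<eta>. ?u x a b \<eta> \<partial>lborel)"
      by (rule nn_integral_cmult) measurable
    also have "\<dots> \<le> ennreal c * ennreal (?S * (b - a))"
      using that by (intro mult_left_mono nn_integral_shift_indicator[where f = "\<lambda>r. 1 / r ^ (DIM('v) - 1)"]
          radial_integral_le_linear) auto
    also have "\<dots> = ennreal (c * (?S * (b - a)))" using that by (simp add: ennreal_mult)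
    finally show ?thesis .
  qed
  have log: "(\<integral>\<^sup>+\<eta>. ?g4 \<eta> \<partial>lborel) \<le> ennreal ?b4"
  proof -
    have "(\<integral>\<^sup>+\<eta>. ?g4 \<eta> \<partial>lborel) = ennreal ?C * (\<integral>\<^sup>+\<eta>. ?v \<eta> \<partial>lborel)"
      by (rule nn_integral_cmult) measurable
    also have "\<dots> \<le> ennreal ?C * ennreal (?S * (ln (3 * \<rho>) - ln (2 * h)))"
      using h by (intro mult_left_mono nn_integral_shift_indicator[where f = "\<lambda>r. 1 / r ^ DIM('v)"]
          radial_integral_le_ln) auto
    also have "\<dots> = ennreal ?b4" using C ln by (subst ennreal_mult) (auto simp del: ln_mult)
    finally show ?thesis .
  qed
  have "(LINT \<eta>:B|lborel. correction k \<rho> \<gamma> D w \<xi> t \<eta>) - (LINT \<eta>:B|lborel. correction k \<rho> \<gamma> D w \<xi>' t' \<eta>) =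
      (LINT \<eta>:B|lborel. correction k \<rho> \<gamma> D w \<xi> t \<eta> - correction k \<rho> \<gamma> D w \<xi>' t' \<eta>)"
    using set_integral_diff(2)[OF int] by simp
  also have "norm \<dots> \<le> ?b1 + ?b2 + ?b3 + ?b4"
  proof (rule norm_set_integral_le[OF set_integral_diff(1)[OF int], where g = "\<lambda>\<eta>. ?g1 \<eta> + ?g2 \<eta> + ?g3 \<eta> + ?g4 \<eta>"])
    fix \<eta> :: 'v assume \<eta>: "\<eta> \<in> B"
    let ?d = "norm (correction k \<rho> \<gamma> D w \<xi> t \<eta> - correction k \<rho> \<gamma> D w \<xi>' t' \<eta>)"
    have near_\<xi>: "norm (\<xi>' - \<eta>) \<le> norm (\<xi> - \<eta>) + h" "norm (\<xi> - \<eta>) \<le> norm (\<xi>' - \<eta>) + h"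
      using norm_triangle_ineq[of "\<xi>' - \<xi>" "\<xi> - \<eta>"] norm_triangle_ineq[of "\<xi> - \<xi>'" "\<xi>' - \<eta>"] h_def
      by (auto simp: norm_minus_commute)
    show "ennreal ?d \<le> ?g1 \<eta> + ?g2 \<eta> + ?g3 \<eta> + ?g4 \<eta>"
    proof (cases "norm (\<xi> - \<eta>) \<le> 2 * h")
      case True
      have "?d \<le> norm (correction k \<rho> \<gamma> D w \<xi> t \<eta>) + norm (correction k \<rho> \<gamma> D w \<xi>' t' \<eta>)" by (rule norm_triangle_ineq4)
      also have "\<dots> \<le> ?A * (1 / norm (\<xi> - \<eta>) ^ (?m - 1)) + ?A * (1 / norm (\<xi>' - \<eta>) ^ (?m - 1))"
        by (intro add_mono norm_correction_le \<xi> \<xi>' \<eta>)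
      finally have "ennreal ?d \<le> ennreal (?A * (1 / norm (\<xi> - \<eta>) ^ (?m - 1))) + ennreal (?A * (1 / norm (\<xi>' - \<eta>) ^ (?m - 1)))"
        using A by (subst ennreal_plus[symmetric]) (simp_all del: ennreal_plus add: ennreal_leI)
      also have "\<dots> = ?g1 \<eta> + ?g2 \<eta>"
        using True near_\<xi> h A by (simp add: ennreal_mult[symmetric])
      finally show ?thesis by (simp add: add_increasing2)
    next
      case False
      then have far: "2 * h \<le> norm (\<xi> - \<eta>)" by simp
      have up: "norm (\<xi> - \<eta>) \<le> 3 * \<rho>" using \<xi> \<eta> norm_triangle_ineq4[of \<xi> \<eta>] by (simp add: dist_norm)
      show ?thesis
      proof (cases "\<eta> \<in> ball \<xi> \<rho> \<longleftrightarrow> \<eta> \<in> ball \<xi>' \<rho>")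
        case True
        then have "?d \<le> ?C * (1 / norm (\<xi> - \<eta>) ^ ?m)"
          using correction_diff_inside[OF \<xi> \<xi>' \<eta> h_def h(1) refl far refl]
            correction_diff_outside[OF \<xi> \<xi>' \<eta> h_def h(1) refl far refl] by blast
        then have "ennreal ?d \<le> ?g4 \<eta>"
          using far up C by (simp add: ennreal_mult[symmetric] ennreal_leI)
        then show ?thesis by (simp add: add_increasing)
      next
        case False
        \<comment> \<open>A point of exactly one of two discs with centres at most h apart has
          distance between \<rho> - h and \<rho> + h from \<xi>.\<close>
        then have shell: "norm (\<xi> - \<eta>) \<in> {\<rho> - h..\<rho> + h}"
          using near_\<xi> by (auto simp: dist_norm)
        have "?d \<le> (?A * 2 ^ ?m) * (1 / norm (\<xi> - \<eta>) ^ (?m - 1))"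
          by (rule correction_diff_shell[OF \<xi> \<xi>' \<eta> h_def h(1) refl far refl])
        then have "ennreal ?d \<le> ennreal ((?A * 2 ^ ?m) * (1 / norm (\<xi> - \<eta>) ^ (?m - 1)))"
          by (rule ennreal_leI)
        also have "\<dots> = ?g3 \<eta>"
          using shell A by (subst ennreal_mult) auto
        finally show ?thesis by (simp add: add_increasing add_increasing2)
      qed
    qed
  next
    have meas: "?g1 \<in> borel_measurable lborel" "?g2 \<in> borel_measurable lborel"
      "?g3 \<in> borel_measurable lborel" "?g4 \<in> borel_measurable lborel" by measurable
    have "(\<integral>\<^sup>+\<eta>. ?g1 \<eta> + ?g2 \<eta> + ?g3 \<eta> + ?g4 \<eta> \<partial>lborel) =
       (\<integral>\<^sup>+\<eta>. ?g1 \<eta> \<partial>lborel) + (\<integral>\<^sup>+\<eta>. ?g2 \<eta> \<partial>lborel) + (\<integral>\<^sup>+\<eta>. ?g3 \<eta> \<partial>lborel) + (\<integral>\<^sup>+\<eta>. ?g4 \<eta> \<partial>lborel)"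
      by (simp only: nn_integral_add meas borel_measurable_add)
    also have "\<dots> \<le> ennreal ?b1 + ennreal ?b2 + ennreal ?b3 + ennreal ?b4"
      using lin[of ?A 0 "2 * h" \<xi>] lin[of ?A 0 "3 * h" \<xi>'] lin[of "?A * 2 ^ ?m" "\<rho> - h" "\<rho> + h" \<xi>] A h
      by (intro add_mono log) simp_all
    also have "\<dots> = ennreal (?b1 + ?b2 + ?b3 + ?b4)"
      using nonneg by (simp only: ennreal_plus add_nonneg_nonneg)
    finally show "(\<integral>\<^sup>+\<eta>. ?g1 \<eta> + ?g2 \<eta> + ?g3 \<eta> + ?g4 \<eta> \<partial>lborel) \<le> ennreal (?b1 + ?b2 + ?b3 + ?b4)" .
    show "0 \<le> ?b1 + ?b2 + ?b3 + ?b4" using nonneg by (intro add_nonneg_nonneg)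
  qed
  finally show ?thesis .
qed

text \<open>The flat part is changed in three Lipschitz moves: density, height, slope. The height
  move needs both points on the same side, hence \<open>0 < t * t'\<close>. The factor |ln h| comes
  from the correction alone.\<close>

lemma graph_potential_hoelder:
  assumes \<xi>: "\<xi> \<in> ball 0 \<rho>" and \<xi>': "\<xi>' \<in> ball 0 \<rho>" and tt: "0 < t * t'"
    and h_def: "h = norm (\<xi> - \<xi>') + \<bar>t - t'\<bar>" and h: "0 < h" "h \<le> \<rho>"
  shows "norm (graph_potential k \<rho> \<gamma> w \<xi> t - graph_potential k \<rho> \<gamma> w \<xi>' t') \<le>
    N * W * h * (hoelder_const TYPE('v) \<Lambda> \<rho> + mid_const TYPE('v) \<Lambda> \<rho> * sphere_area TYPE('v) * \<bar>ln h\<bar>)"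
proof -
  let ?S = "sphere_area TYPE('v)" and ?F = "flat_const TYPE('v) \<Lambda>"
  have t: "t \<noteq> 0" "t' \<noteq> 0" using tt by auto
  note B = half_ball(1)[OF \<xi>] half_ball(1)[OF \<xi>']
  have hh: "norm (\<xi> - \<xi>') \<le> h" "\<bar>t - t'\<bar> \<le> h" using h_def by auto
  let ?G = "\<lambda>l t. flat_integral k \<rho> l t"
  have F: "0 \<le> ?F" using \<Lambda> by (simp add: flat_const_def)
  have "w \<xi> * ?G (D \<xi>) t - w \<xi>' * ?G (D \<xi>') t' =
     (w \<xi> - w \<xi>') * ?G (D \<xi>) t + w \<xi>' * (?G (D \<xi>) t - ?G (D \<xi>) t') + w \<xi>' * (?G (D \<xi>) t' - ?G (D \<xi>') t')"
    by (simp add: algebra_simps)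
  then have "norm (w \<xi> * ?G (D \<xi>) t - w \<xi>' * ?G (D \<xi>') t') \<le>
     norm ((w \<xi> - w \<xi>') * ?G (D \<xi>) t) + norm (w \<xi>' * (?G (D \<xi>) t - ?G (D \<xi>) t')) + norm (w \<xi>' * (?G (D \<xi>) t' - ?G (D \<xi>') t'))"
    by (simp only:) (intro norm_triangle_le add_mono order_refl)
  also have "\<dots> \<le> (W * h) * (N * ?F) + W * (N * ?S * h / \<rho>) + W * (N * (\<Lambda> * h) * ?F)"
    unfolding norm_mult
  proof (intro add_mono mult_mono)
    show "norm (w \<xi> - w \<xi>') \<le> W * h"
      using w_lip[OF B] mult_left_mono[OF hh(1) W] by simp
    show "norm (?G (D \<xi>) t) \<le> N * ?F" by (rule norm_flat_integral_le[OF k t(1) D_bound[OF B(1)]])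
    have "norm (?G (D \<xi>) t - ?G (D \<xi>) t') \<le> N * ?S * \<bar>t - t'\<bar> / \<rho>"
      by (rule flat_integral_lipschitz_height[OF k tt \<rho>])
    also have "\<dots> \<le> N * ?S * h / \<rho>"
      using hh N_nonneg \<rho> by (intro divide_right_mono mult_left_mono) auto
    finally show "norm (?G (D \<xi>) t - ?G (D \<xi>) t') \<le> N * ?S * h / \<rho>" .
    have "norm (?G (D \<xi>) t' - ?G (D \<xi>') t') \<le> N * norm (D \<xi> - D \<xi>') * ?F"
      by (rule flat_integral_lipschitz_slope[OF k t(2) D_bound[OF B(1)] D_bound[OF B(2)]])
    also have "\<dots> \<le> N * (\<Lambda> * h) * ?F"
      using D_lip[OF B] mult_left_mono[OF hh(1) \<Lambda>] N_nonneg F by (intro mult_right_mono mult_left_mono) auto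
    finally show "norm (?G (D \<xi>) t' - ?G (D \<xi>') t') \<le> N * (\<Lambda> * h) * ?F" .
  qed (use w_bound[OF B(2)] W h in auto)
  finally have flat: "norm (w \<xi> * ?G (D \<xi>) t - w \<xi>' * ?G (D \<xi>') t') \<le> N * W * h * (?F + \<Lambda> * ?F + ?S / \<rho>)"
    by (simp add: algebra_simps)
  have "norm ((LINT \<eta>:B|lborel. correction k \<rho> \<gamma> D w \<xi> t \<eta>) - (LINT \<eta>:B|lborel. correction k \<rho> \<gamma> D w \<xi>' t' \<eta>)) \<le>
    N * W * h * (corr_const \<Lambda> \<rho> * ?S * (5 + 2 * 2 ^ DIM('v)) + mid_const TYPE('v) \<Lambda> \<rho> * ?S * (ln (3 * \<rho>) - ln (2 * h)))"
    using correction_integral_diff[OF \<xi> \<xi>' t h_def h] by (simp add: algebra_simps del: ln_mult)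
  also have "\<dots> \<le> N * W * h * (corr_const \<Lambda> \<rho> * ?S * (5 + 2 * 2 ^ DIM('v)) + mid_const TYPE('v) \<Lambda> \<rho> * ?S * (\<bar>ln (3 * \<rho>)\<bar> + \<bar>ln h\<bar>))"
  proof (intro mult_left_mono add_left_mono)
    have "ln (2 * h) = ln 2 + ln h" using h by (simp add: ln_mult)
    moreover have "0 \<le> ln (2::real)" by simp
    ultimately show "ln (3 * \<rho>) - ln (2 * h) \<le> \<bar>ln (3 * \<rho>)\<bar> + \<bar>ln h\<bar>" by linarith
  qed (use N_nonneg W h mid_const_nonneg in auto)
  finally have corr: "norm ((LINT \<eta>:B|lborel. correction k \<rho> \<gamma> D w \<xi> t \<eta>) - (LINT \<eta>:B|lborel. correction k \<rho> \<gamma> D w \<xi>' t' \<eta>)) \<le>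
    N * W * h * (corr_const \<Lambda> \<rho> * ?S * (5 + 2 * 2 ^ DIM('v)) + mid_const TYPE('v) \<Lambda> \<rho> * ?S * (\<bar>ln (3 * \<rho>)\<bar> + \<bar>ln h\<bar>))" .
  have "graph_potential k \<rho> \<gamma> w \<xi> t - graph_potential k \<rho> \<gamma> w \<xi>' t' = (w \<xi> * ?G (D \<xi>) t - w \<xi>' * ?G (D \<xi>') t') +
      ((LINT \<eta>:B|lborel. correction k \<rho> \<gamma> D w \<xi> t \<eta>) - (LINT \<eta>:B|lborel. correction k \<rho> \<gamma> D w \<xi>' t' \<eta>))"
    unfolding graph_potential_decomposition(2)[OF \<xi> t(1)] graph_potential_decomposition(2)[OF \<xi>' t(2)]
    by simp
  then have "norm (graph_potential k \<rho> \<gamma> w \<xi> t - graph_potential k \<rho> \<gamma> w \<xi>' t') \<le> N * W * h * (?F + \<Lambda> * ?F + ?S / \<rho>) +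
     N * W * h * (corr_const \<Lambda> \<rho> * ?S * (5 + 2 * 2 ^ DIM('v)) + mid_const TYPE('v) \<Lambda> \<rho> * ?S * (\<bar>ln (3 * \<rho>)\<bar> + \<bar>ln h\<bar>))"
    using flat corr by (simp only:) (intro norm_triangle_le add_mono)
  also have "\<dots> = N * W * h * ((?F + \<Lambda> * ?F + ?S / \<rho>) +
     (corr_const \<Lambda> \<rho> * ?S * (5 + 2 * 2 ^ DIM('v)) + mid_const TYPE('v) \<Lambda> \<rho> * ?S * (\<bar>ln (3 * \<rho>)\<bar> + \<bar>ln h\<bar>)))"
    by (rule distrib_left[symmetric])
  also have "\<dots> \<le> N * W * h * (hoelder_const TYPE('v) \<Lambda> \<rho> + mid_const TYPE('v) \<Lambda> \<rho> * ?S * \<bar>ln h\<bar>)"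
    unfolding hoelder_const_def using N_nonneg W h F by (intro mult_left_mono) (auto simp: algebra_simps)
  finally show ?thesis .
qed

end

hide_const (open) B

section \<open>Change of variables for areas of graphs\<close>

lemma inner_matrix_vector_mult: "((A :: real^'n^'n) *v x) \<bullet> z = x \<bullet> (transpose A *v z)"
  by (metis dot_lmul_matrix vector_transpose_matrix)

lemma matrix_mult_linear: "linear f \<Longrightarrow> matrix f *v (x :: real^'n) = (f x :: real^'m)"
  by (metis matrix_vector_mul(2))

text \<open>The two bilinear forms correspond under A, that is, M = A^T M' A.\<close>

lemma det_congruence:
  fixes M M' A :: "real^'n^'n"
  assumes "\<And>x y. x \<bullet> (M *v y) = (A *v x) \<bullet> (M' *v (A *v y))"
  shows "det M = (det A)\<^sup>2 * det M'"
proof -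
  have inner: "x \<bullet> (M *v y) = x \<bullet> ((transpose A ** M' ** A) *v y)" for x y
    unfolding assms inner_matrix_vector_mult by (simp add: matrix_vector_mul_assoc matrix_mul_assoc)
  have eq: "M *v y = (transpose A ** M' ** A) *v y" for y
    by (rule vector_eq_ldot[THEN iffD1]) (intro allI inner)
  have "M = transpose A ** M' ** A" unfolding matrix_eq by (intro allI eq)
  then show ?thesis by (simp add: det_mul power2_eq_square)
qed

text \<open>The first fundamental form I + v v^T of a graph with gradient v, in the coordinates of
  its base.\<close>

definition metric_matrix :: "real^'n \<Rightarrow> real^'n^'n" where
  "metric_matrix v = matrix (\<lambda>y. y + (v \<bullet> y) *\<^sub>R v)"

lemma metric_matrix_mult: "metric_matrix v *v y = y + (v \<bullet> y) *\<^sub>R v"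
proof -
  have "linear (\<lambda>y. y + (v \<bullet> y) *\<^sub>R v)"
    by (rule linearI) (auto simp: algebra_simps inner_add_right)
  then show ?thesis unfolding metric_matrix_def by (rule matrix_mult_linear)
qed

lemma metric_matrix_nth: "metric_matrix v $ i $ j = (if i = j then 1 else 0) + v $ j * v $ i"
proof -
  have "metric_matrix v $ i $ j = (axis j 1 + (v \<bullet> axis j 1) *\<^sub>R v) $ i"
    by (simp add: metric_matrix_def matrix_def)
  then show ?thesis by (simp add: inner_axis) (simp add: axis_def)
qed

text \<open>A rotation carries v to a multiple of a coordinate vector, for which the matrix is
  diagonal with at most one entry different from 1.\<close>

lemma det_metric_matrix: "det (metric_matrix (v :: real^'n)) = 1 + (norm v)\<^sup>2"
proof -
  obtain k :: 'n where True by simp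
  let ?a = "norm v *\<^sub>R (axis k 1 :: real^'n)"
  obtain Q where Q: "orthogonal_transformation Q" "Q ?a = v"
    using orthogonal_transformation_exists[of ?a v] by (auto simp: norm_axis_1)
  then have lin: "linear Q" by (simp add: orthogonal_transformation)
  have inn: "Q x \<bullet> Q y = x \<bullet> y" for x y using Q(1) by (simp add: orthogonal_transformation_def)
  have "det (metric_matrix ?a) = (det (matrix Q))\<^sup>2 * det (metric_matrix v)"
  proof (rule det_congruence)
    fix x y
    have "v \<bullet> Q y = ?a \<bullet> y" for y using inn[of ?a y] Q(2) by simp
    then show "x \<bullet> (metric_matrix ?a *v y) = (matrix Q *v x) \<bullet> (metric_matrix v *v (matrix Q *v y))"
      unfolding metric_matrix_mult matrix_mult_linear[OF lin]
      by (simp add: inner_add_right inn inner_commute)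
  qed
  moreover have "(det (matrix Q))\<^sup>2 = 1"
    using det_orthogonal_matrix[of "matrix Q"] Q(1) by (auto simp: orthogonal_transformation_matrix)
  moreover have "det (metric_matrix ?a) = (\<Prod>i\<in>UNIV. metric_matrix ?a $ i $ i)"
    by (rule det_diagonal) (simp add: metric_matrix_nth, auto simp: axis_def)
  moreover have "(\<Prod>i\<in>UNIV. metric_matrix ?a $ i $ i) = (\<Prod>i\<in>UNIV. if i = k then 1 + (norm v)\<^sup>2 else 1)"
    by (rule prod.cong) (auto simp: metric_matrix_nth axis_def power2_eq_square)
  ultimately show ?thesis by simp
qed

text \<open>A carries one first fundamental form to the other, so their determinants differ by the
  factor det(A)^2. The square roots of these determinants are the area elements.\<close>

lemma jacobian_eq:
  fixes A :: "real^'n \<Rightarrow> real^'n"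
  assumes "linear A"
    and "\<And>x y. x \<bullet> y + (v \<bullet> x) * (v \<bullet> y) = A x \<bullet> A y + (v' \<bullet> A x) * (v' \<bullet> A y)"
  shows "\<bar>det (matrix A)\<bar> * sqrt (1 + (norm v')\<^sup>2) = sqrt (1 + (norm v)\<^sup>2)"
proof -
  have "det (metric_matrix v) = (det (matrix A))\<^sup>2 * det (metric_matrix v')"
    by (rule det_congruence)
      (use assms(2) in \<open>simp add: metric_matrix_mult matrix_mult_linear[OF assms(1)] inner_add_right inner_commute mult_ac\<close>)
  then have "sqrt (1 + (norm v)\<^sup>2) = sqrt ((det (matrix A))\<^sup>2 * (1 + (norm v')\<^sup>2))"
    by (simp only: det_metric_matrix)
  then show ?thesis by (simp add: real_sqrt_mult)
qed

lemma set_integrable_lebesgue_continuous: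
  fixes f :: "'v::euclidean_space \<Rightarrow> 'b::{banach, second_countable_topology}"
  assumes "S \<in> sets borel" "bounded S" and "continuous_on S f"
    and "\<And>x. x \<in> S \<Longrightarrow> norm (f x) \<le> B"
  shows "f absolutely_integrable_on S"
proof -
  have "set_integrable lborel S f" using assms by (rule set_integrable_continuous_bounded)
  then show ?thesis
    unfolding set_integrable_def using integrable_completion borel_measurable_integrable by blast
qed

lemma nn_integral_absolutely_integrable:
  fixes f :: "'v::euclidean_space \<Rightarrow> real"
  assumes "f absolutely_integrable_on S" "\<And>x. 0 \<le> f x"
  shows "(\<integral>\<^sup>+x\<in>S. ennreal (f x) \<partial>lborel) = ennreal (integral S f)"
  using assms set_lebesgue_integral_eq_integral(1)[OF assms(1)]
  by (intro nn_integral_has_integral_lebesgue') (auto intro: integrable_integral)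

text \<open>By \<open>jacobian_eq\<close> the Jacobian times the area element at \<phi> x equals the
  area element at x, so the change of variables formula applies. Integrability is checked on S,
  where the area element is continuous and bounded. That formula is stated for vector valued
  integrands, hence the wrapping into \<open>real^1\<close>.\<close>

lemma graph_area_change_wellorder:
  fixes \<phi> v v' :: "real^'n::{finite,wellorder} \<Rightarrow> real^'n::_"
  assumes S: "S \<in> sets borel" "bounded S" and inj: "inj_on \<phi> S"
    and der: "\<And>x. x \<in> S \<Longrightarrow> (\<phi> has_derivative \<phi>' x) (at x within S)"
    and form: "\<And>x u u'. x \<in> S \<Longrightarrow> u \<bullet> u' + (v x \<bullet> u) * (v x \<bullet> u') =
        \<phi>' x u \<bullet> \<phi>' x u' + (v' (\<phi> x) \<bullet> \<phi>' x u) * (v' (\<phi> x) \<bullet> \<phi>' x u')"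
    and cont: "continuous_on S (\<lambda>x. norm (v x))" and le: "\<And>x. x \<in> S \<Longrightarrow> norm (v x) \<le> \<Lambda>"
  shows "(\<integral>\<^sup>+x\<in>S. ennreal (sqrt (1 + (norm (v x))\<^sup>2)) \<partial>lborel) =
         (\<integral>\<^sup>+x\<in>\<phi> ` S. ennreal (sqrt (1 + (norm (v' x))\<^sup>2)) \<partial>lborel)"
proof -
  let ?J = "\<lambda>x. sqrt (1 + (norm (v x))\<^sup>2)" and ?J' = "\<lambda>x. sqrt (1 + (norm (v' x))\<^sup>2)"
  have eq: "\<bar>det (matrix (\<phi>' x))\<bar> *\<^sub>R (vec (?J' (\<phi> x)) :: real^1) = vec (?J x)" if "x \<in> S" for x
    using jacobian_eq[OF has_derivative_linear[OF der[OF that]] form[OF that]]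
    by (simp add: vec_eq_iff)
  have J: "?J absolutely_integrable_on S"
  proof (rule set_integrable_lebesgue_continuous[OF S, where B = "sqrt (1 + \<Lambda>\<^sup>2)"])
    show "continuous_on S ?J" by (intro continuous_intros cont)
    show "norm (?J x) \<le> sqrt (1 + \<Lambda>\<^sup>2)" if "x \<in> S" for x
      using le[OF that] by (simp add: power_mono)
  qed
  then have J1: "(\<lambda>x. vec (?J x) :: real^1) absolutely_integrable_on S"
    by (simp add: absolutely_integrable_on_1_iff)
  have int: "(\<lambda>x. \<bar>det (matrix (\<phi>' x))\<bar> *\<^sub>R (vec (?J' (\<phi> x)) :: real^1)) absolutely_integrable_on S"
    using J1 eq set_integrable_cong[of lebesgue lebesgue S S] by (simp cong: set_integrable_cong)
  have "integral S (\<lambda>x. \<bar>det (matrix (\<phi>' x))\<bar> *\<^sub>R (vec (?J' (\<phi> x)) :: real^1)) = integral S (\<lambda>x. vec (?J x))"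
    by (rule integral_cong) (rule eq)
  also have "\<dots> = vec (integral S ?J)" by (simp add: integral_on_1_eq)
  finally have val: "integral S (\<lambda>x. \<bar>det (matrix (\<phi>' x))\<bar> *\<^sub>R (vec (?J' (\<phi> x)) :: real^1)) = vec (integral S ?J)" .
  have "S \<in> sets lebesgue" using S by simp
  from has_absolute_integral_change_of_variables[OF this der inj, of "\<lambda>x. vec (?J' x) :: real^1" "vec (integral S ?J)"]
  have "(\<lambda>x. vec (?J' x) :: real^1) absolutely_integrable_on \<phi> ` S \<and>
      integral (\<phi> ` S) (\<lambda>x. vec (?J' x) :: real^1) = vec (integral S ?J)"
    using int val by blast
  then have "?J' absolutely_integrable_on \<phi> ` S" "integral (\<phi> ` S) ?J' = integral S ?J"
    by (auto simp: absolutely_integrable_on_1_iff integral_on_1_eq vec_eq_iff)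
  then show ?thesis
    using nn_integral_absolutely_integrable[OF J] nn_integral_absolutely_integrable[where f = ?J' and S = "\<phi> ` S"] by simp
qed

(* The library proves the change of variables formula only for well-ordered index types;
   windex is a well-ordered copy of an arbitrary finite index type. *)
typedef 'm windex = "{..<CARD('m::finite)}" morphisms index_of of_index
  by (rule exI[of _ 0]) simp

instantiation windex :: (finite) "{finite, wellorder}"
begin

definition less_eq_windex :: "'a windex \<Rightarrow> 'a windex \<Rightarrow> bool" where
  "less_eq_windex i j \<longleftrightarrow> index_of i \<le> index_of j"

definition less_windex :: "'a windex \<Rightarrow> 'a windex \<Rightarrow> bool" where
  "less_windex i j \<longleftrightarrow> index_of i < index_of j"

instance
proof
  fix P :: "'a windex \<Rightarrow> bool" and a :: "'a windex"
  assume step: "\<And>x. (\<And>y. y < x \<Longrightarrow> P y) \<Longrightarrow> P x"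
  show "P a"
    by (induction "index_of a" arbitrary: a rule: less_induct) (metis step less_windex_def)
next
  have "range (index_of :: 'a windex \<Rightarrow> nat) \<subseteq> {..<CARD('a)}" using index_of by blast
  then have "finite (range (index_of :: 'a windex \<Rightarrow> nat))" by (rule finite_subset) simp
  then show "finite (UNIV :: 'a windex set)"
    by (rule finite_imageD) (simp add: inj_on_def index_of_inject)
qed (auto simp: less_eq_windex_def less_windex_def index_of_inject)

end

lemma card_windex: "CARD('m::finite windex) = CARD('m)"
proof -
  have "bij_betw (index_of :: 'm windex \<Rightarrow> nat) UNIV {..<CARD('m)}"
    by (rule bij_betwI[where g = of_index]) (use index_of of_index_inverse index_of_inverse in auto)
  then show ?thesis using bij_betw_same_card by fastforce
qed

definition windex_bij :: "'m::finite windex \<Rightarrow> 'm" where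
  "windex_bij = (SOME g. bij g)"

lemma bij_windex_bij: "bij (windex_bij :: 'm::finite windex \<Rightarrow> 'm)"
proof -
  have "\<exists>g :: 'm windex \<Rightarrow> 'm. bij g"
    using finite_same_card_bij[of "UNIV :: 'm windex set" "UNIV :: 'm set"] card_windex by auto
  then show ?thesis unfolding windex_bij_def by (rule someI_ex)
qed

definition reindex :: "real^'m::finite \<Rightarrow> real^'m windex" where
  "reindex x = (\<chi> i. x $ windex_bij i)"

definition unreindex :: "real^'m windex \<Rightarrow> real^'m::finite" where
  "unreindex y = (\<chi> j. y $ inv windex_bij j)"

lemma reindex_inverse [simp]: "unreindex (reindex x) = x" "reindex (unreindex y) = y"
  using bij_windex_bij[where 'm = 'a]
  by (auto simp: reindex_def unreindex_def vec_eq_iff bij_is_surj surj_f_inv_f)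
     (metis bij_inv_eq_iff bij_windex_bij)

lemma linear_reindex: "linear (reindex :: real^'m::finite \<Rightarrow> _)" "linear (unreindex :: _ \<Rightarrow> real^'m::finite)"
  by (rule linearI; simp add: reindex_def unreindex_def vec_eq_iff)+

lemma inner_reindex [simp]: "reindex x \<bullet> reindex y = x \<bullet> (y :: real^'m::finite)"
  unfolding inner_vec_def reindex_def
  using sum.reindex_bij_betw[OF bij_windex_bij[where 'm = 'm], of "\<lambda>i. x $ i \<bullet> y $ i"] by simp

lemma inner_unreindex [simp]: "unreindex x \<bullet> unreindex y = x \<bullet> y"
  using inner_reindex[of "unreindex x" "unreindex y"] by simp

lemma norm_reindex [simp]: "norm (reindex x) = norm x" "norm (unreindex y) = norm y"
  by (simp_all add: norm_eq_sqrt_inner)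

lemma continuous_on_reindex: "continuous_on S reindex" "continuous_on T unreindex"
  using linear_reindex[unfolded linear_conv_bounded_linear] by (auto intro: linear_continuous_on)

lemma reindex_measurable [measurable]: "reindex \<in> borel_measurable borel" "unreindex \<in> borel_measurable borel"
  by (auto intro: borel_measurable_continuous_onI continuous_on_reindex)

text \<open>The map permutes the standard basis, so the preimage of a box is a box with the same
  side lengths, and Lebesgue measure is determined by its values on boxes.\<close>

lemma distr_reindex: "distr lborel borel (reindex :: real^'m::finite \<Rightarrow> _) = lborel"
proof (rule lborel_eqI[symmetric])
  fix l u :: "real^'m windex"
  assume le: "\<And>b. b \<in> Basis \<Longrightarrow> l \<bullet> b \<le> u \<bullet> b"
  have Basis: "reindex ` (Basis :: (real^'m) set) = Basis"
  proof -
    have eq: "reindex (axis j 1 :: real^'m) = axis (inv windex_bij j) 1" for j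
      using bij_windex_bij[where 'm = 'm] by (auto simp: reindex_def axis_def vec_eq_iff bij_inv_eq_iff)
    have "axis i 1 = reindex (axis (windex_bij i) 1 :: real^'m)" for i
      unfolding eq using bij_windex_bij[where 'm = 'm] by (simp add: bij_is_inj)
    then have "axis i 1 \<in> reindex ` (Basis :: (real^'m) set)" for i
      by (rule image_eqI) (auto simp: Basis_vec_def)
    then show ?thesis by (auto simp: Basis_vec_def eq)
  qed
  have "inj_on reindex (Basis :: (real^'m) set)" by (metis inj_onI reindex_inverse(1))
  then have bij: "bij_betw reindex (Basis :: (real^'m) set) Basis" using Basis by (simp add: bij_betw_def)
  have inner: "w \<bullet> reindex b = unreindex w \<bullet> b" for w and b :: "real^'m"
    using inner_reindex[of "unreindex w" b] by simp
  have "reindex -` box l u \<inter> space lborel = box (unreindex l) (unreindex u :: real^'m)"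
  proof -
    have "reindex x \<in> box l u \<longleftrightarrow> x \<in> box (unreindex l) (unreindex u)" for x :: "real^'m"
      unfolding mem_box Basis[symmetric] by (simp add: inner)
    then show ?thesis by auto
  qed
  then have "emeasure (distr lborel borel reindex) (box l u) = emeasure lborel (box (unreindex l) (unreindex u :: real^'m))"
    by (subst emeasure_distr) auto
  also have "\<dots> = (\<Prod>b\<in>Basis. (unreindex u - unreindex l) \<bullet> (b :: real^'m))"
  proof (rule emeasure_lborel_box)
    fix b :: "real^'m" assume "b \<in> Basis"
    then have "reindex b \<in> Basis" using Basis by blast
    from le[OF this] show "unreindex l \<bullet> b \<le> unreindex u \<bullet> b" by (simp add: inner)
  qed
  also have "\<dots> = (\<Prod>b\<in>Basis. (u - l) \<bullet> b)"
    using prod.reindex_bij_betw[OF bij, of "\<lambda>b. (u - l) \<bullet> b"]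
    by (simp add: inner linear_diff[OF linear_reindex(2)])
  finally show "emeasure (distr lborel borel reindex) (box l u) = (\<Prod>b\<in>Basis. (u - l) \<bullet> b)" .
qed simp

lemma nn_integral_reindex:
  fixes S :: "(real^'m::finite) set"
  assumes S: "S \<in> sets borel" and f: "set_borel_measurable borel S f"
  shows "(\<integral>\<^sup>+x\<in>S. ennreal (f x) \<partial>lborel) = (\<integral>\<^sup>+y\<in>reindex ` S. ennreal (f (unreindex y)) \<partial>lborel)"
proof -
  have m: "(\<lambda>x. ennreal (indicator S x *\<^sub>R f x)) \<in> borel_measurable borel"
    using f unfolding set_borel_measurable_def by measurable
  note m' = measurable_compose[OF reindex_measurable(2) m]
  have ind: "indicator (reindex ` S) y = indicator S (unreindex y)" for y
    by (auto simp: indicator_def) (metis reindex_inverse(2) image_eqI)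
  have eq: "ennreal (f x) * indicator S x = ennreal (indicator S x *\<^sub>R f x)" for x
    by (auto simp: indicator_def)
  have "(\<integral>\<^sup>+y\<in>reindex ` S. ennreal (f (unreindex y)) \<partial>lborel) =
      (\<integral>\<^sup>+y. ennreal (indicator S (unreindex y) *\<^sub>R f (unreindex y)) \<partial>distr lborel borel (reindex :: real^'m \<Rightarrow> _))"
    unfolding distr_reindex ind eq ..
  also have "\<dots> = (\<integral>\<^sup>+x. ennreal (indicator S x *\<^sub>R f x) \<partial>lborel)"
    using m' by (subst nn_integral_distr) (simp_all del: real_scaleR_def)
  finally show ?thesis unfolding eq by simp
qed

text \<open>Conjugation with \<open>reindex\<close> transports the claim to the well-ordered index
  type; inner products, norms and volumes are preserved.\<close>

lemma graph_area_change:
  fixes \<phi> :: "real^'m::finite \<Rightarrow> real^'m" and v v' :: "real^'m \<Rightarrow> real^'m"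
  assumes S: "S \<in> sets borel" "bounded S" and S': "S' = \<phi> ` S" "S' \<in> sets borel" and inj: "inj_on \<phi> S"
    and der: "\<And>x. x \<in> S \<Longrightarrow> (\<phi> has_derivative \<phi>' x) (at x within S)"
    and form: "\<And>x u u'. x \<in> S \<Longrightarrow> u \<bullet> u' + (v x \<bullet> u) * (v x \<bullet> u') =
        \<phi>' x u \<bullet> \<phi>' x u' + (v' (\<phi> x) \<bullet> \<phi>' x u) * (v' (\<phi> x) \<bullet> \<phi>' x u')"
    and cont: "continuous_on S (\<lambda>x. norm (v x))" "continuous_on S' (\<lambda>x. norm (v' x))"
    and le: "\<And>x. x \<in> S \<Longrightarrow> norm (v x) \<le> \<Lambda>"
  shows "(\<integral>\<^sup>+x\<in>S. ennreal (sqrt (1 + (norm (v x))\<^sup>2)) \<partial>lborel) =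
         (\<integral>\<^sup>+x\<in>S'. ennreal (sqrt (1 + (norm (v' x))\<^sup>2)) \<partial>lborel)"
proof -
  let ?P = "reindex :: real^'m \<Rightarrow> _" and ?Q = "unreindex :: _ \<Rightarrow> real^'m"
  let ?\<phi> = "\<lambda>y. ?P (\<phi> (?Q y))" and ?v = "\<lambda>y. ?P (v (?Q y))" and ?v' = "\<lambda>y. ?P (v' (?Q y))"
  let ?\<phi>' = "\<lambda>y h. ?P (\<phi>' (?Q y) (?Q h))"
  have PS: "?P ` T = ?Q -` T" for T
    by (auto simp: image_iff) (metis reindex_inverse(2))
  have QPS: "?Q ` ?P ` T = T" for T by (simp add: image_image)
  have bd: "bounded (?P ` S)"
    using S(2) linear_reindex(1) by (intro bounded_linear_image) (auto simp: linear_conv_bounded_linear)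
  have meas: "?P ` S \<in> sets borel"
    unfolding PS using measurable_sets[OF reindex_measurable(2), of S] S(1) by simp
  have shifted: "(\<integral>\<^sup>+y\<in>?P ` S. ennreal (sqrt (1 + (norm (?v y))\<^sup>2)) \<partial>lborel) =
      (\<integral>\<^sup>+y\<in>?\<phi> ` ?P ` S. ennreal (sqrt (1 + (norm (?v' y))\<^sup>2)) \<partial>lborel)"
  proof (rule graph_area_change_wellorder[OF meas bd])
    show "inj_on ?\<phi> (?P ` S)"
      using inj by (auto simp: inj_on_def) (metis reindex_inverse(1))
    show "(?\<phi> has_derivative ?\<phi>' y) (at y within ?P ` S)" if y: "y \<in> ?P ` S" for y
    proof -
      have Q: "(?Q has_derivative ?Q) (at y within ?P ` S)"
        using linear_reindex(2) unfolding linear_conv_bounded_linear by (rule bounded_linear_imp_has_derivative)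
      have "(\<phi> has_derivative \<phi>' (?Q y)) (at (?Q y) within ?Q ` ?P ` S)"
        unfolding QPS using y by (intro der) auto
      from diff_chain_within[OF Q this]
      have "((\<lambda>y. \<phi> (?Q y)) has_derivative (\<lambda>h. \<phi>' (?Q y) (?Q h))) (at y within ?P ` S)"
        by (simp add: o_def)
      then show ?thesis
        by (rule has_derivative_compose)
          (rule bounded_linear_imp_has_derivative[OF linear_reindex(1)[unfolded linear_conv_bounded_linear]])
    qed
    show "u \<bullet> u' + (?v y \<bullet> u) * (?v y \<bullet> u') =
        ?\<phi>' y u \<bullet> ?\<phi>' y u' + (?v' (?\<phi> y) \<bullet> ?\<phi>' y u) * (?v' (?\<phi> y) \<bullet> ?\<phi>' y u')"
      if y: "y \<in> ?P ` S" for y u u'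
    proof -
      have "?Q y \<in> S" using y by auto
      from form[OF this, of "?Q u" "?Q u'"] show ?thesis
        using inner_reindex[of "v (?Q y)" "?Q u"] inner_reindex[of "v (?Q y)" "?Q u'"] by simp
    qed
    have "continuous_on (?P ` S) (\<lambda>y. norm (v (?Q y)))"
      by (rule continuous_on_compose2[OF cont(1) continuous_on_reindex(2)]) (simp add: QPS)
    then show "continuous_on (?P ` S) (\<lambda>y. norm (?v y))" by simp
    show "norm (?v y) \<le> \<Lambda>" if "y \<in> ?P ` S" for y using that le by auto
  qed
  have cm: "set_borel_measurable borel T (\<lambda>x. sqrt (1 + (norm (v x :: real^'m))\<^sup>2))"
    if "T \<in> sets borel" "continuous_on T (\<lambda>x. norm (v x))" for T and v :: "real^'m \<Rightarrow> real^'m"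
    unfolding set_borel_measurable_def using that(1)
    by (intro borel_measurable_continuous_on_indicator continuous_on_real_sqrt continuous_on_add
        continuous_on_power continuous_on_const that(2))
  have "?\<phi> ` ?P ` S = ?P ` S'" unfolding S'(1) by (simp add: image_image)
  then show ?thesis
    using shifted nn_integral_reindex[OF S(1) cm[OF S(1) cont(1)]] nn_integral_reindex[OF S'(2) cm[OF S'(2) cont(2)]]
    by simp
qed

text \<open>Riesz representation: v has the coordinates \<open>l b\<close> in the standard basis. It
  turns total derivatives into gradients.\<close>

lemma blinfun_real_inner:
  fixes l :: "'a::euclidean_space \<Rightarrow>\<^sub>L real"
  obtains v where "\<And>x. l x = v \<bullet> x" "norm v = norm l"
proof
  define v where "v = (\<Sum>b\<in>Basis. l b *\<^sub>R b)"
  show l: "l x = v \<bullet> x" for x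
  proof -
    have "l x = l (\<Sum>b\<in>Basis. (x \<bullet> b) *\<^sub>R b)" by (simp add: euclidean_representation)
    also have "\<dots> = v \<bullet> x"
      unfolding v_def by (simp add: blinfun.sum_right blinfun.scaleR_right inner_sum_left) (simp add: inner_commute mult.commute)
    finally show ?thesis .
  qed
  show "norm v = norm l"
  proof (rule antisym)
    have "norm v * norm v \<le> norm l * norm v"
      using norm_blinfun[of l v] by (simp add: l dot_square_norm power2_eq_square)
    then show "norm v \<le> norm l" by (cases "v = 0") auto
    show "norm l \<le> norm v"
      by (rule norm_blinfun_bound) (auto simp: l Cauchy_Schwarz_ineq2)
  qed
qed

section \<open>The surface measure\<close>

definition cylinder :: "('m::finite) rn \<Rightarrow> ('m rn \<Rightarrow> 'm rn) \<Rightarrow> real \<Rightarrow> real \<Rightarrow> 'm rn set" where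
  "cylinder p R r \<delta> = (\<lambda>x. R (x - p)) -` (ball 0 r \<times> {-\<delta><..<\<delta>})"

definition graph_point :: "('m::finite) rn \<Rightarrow> ('m rn \<Rightarrow> 'm rn) \<Rightarrow> (real^'m \<Rightarrow> real) \<Rightarrow> real^'m \<Rightarrow> 'm rn" where
  "graph_point p R \<gamma> \<eta> = p + inv R (\<eta>, \<gamma> \<eta>)"

definition area_element :: "(real^'m::finite \<Rightarrow> real) \<Rightarrow> real^'m \<Rightarrow> real" where
  "area_element \<gamma> \<eta> = sqrt (1 + (norm (total_deriv \<gamma> \<eta>))\<^sup>2)"

text \<open>The image of the weighted Lebesgue measure under the graph parametrization. The value p
  outside the ball only makes the map total and measurable, as the density vanishes there.\<close>

definition graph_measure ::
  "('m::finite) rn \<Rightarrow> ('m rn \<Rightarrow> 'm rn) \<Rightarrow> real \<Rightarrow> (real^'m \<Rightarrow> real) \<Rightarrow> 'm rn measure" where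
  "graph_measure p R r \<gamma> =
     distr (density lborel (\<lambda>\<eta>. ennreal (indicator (ball 0 r) \<eta> * area_element \<gamma> \<eta>))) borel
       (\<lambda>\<eta>. if \<eta> \<in> ball 0 r then graph_point p R \<gamma> \<eta> else p)"

lemma orthogonal_inv:
  fixes R :: "('m::finite) rn \<Rightarrow> 'm rn"
  assumes "orthogonal_transformation R"
  shows "R (inv R x) = x" "inv R (R x) = x" "linear R" "linear (inv R)" "orthogonal_transformation (inv R)"
    "norm (R x) = norm x" "norm (inv R x) = norm x"
proof -
  have b: "bij R" and i: "orthogonal_transformation (inv R)"
    using assms orthogonal_transformation_bij orthogonal_transformation_inv by blast+
  show "R (inv R x) = x" "inv R (R x) = x"
    using b by (simp_all add: bij_is_surj surj_f_inv_f bij_is_inj)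
  show "linear R" "linear (inv R)" "orthogonal_transformation (inv R)"
    "norm (R x) = norm x" "norm (inv R x) = norm x"
    using assms i unfolding orthogonal_transformation by blast+
qed

context
  fixes \<Omega> :: "('m::finite) rn set" and p R r \<delta> \<gamma>
  assumes lg: "local_graph \<Omega> p R r \<delta> \<gamma>"
begin

lemma local_graph_basic:
  "orthogonal_transformation R" "0 < r" "0 < \<delta>" "\<gamma> 0 = 0"
  "\<eta> \<in> ball 0 r \<Longrightarrow> \<bar>\<gamma> \<eta>\<bar> < \<delta> / 2"
  using lg unfolding local_graph_def by blast+

lemmas R_inv = orthogonal_inv[OF local_graph_basic(1)]

lemma has_derivative_graph:
  assumes "\<eta> \<in> ball 0 r" shows "(\<gamma> has_derivative blinfun_apply (total_deriv \<gamma> \<eta>)) (at \<eta>)"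
proof -
  have "\<gamma> differentiable (at \<eta>)"
    using lg assms by (auto simp: local_graph_def C11_up_to_closure_def)
  then have d: "(\<gamma> has_derivative frechet_derivative \<gamma> (at \<eta>)) (at \<eta>)"
    by (simp add: frechet_derivative_works)
  then show ?thesis
    unfolding total_deriv_def
    by (simp add: bounded_linear_Blinfun_apply has_derivative_bounded_linear)
qed

lemma total_deriv_lipschitz: "\<exists>L. L-lipschitz_on (ball 0 r) (total_deriv \<gamma>)"
proof -
  obtain D L where "L-lipschitz_on (closure (ball 0 r)) D" "\<forall>x\<in>ball 0 r. D x = total_deriv \<gamma> x"
    using lg by (auto simp: local_graph_def C11_up_to_closure_def)
  then have "L-lipschitz_on (ball 0 r) (total_deriv \<gamma>)"
    using lipschitz_on_subset[of L "closure (ball 0 r)" D "ball 0 r"] closure_subset[of "ball 0 r"]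
    by (auto simp: lipschitz_on_def)
  then show ?thesis ..
qed

lemma continuous_on_graph: "continuous_on (ball 0 r) \<gamma>"
  by (intro continuous_at_imp_continuous_on ballI has_derivative_continuous[OF has_derivative_graph])

lemma continuous_on_total_deriv: "continuous_on (ball 0 r) (total_deriv \<gamma>)"
  using total_deriv_lipschitz lipschitz_on_continuous_on by blast

lemma continuous_on_area_element: "continuous_on (ball 0 r) (area_element \<gamma>)"
  unfolding area_element_def by (intro continuous_intros continuous_on_total_deriv)

lemma total_deriv_bounded: "\<exists>B. \<forall>\<eta>\<in>ball 0 r. norm (total_deriv \<gamma> \<eta>) \<le> B"
proof -
  obtain L where L: "L-lipschitz_on (ball 0 r) (total_deriv \<gamma>)" using total_deriv_lipschitz ..
  have "norm (total_deriv \<gamma> \<eta>) \<le> norm (total_deriv \<gamma> 0) + L * r" if \<eta>: "\<eta> \<in> ball 0 r" for \<eta>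
  proof -
    have "dist (total_deriv \<gamma> \<eta>) (total_deriv \<gamma> 0) \<le> L * dist \<eta> 0"
      using local_graph_basic(2) by (intro lipschitz_onD[OF L] \<eta>) simp
    also have "\<dots> \<le> L * r"
      using \<eta> lipschitz_on_nonneg[OF L] by (intro mult_left_mono) auto
    finally show ?thesis using norm_triangle_ineq2[of "total_deriv \<gamma> \<eta>" "total_deriv \<gamma> 0"]
      by (simp add: dist_norm)
  qed
  then show ?thesis by blast
qed

lemma loc_graph_point: "R (graph_point p R \<gamma> \<eta> - p) = (\<eta>, \<gamma> \<eta>)"
  by (simp add: graph_point_def R_inv)

lemma eq_graph_point:
  assumes "R (x - p) = (\<eta>, \<gamma> \<eta>)" shows "x = graph_point p R \<gamma> \<eta>"
  using R_inv(2)[of "x - p"] assms by (simp add: graph_point_def)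

lemma continuous_on_graph_point: "continuous_on (ball 0 r) (graph_point p R \<gamma>)"
proof -
  have inv: "continuous_on UNIV (inv R)" using R_inv(4) by (simp add: linear_continuous_on linear_linear)
  show ?thesis
    unfolding graph_point_def
    by (intro continuous_intros continuous_on_compose2[OF inv] continuous_on_graph) auto
qed

lemma continuous_on_loc: "continuous_on S (\<lambda>x. R (x - p))"
proof -
  have "continuous_on UNIV R" using R_inv(3) by (simp add: linear_continuous_on linear_linear)
  then show ?thesis by (rule continuous_on_compose2) (auto intro: continuous_intros)
qed

lemma open_cylinder: "open (cylinder p R r \<delta>)"
  unfolding cylinder_def by (intro open_vimage continuous_on_loc open_Times) auto

lemma center_in_cylinder: "p \<in> cylinder p R r \<delta>"
  using local_graph_basic linear_0[OF R_inv(3)] by (simp add: cylinder_def zero_prod_def)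

lemma graph_point_in_cylinder:
  assumes "\<eta> \<in> ball 0 r" shows "graph_point p R \<gamma> \<eta> \<in> cylinder p R r \<delta>"
  using local_graph_basic(3) local_graph_basic(5)[OF assms] assms
  by (auto simp: cylinder_def loc_graph_point)

lemma in_domain_iff:
  assumes "R (x - p) = (\<eta>, y)" "x \<in> cylinder p R r \<delta>"
  shows "x \<in> \<Omega> \<longleftrightarrow> y < \<gamma> \<eta>"
proof -
  have C: "R (x - p) \<in> ball 0 r \<times> {-\<delta><..<\<delta>}"
    using assms(2) unfolding cylinder_def by (rule vimageD)
  have im: "(\<lambda>x. R (x - p)) ` \<Omega> \<inter> (ball 0 r \<times> {-\<delta><..<\<delta>}) =
      {(\<eta>, y). \<eta> \<in> ball 0 r \<and> y \<in> {-\<delta><..<\<delta>} \<and> y < \<gamma> \<eta>}"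
    using lg unfolding local_graph_def by blast
  have "x \<in> \<Omega> \<longleftrightarrow> R (x - p) \<in> (\<lambda>x. R (x - p)) ` \<Omega>"
  proof -
    have "x = z" if "R (x - p) = R (z - p)" for x z
      using arg_cong[OF that, of "inv R"] by (simp add: R_inv(2))
    then have "inj (\<lambda>x. R (x - p))" by (rule injI)
    from inj_image_mem_iff[OF this, of x \<Omega>] show ?thesis by (simp only:)
  qed
  also have "\<dots> \<longleftrightarrow> R (x - p) \<in> (\<lambda>x. R (x - p)) ` \<Omega> \<inter> (ball 0 r \<times> {-\<delta><..<\<delta>})"
    by (rule iffI, erule IntI, rule C, erule IntD1)
  also have "\<dots> \<longleftrightarrow> y < \<gamma> \<eta>"
    unfolding im using C by (simp add: assms(1))
  finally show ?thesis .
qed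

lemma open_above: "open {x \<in> cylinder p R r \<delta>. \<gamma> (fst (R (x - p))) < snd (R (x - p))}"
proof -
  have "continuous_on (cylinder p R r \<delta>) (\<lambda>x. \<gamma> (fst (R (x - p))))"
    by (rule continuous_on_compose2[OF continuous_on_graph])
      (auto intro!: continuous_on_fst continuous_on_loc simp: cylinder_def)
  then have "continuous_on (cylinder p R r \<delta>) (\<lambda>x. snd (R (x - p)) - \<gamma> (fst (R (x - p))))"
    by (intro continuous_on_diff continuous_on_snd continuous_on_loc)
  from continuous_open_preimage[OF this open_cylinder, of "{0<..}"]
  have "open (cylinder p R r \<delta> \<inter> (\<lambda>x. snd (R (x - p)) - \<gamma> (fst (R (x - p)))) -` {0<..})"
    by simp
  also have "cylinder p R r \<delta> \<inter> (\<lambda>x. snd (R (x - p)) - \<gamma> (fst (R (x - p)))) -` {0<..} =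
      {x \<in> cylinder p R r \<delta>. \<gamma> (fst (R (x - p))) < snd (R (x - p))}" by auto
  finally show ?thesis .
qed

text \<open>The part of the cylinder above the graph is open and misses \<Omega>, hence it also
  misses the closure.\<close>

lemma above_not_in_closure:
  assumes "R (x - p) = (\<eta>, y)" "x \<in> cylinder p R r \<delta>" "\<gamma> \<eta> < y"
  shows "x \<notin> closure \<Omega>"
proof -
  let ?U = "{x \<in> cylinder p R r \<delta>. \<gamma> (fst (R (x - p))) < snd (R (x - p))}"
  have "z \<notin> \<Omega>" if "z \<in> ?U" for z
    using in_domain_iff[OF prod.collapse[symmetric], of z] that by simp
  then have "?U \<inter> \<Omega> = {}" by blast
  then have "?U \<inter> closure \<Omega> = {}" using open_above open_Int_closure_eq_empty by blast
  moreover have "x \<in> ?U" using assms by auto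
  ultimately show ?thesis by blast
qed

text \<open>Small vertical shifts, in chart coordinates, stay in the open cylinder and tend to x.
  From a point of the graph, c = -1 leads into \<Omega> and c = 1 into its exterior.\<close>

lemma vertical_limit:
  assumes x: "R (x - p) = (\<eta>, y)" "x \<in> cylinder p R r \<delta>"
    and S: "\<And>z s. z \<in> cylinder p R r \<delta> \<Longrightarrow> R (z - p) = (\<eta>, y + c * s) \<Longrightarrow> 0 < s \<Longrightarrow> z \<in> S"
  shows "x \<in> closure S"
proof -
  let ?z = "\<lambda>s. x + inv R (0, c * s)"
  have loc: "R (?z s - p) = (\<eta>, y + c * s)" for s
  proof -
    have "?z s - p = (x - p) + inv R (0, c * s)" by simp
    then have "R (?z s - p) = R (x - p) + R (inv R (0, c * s))" by (simp only: linear_add[OF R_inv(3)])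
    then show ?thesis using x by (simp add: R_inv)
  qed
  have inv: "continuous_on UNIV (inv R)" using R_inv(4) by (simp add: linear_continuous_on linear_linear)
  have cont: "continuous_on UNIV ?z"
    by (intro continuous_intros continuous_on_compose2[OF inv]) auto
  have z0: "?z 0 = x" using linear_0[OF R_inv(4)] by (simp add: zero_prod_def)
  have lim: "(?z \<longlongrightarrow> x) (at_right 0)"
  proof -
    have "isCont ?z 0" using cont by (simp add: continuous_on_eq_continuous_at)
    then have "(?z \<longlongrightarrow> ?z 0) (at 0)" by (simp only: isCont_def)
    then show ?thesis unfolding z0 by (rule tendsto_mono[OF at_le[OF subset_UNIV]])
  qed
  have "eventually (\<lambda>s. ?z s \<in> cylinder p R r \<delta>) (at_right 0)"
    using lim open_cylinder x(2) by (rule topological_tendstoD)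
  then have "eventually (\<lambda>s. ?z s \<in> S) (at_right 0)"
    using eventually_at_right_less[of 0] by eventually_elim (use S loc in blast)
  then show ?thesis
    using lim by (intro Lim_in_closed_set[of "closure S" ?z "at_right 0"])
      (auto elim!: eventually_mono intro: closure_subset[THEN subsetD])
qed

text \<open>The second membership says that \<Omega> lies on only one side of its boundary. It is
  what makes the closure of the exterior equal to the complement of \<Omega>.\<close>

lemma graph_in_closures:
  assumes x: "R (x - p) = (\<eta>, \<gamma> \<eta>)" "x \<in> cylinder p R r \<delta>"
  shows "x \<in> closure \<Omega>" "x \<in> closure (- closure \<Omega>)"
proof -
  show "x \<in> closure \<Omega>"
    by (rule vertical_limit[OF x, of "-1"]) (use in_domain_iff in auto)
  show "x \<in> closure (- closure \<Omega>)"
    by (rule vertical_limit[OF x, of 1]) (use above_not_in_closure in auto)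
qed

lemma in_frontier_iff:
  assumes "open \<Omega>" and x: "R (x - p) = (\<eta>, y)" "x \<in> cylinder p R r \<delta>"
  shows "x \<in> frontier \<Omega> \<longleftrightarrow> y = \<gamma> \<eta>"
proof -
  have "x \<in> frontier \<Omega> \<longleftrightarrow> x \<in> closure \<Omega> \<and> x \<notin> \<Omega>"
    using \<open>open \<Omega>\<close> by (auto simp: frontier_def interior_open)
  then show ?thesis
    using in_domain_iff[OF x] above_not_in_closure[OF x] graph_in_closures(1)[of x \<eta>] x
    by (cases y "\<gamma> \<eta>" rule: linorder_cases) auto
qed

lemma graph_point_in_frontier:
  assumes "open \<Omega>" "\<eta> \<in> ball 0 r" shows "graph_point p R \<gamma> \<eta> \<in> frontier \<Omega>"
  using in_frontier_iff[OF assms(1) loc_graph_point graph_point_in_cylinder[OF assms(2)]] by simp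

lemma frontier_point_eq:
  assumes "open \<Omega>" "x \<in> frontier \<Omega>" "x \<in> cylinder p R r \<delta>"
  shows "fst (R (x - p)) \<in> ball 0 r" "x = graph_point p R \<gamma> (fst (R (x - p)))"
proof -
  obtain \<eta> y where eq: "R (x - p) = (\<eta>, y)" by (metis surj_pair)
  then have "y = \<gamma> \<eta>" using in_frontier_iff[OF assms(1) eq assms(3)] assms(2) by simp
  then show "x = graph_point p R \<gamma> (fst (R (x - p)))" using eq_graph_point[of x \<eta>] eq by simp
  show "fst (R (x - p)) \<in> ball 0 r" using assms(3) by (auto simp: cylinder_def)
qed

lemma area_element_measurable [measurable]:
  "(\<lambda>\<eta>. indicator (ball 0 r) \<eta> * area_element \<gamma> \<eta>) \<in> borel_measurable borel"
  using borel_measurable_continuous_on_indicator[OF _ continuous_on_area_element] by simp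

lemma graph_point_measurable [measurable]:
  "(\<lambda>\<eta>. if \<eta> \<in> ball 0 r then graph_point p R \<gamma> \<eta> else p) \<in> borel_measurable borel"
  by (rule borel_measurable_continuous_on_if) (auto intro: continuous_on_graph_point)

lemma preimage_borel:
  assumes "A \<in> sets borel" shows "{\<eta> \<in> ball 0 r. graph_point p R \<gamma> \<eta> \<in> A} \<in> sets borel"
proof -
  have "{\<eta> \<in> ball 0 r. graph_point p R \<gamma> \<eta> \<in> A} =
      ((\<lambda>\<eta>. if \<eta> \<in> ball 0 r then graph_point p R \<gamma> \<eta> else p) -` A \<inter> space borel) \<inter> ball 0 r" by auto
  then show ?thesis using measurable_sets[OF graph_point_measurable assms] by simp
qed

lemma emeasure_graph_measure:
  assumes A: "A \<in> sets borel"
  shows "emeasure (graph_measure p R r \<gamma>) A =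
    (\<integral>\<^sup>+\<eta>\<in>{\<eta> \<in> ball 0 r. graph_point p R \<gamma> \<eta> \<in> A}. ennreal (area_element \<gamma> \<eta>) \<partial>lborel)"
proof -
  let ?g = "\<lambda>\<eta>. if \<eta> \<in> ball 0 r then graph_point p R \<gamma> \<eta> else p"
  have "emeasure (graph_measure p R r \<gamma>) A =
     emeasure (density lborel (\<lambda>\<eta>. ennreal (indicator (ball 0 r) \<eta> * area_element \<gamma> \<eta>))) (?g -` A)"
    unfolding graph_measure_def using A graph_point_measurable
    by (subst emeasure_distr) (auto simp del: mem_ball)
  also have "\<dots> = (\<integral>\<^sup>+\<eta>. ennreal (indicator (ball 0 r) \<eta> * area_element \<gamma> \<eta>) * indicator (?g -` A) \<eta> \<partial>lborel)"
    using measurable_sets[OF graph_point_measurable A] by (intro emeasure_density) auto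
  also have "\<dots> = (\<integral>\<^sup>+\<eta>\<in>{\<eta> \<in> ball 0 r. graph_point p R \<gamma> \<eta> \<in> A}. ennreal (area_element \<gamma> \<eta>) \<partial>lborel)"
    by (rule nn_integral_cong) (auto simp: indicator_def)
  finally show ?thesis .
qed

text \<open>The area integral in the definition of the surface measure, which is imposed only for
  sets inside the cylinder, is recognized as the value of a measure on all Borel sets.\<close>

lemma local_area_eq_graph_measure:
  assumes A: "A \<in> sets borel"
  shows "(\<integral>\<^sup>+\<eta>\<in>ball 0 r. (indicator ((\<lambda>x. R (x - p)) ` A) (\<eta>, \<gamma> \<eta>) *
      ennreal (sqrt (1 + (norm (total_deriv \<gamma> \<eta>))\<^sup>2))) \<partial>lborel) = emeasure (graph_measure p R r \<gamma>) A"
  unfolding emeasure_graph_measure[OF A]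
proof (rule nn_integral_cong)
  fix \<eta>
  have "(\<eta>, \<gamma> \<eta>) \<in> (\<lambda>x. R (x - p)) ` A \<longleftrightarrow> graph_point p R \<gamma> \<eta> \<in> A"
  proof
    assume "(\<eta>, \<gamma> \<eta>) \<in> (\<lambda>x. R (x - p)) ` A"
    then obtain x where x: "x \<in> A" "R (x - p) = (\<eta>, \<gamma> \<eta>)" by (auto simp: image_iff)
    from eq_graph_point[OF x(2)] show "graph_point p R \<gamma> \<eta> \<in> A" using x(1) by simp
  next
    assume "graph_point p R \<gamma> \<eta> \<in> A"
    then show "(\<eta>, \<gamma> \<eta>) \<in> (\<lambda>x. R (x - p)) ` A"
      by (intro image_eqI[where f = "\<lambda>x. R (x - p)" and x = "graph_point p R \<gamma> \<eta>"]) (simp_all add: loc_graph_point)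
  qed
  then show "indicator ((\<lambda>x. R (x - p)) ` A) (\<eta>, \<gamma> \<eta>) * ennreal (sqrt (1 + (norm (total_deriv \<gamma> \<eta>))\<^sup>2)) * indicator (ball 0 r) \<eta> =
      ennreal (area_element \<gamma> \<eta>) * indicator {\<eta> \<in> ball 0 r. graph_point p R \<gamma> \<eta> \<in> A} \<eta>"
    by (auto simp: indicator_def area_element_def)
qed

lemma graph_measure_frontier:
  assumes "open \<Omega>" "A \<in> sets borel"
  shows "emeasure (graph_measure p R r \<gamma>) (A \<inter> frontier \<Omega>) = emeasure (graph_measure p R r \<gamma>) A"
proof -
  have "A \<inter> frontier \<Omega> \<in> sets borel" using assms(2) by (intro sets.Int) (auto intro: borel_closed)
  moreover have "{\<eta> \<in> ball 0 r. graph_point p R \<gamma> \<eta> \<in> A \<inter> frontier \<Omega>} = {\<eta> \<in> ball 0 r. graph_point p R \<gamma> \<eta> \<in> A}"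
    using graph_point_in_frontier[OF assms(1)] by auto
  ultimately show ?thesis using assms(2) by (simp only: emeasure_graph_measure)
qed

lemma graph_measure_finite: "emeasure (graph_measure p R r \<gamma>) A < \<infinity>"
proof -
  obtain B where B: "\<And>\<eta>. \<eta> \<in> ball 0 r \<Longrightarrow> norm (total_deriv \<gamma> \<eta>) \<le> B" using total_deriv_bounded by blast
  have "emeasure (graph_measure p R r \<gamma>) A \<le> emeasure (graph_measure p R r \<gamma>) UNIV"
    using emeasure_space[of "graph_measure p R r \<gamma>" A] by (simp add: graph_measure_def)
  also have "\<dots> \<le> (\<integral>\<^sup>+(\<eta>::real^'m). ennreal (sqrt (1 + B\<^sup>2)) * indicator (ball 0 r) \<eta> \<partial>lborel)"
    unfolding emeasure_graph_measure[OF borel_open[OF open_UNIV]]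
  proof (intro nn_integral_mono)
    fix \<eta> :: "real^'m"
    show "ennreal (area_element \<gamma> \<eta>) * indicator {\<eta> \<in> ball 0 r. graph_point p R \<gamma> \<eta> \<in> UNIV} \<eta> \<le>
        ennreal (sqrt (1 + B\<^sup>2)) * indicator (ball 0 r) \<eta>"
      using B[of \<eta>] by (auto simp: indicator_def area_element_def intro!: ennreal_leI power_mono)
  qed
  also have "\<dots> = ennreal (sqrt (1 + B\<^sup>2)) * emeasure lborel (ball (0 :: real^'m) r)"
    by (rule nn_integral_cmult_indicator) simp
  also have "\<dots> < \<infinity>" using emeasure_lborel_ball_finite[of "0 :: real^'m" r] by (simp add: ennreal_mult_less_top)
  finally show ?thesis .
qed

end

lemma sets_graph_measure [simp]: "sets (graph_measure p R r \<gamma>) = sets borel"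
  by (simp add: graph_measure_def)

lemma gradient_exists:
  fixes \<gamma> :: "real^'m::finite \<Rightarrow> real"
  shows "\<exists>v. \<forall>x. (\<forall>h. total_deriv \<gamma> x h = v x \<bullet> h) \<and> norm (v x) = norm (total_deriv \<gamma> x)"
proof (rule choice, rule allI)
  fix x
  obtain v where "\<And>h. total_deriv \<gamma> x h = v \<bullet> h" "norm v = norm (total_deriv \<gamma> x)"
    by (rule blinfun_real_inner[of "total_deriv \<gamma> x"], rule that)
  then show "\<exists>v. (\<forall>h. total_deriv \<gamma> x h = v \<bullet> h) \<and> norm v = norm (total_deriv \<gamma> x)"
    by (intro exI[of _ v]) simp
qed

text \<open>Over A both charts parametrize the same part of the frontier, and the transition map is
  the base component of \<psi>. Since R' and \<open>inv R\<close> are orthogonal, its derivative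
  carries the first fundamental form of one graph to that of the other, and
  \<open>graph_area_change\<close> applies.\<close>

lemma graph_measure_compatible:
  fixes \<Omega> :: "('m::finite) rn set"
  assumes lg: "local_graph \<Omega> p R r \<delta> \<gamma>" and lg': "local_graph \<Omega> p' R' r' \<delta>' \<gamma>'"
    and "open \<Omega>" and A: "A \<in> sets borel" "A \<subseteq> cylinder p R r \<delta>" "A \<subseteq> cylinder p' R' r' \<delta>'"
  shows "emeasure (graph_measure p R r \<gamma>) A = emeasure (graph_measure p' R' r' \<gamma>') A"
proof -
  let ?S = "{\<eta> \<in> ball 0 r. graph_point p R \<gamma> \<eta> \<in> A}" and ?S' = "{\<eta> \<in> ball 0 r'. graph_point p' R' \<gamma>' \<eta> \<in> A}"
  define \<psi> where "\<psi> = (\<lambda>\<eta>. R' (graph_point p R \<gamma> \<eta> - p'))"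
  define \<psi>' where "\<psi>' = (\<lambda>\<eta> h. R' (inv R (h, total_deriv \<gamma> \<eta> h)))"
  obtain v where v: "\<And>x h. total_deriv \<gamma> x h = v x \<bullet> h" "\<And>x. norm (v x) = norm (total_deriv \<gamma> x)"
    using gradient_exists by metis
  obtain v' where v': "\<And>x h. total_deriv \<gamma>' x h = v' x \<bullet> h" "\<And>x. norm (v' x) = norm (total_deriv \<gamma>' x)"
    using gradient_exists by metis
  note RR = orthogonal_inv[OF local_graph_basic(1)[OF lg]] and RR' = orthogonal_inv[OF local_graph_basic(1)[OF lg']]
  obtain B where B: "\<And>\<eta>. \<eta> \<in> ball 0 r \<Longrightarrow> norm (total_deriv \<gamma> \<eta>) \<le> B" using total_deriv_bounded[OF lg] by blast
  have der: "(\<psi> has_derivative \<psi>' \<eta>) (at \<eta>)" if "\<eta> \<in> ball 0 r" for \<eta>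
  proof -
    have "((\<lambda>\<eta>. (\<eta>, \<gamma> \<eta>)) has_derivative (\<lambda>h. (h, total_deriv \<gamma> \<eta> h))) (at \<eta>)"
      by (intro has_derivative_Pair has_derivative_ident has_derivative_graph[OF lg that])
    from has_derivative_compose[OF this bounded_linear_imp_has_derivative[OF RR(4)[unfolded linear_conv_bounded_linear]]]
    have "(graph_point p R \<gamma> has_derivative (\<lambda>h. inv R (h, total_deriv \<gamma> \<eta> h))) (at \<eta>)"
      unfolding graph_point_def by (intro has_derivative_add_const has_derivative_eq_rhs[OF has_derivative_add[OF has_derivative_const]]) auto
    then have "((\<lambda>\<eta>. graph_point p R \<gamma> \<eta> - p') has_derivative (\<lambda>h. inv R (h, total_deriv \<gamma> \<eta> h))) (at \<eta>)"
      using has_derivative_diff[OF _ has_derivative_const] by fastforce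
    from has_derivative_compose[OF this bounded_linear_imp_has_derivative[OF RR'(3)[unfolded linear_conv_bounded_linear]]]
    show ?thesis unfolding \<psi>_def \<psi>'_def .
  qed
  have \<psi>_in: "fst (\<psi> \<eta>) \<in> ball 0 r' \<and> \<psi> \<eta> = (fst (\<psi> \<eta>), \<gamma>' (fst (\<psi> \<eta>))) \<and> graph_point p' R' \<gamma>' (fst (\<psi> \<eta>)) = graph_point p R \<gamma> \<eta>"
    if \<eta>: "\<eta> \<in> ball 0 r" and cyl: "graph_point p R \<gamma> \<eta> \<in> cylinder p' R' r' \<delta>'" for \<eta>
  proof -
    have "graph_point p R \<gamma> \<eta> \<in> frontier \<Omega>" by (rule graph_point_in_frontier[OF lg \<open>open \<Omega>\<close> \<eta>])
    from frontier_point_eq[OF lg' \<open>open \<Omega>\<close> this cyl]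
    have *: "fst (\<psi> \<eta>) \<in> ball 0 r'" "graph_point p R \<gamma> \<eta> = graph_point p' R' \<gamma>' (fst (\<psi> \<eta>))"
      by (auto simp: \<psi>_def)
    moreover have "\<psi> \<eta> = (fst (\<psi> \<eta>), \<gamma>' (fst (\<psi> \<eta>)))"
      using loc_graph_point[OF lg', of "fst (\<psi> \<eta>)"] unfolding *(2)[symmetric] \<psi>_def[symmetric]
      by (simp add: \<psi>_def)
    ultimately show ?thesis by simp
  qed
  have image: "?S' = (\<lambda>\<eta>. fst (\<psi> \<eta>)) ` ?S"
  proof (intro equalityI subsetI)
    fix \<eta>' assume \<eta>': "\<eta>' \<in> ?S'"
    let ?x = "graph_point p' R' \<gamma>' \<eta>'"
    have "?x \<in> frontier \<Omega>" using graph_point_in_frontier[OF lg' \<open>open \<Omega>\<close>] \<eta>' by simp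
    moreover have "?x \<in> cylinder p R r \<delta>" using \<eta>' A by auto
    ultimately have *: "fst (R (?x - p)) \<in> ball 0 r" "?x = graph_point p R \<gamma> (fst (R (?x - p)))"
      using frontier_point_eq[OF lg \<open>open \<Omega>\<close>] by blast+
    have "\<psi> (fst (R (?x - p))) = R' (?x - p')" unfolding \<psi>_def *(2)[symmetric] ..
    then have "fst (\<psi> (fst (R (?x - p)))) = \<eta>'" using loc_graph_point[OF lg', of \<eta>'] by simp
    moreover have "fst (R (?x - p)) \<in> ?S" using * \<eta>' by auto
    ultimately show "\<eta>' \<in> (\<lambda>\<eta>. fst (\<psi> \<eta>)) ` ?S" by (intro image_eqI[OF sym])
  next
    fix \<eta>' assume "\<eta>' \<in> (\<lambda>\<eta>. fst (\<psi> \<eta>)) ` ?S"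
    then show "\<eta>' \<in> ?S'" using \<psi>_in A(3) by auto
  qed
  have "(\<integral>\<^sup>+\<eta>\<in>?S. ennreal (sqrt (1 + (norm (v \<eta>))\<^sup>2)) \<partial>lborel) =
        (\<integral>\<^sup>+\<eta>\<in>?S'. ennreal (sqrt (1 + (norm (v' \<eta>))\<^sup>2)) \<partial>lborel)"
  proof (rule graph_area_change[where \<phi>' = "\<lambda>\<eta> h. fst (\<psi>' \<eta> h)"])
    show "?S \<in> sets borel" "?S' \<in> sets borel" using preimage_borel[OF lg A(1)] preimage_borel[OF lg' A(1)] by auto
    show "bounded ?S" by (rule bounded_subset[OF bounded_ball[of 0 r]]) auto
    show "?S' = (\<lambda>\<eta>. fst (\<psi> \<eta>)) ` ?S" by (rule image)
    show "inj_on (\<lambda>\<eta>. fst (\<psi> \<eta>)) ?S"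
    proof (rule inj_onI)
      fix \<eta>1 \<eta>2 assume s: "\<eta>1 \<in> ?S" "\<eta>2 \<in> ?S" and eq: "fst (\<psi> \<eta>1) = fst (\<psi> \<eta>2)"
      have c: "graph_point p R \<gamma> \<eta>1 \<in> cylinder p' R' r' \<delta>'" "graph_point p R \<gamma> \<eta>2 \<in> cylinder p' R' r' \<delta>'"
        "\<eta>1 \<in> ball 0 r" "\<eta>2 \<in> ball 0 r"
        using s subsetD[OF A(3)] by simp_all
      have "graph_point p R \<gamma> \<eta>1 = graph_point p' R' \<gamma>' (fst (\<psi> \<eta>1))"
        by (rule \<psi>_in[OF c(3,1), THEN conjunct2, THEN conjunct2, symmetric])
      also have "\<dots> = graph_point p' R' \<gamma>' (fst (\<psi> \<eta>2))" by (simp only: eq)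
      also have "\<dots> = graph_point p R \<gamma> \<eta>2"
        by (rule \<psi>_in[OF c(4,2), THEN conjunct2, THEN conjunct2])
      finally have "graph_point p R \<gamma> \<eta>1 = graph_point p R \<gamma> \<eta>2" .
      then have "R (graph_point p R \<gamma> \<eta>1 - p) = R (graph_point p R \<gamma> \<eta>2 - p)" by (simp only:)
      then show "\<eta>1 = \<eta>2" by (simp add: loc_graph_point[OF lg])
    qed
    show "((\<lambda>\<eta>. fst (\<psi> \<eta>)) has_derivative (\<lambda>h. fst (\<psi>' \<eta> h))) (at \<eta> within ?S)" if "\<eta> \<in> ?S" for \<eta>
      using that by (intro has_derivative_at_withinI[OF has_derivative_fst[OF der]]) simp
    show "u \<bullet> u' + (v \<eta> \<bullet> u) * (v \<eta> \<bullet> u') = fst (\<psi>' \<eta> u) \<bullet> fst (\<psi>' \<eta> u') +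
       (v' (fst (\<psi> \<eta>)) \<bullet> fst (\<psi>' \<eta> u)) * (v' (fst (\<psi> \<eta>)) \<bullet> fst (\<psi>' \<eta> u'))" if \<eta>: "\<eta> \<in> ?S" for \<eta> u u'
    proof -
      have \<eta>r: "\<eta> \<in> ball 0 r" using \<eta> by simp
      \<comment> \<open>A is merely Borel, so the derivatives are compared on the open set ?V of all
        parameters that land in the second cylinder; there \<psi> takes values in the graph of
        \<gamma>'.\<close>
      let ?V = "ball 0 r \<inter> \<psi> -` (ball 0 r' \<times> {-\<delta>'<..<\<delta>'})"
      have cont: "continuous_on (ball 0 r) \<psi>"
        by (intro continuous_at_imp_continuous_on ballI has_derivative_continuous[OF der])
      have V: "open ?V" by (rule continuous_open_preimage[OF cont]) (auto intro: open_Times)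
      have "\<eta> \<in> ?V" using \<eta> A(3) by (auto simp: cylinder_def \<psi>_def)
      have fst_in: "fst (\<psi> \<eta>) \<in> ball 0 r'" using \<psi>_in[OF \<eta>r] \<eta> A(3) by auto
      have d1: "((\<lambda>\<eta>. \<gamma>' (fst (\<psi> \<eta>))) has_derivative (\<lambda>h. total_deriv \<gamma>' (fst (\<psi> \<eta>)) (fst (\<psi>' \<eta> h)))) (at \<eta>)"
        by (rule has_derivative_compose[OF has_derivative_fst[OF der[OF \<eta>r]] has_derivative_graph[OF lg' fst_in]])
      have "((\<lambda>\<eta>. snd (\<psi> \<eta>)) has_derivative (\<lambda>h. snd (\<psi>' \<eta> h))) (at \<eta>)"
        by (rule has_derivative_snd[OF der[OF \<eta>r]])
      then have d2: "((\<lambda>\<eta>. \<gamma>' (fst (\<psi> \<eta>))) has_derivative (\<lambda>h. snd (\<psi>' \<eta> h))) (at \<eta>)"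
      proof (rule has_derivative_transform_within_open[OF _ V \<open>\<eta> \<in> ?V\<close>])
        fix x assume "x \<in> ?V"
        then have "\<psi> x = (fst (\<psi> x), \<gamma>' (fst (\<psi> x)))" using \<psi>_in[of x] by (auto simp: cylinder_def \<psi>_def)
        then show "snd (\<psi> x) = \<gamma>' (fst (\<psi> x))" by (metis snd_conv)
      qed
      \<comment> \<open>Image vectors are tangent to the second graph: their last component is
        determined by the base component and the gradient of \<gamma>'.\<close>
      have s: "snd (\<psi>' \<eta> h) = v' (fst (\<psi> \<eta>)) \<bullet> fst (\<psi>' \<eta> h)" for h
        using has_derivative_unique[OF d1 d2] v'(1) by metis
      have "u \<bullet> u' + (v \<eta> \<bullet> u) * (v \<eta> \<bullet> u') = (u, total_deriv \<gamma> \<eta> u) \<bullet> (u', total_deriv \<gamma> \<eta> u')"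
        by (simp add: v(1))
      also have "\<dots> = \<psi>' \<eta> u \<bullet> \<psi>' \<eta> u'"
      proof -
        have "R' x \<bullet> R' y = x \<bullet> y" "inv R x \<bullet> inv R y = x \<bullet> y" for x y
          using local_graph_basic(1)[OF lg'] RR(5) unfolding orthogonal_transformation_def by blast+
        then show ?thesis unfolding \<psi>'_def by (simp only:)
      qed
      also have "\<dots> = fst (\<psi>' \<eta> u) \<bullet> fst (\<psi>' \<eta> u') + snd (\<psi>' \<eta> u) * snd (\<psi>' \<eta> u')"
        by (simp only: inner_prod_def inner_real_def)
      finally show ?thesis by (simp only: s)
    qed
    show "continuous_on ?S (\<lambda>x. norm (v x))" unfolding v(2)
      by (rule continuous_on_subset[OF continuous_on_norm[OF continuous_on_total_deriv[OF lg]]]) auto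
    show "continuous_on ?S' (\<lambda>x. norm (v' x))" unfolding v'(2)
      by (rule continuous_on_subset[OF continuous_on_norm[OF continuous_on_total_deriv[OF lg']]]) auto
    show "norm (v x) \<le> B" if "x \<in> ?S" for x using that B by (simp add: v(2))
  qed
  then show ?thesis
    unfolding emeasure_graph_measure[OF lg A(1)] emeasure_graph_measure[OF lg' A(1)] area_element_def v(2) v'(2) .
qed

lemma is_surface_measure_iff:
  "is_surface_measure \<Omega> \<sigma> \<longleftrightarrow> sets \<sigma> = sets borel \<and> emeasure \<sigma> (- frontier \<Omega>) = 0 \<and>
     (\<forall>p\<in>frontier \<Omega>. \<forall>R r \<delta> \<gamma>. local_graph \<Omega> p R r \<delta> \<gamma> \<longrightarrow>
       (\<forall>A\<in>sets borel. A \<subseteq> cylinder p R r \<delta> \<longrightarrow> emeasure \<sigma> A = emeasure (graph_measure p R r \<gamma>) A))"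
proof -
  have *: "(\<lambda>x. R (x - p)) ` A \<subseteq> ball 0 r \<times> {-\<delta><..<\<delta>} \<longleftrightarrow> A \<subseteq> cylinder p R r \<delta>" for p R r \<delta> and A :: "'a rn set"
    by (auto simp: cylinder_def)
  show ?thesis
    unfolding is_surface_measure_def * by (simp add: local_area_eq_graph_measure cong: conj_cong imp_cong)
qed

lemma finite_cover_sum:
  fixes C :: "nat \<Rightarrow> 'a set"
  assumes C: "disjoint_family C" "\<And>i. C i \<in> sets M" and A: "A \<in> sets M" "A \<subseteq> (\<Union>i<n. C i)"
  shows "emeasure M A = (\<Sum>i<n. emeasure M (A \<inter> C i))"
proof -
  have "(\<Sum>i<n. emeasure M (A \<inter> C i)) = emeasure M (\<Union>i<n. A \<inter> C i)"
    using C A by (intro sum_emeasure) (auto simp: disjoint_family_on_def)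
  also have "(\<Union>i<n. A \<inter> C i) = A" using A by auto
  finally show ?thesis by simp
qed

text \<open>By compactness finitely many cylinders cover the frontier. Cutting them into disjoint
  pieces yields a finite sum of graph measures that any surface measure must equal. Conversely this
  sum is a surface measure, because overlapping charts agree.\<close>

lemma surface_measure_unique_exists:
  fixes \<Omega> :: "('m::finite) rn set"
  assumes "bounded \<Omega>" "open \<Omega>" "class_C11 \<Omega>"
  shows "\<exists>!\<sigma>. is_surface_measure \<Omega> \<sigma>" and "is_surface_measure \<Omega> \<sigma> \<Longrightarrow> emeasure \<sigma> UNIV < \<infinity>"
proof -
  have "\<forall>p. \<exists>R r \<delta> \<gamma>. p \<in> frontier \<Omega> \<longrightarrow> local_graph \<Omega> p R r \<delta> \<gamma>"
    using assms(3) by (auto simp: class_C11_def)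
  then obtain R r \<delta> \<gamma> where lg: "\<And>p. p \<in> frontier \<Omega> \<Longrightarrow> local_graph \<Omega> p (R p) (r p) (\<delta> p) (\<gamma> p)"
    by metis
  let ?cyl = "\<lambda>p. cylinder p (R p) (r p) (\<delta> p)" and ?gm = "\<lambda>p. graph_measure p (R p) (r p) (\<gamma> p)"
  have "compact (frontier \<Omega>)" using assms(1) by (simp add: compact_frontier_bounded)
  then obtain P where P: "P \<subseteq> frontier \<Omega>" "finite P" "frontier \<Omega> \<subseteq> (\<Union>p\<in>P. ?cyl p)"
  proof (rule compactE_image)
    show "open (?cyl p)" if "p \<in> frontier \<Omega>" for p by (rule open_cylinder[OF lg[OF that]])
    show "frontier \<Omega> \<subseteq> (\<Union>p\<in>frontier \<Omega>. ?cyl p)" using center_in_cylinder[OF lg] by blast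
  qed
  obtain n :: nat and q where q: "P = q ` {i. i < n}" using finite_imp_nat_seg_image_inj_on[OF P(2)] by metis
  have q_in: "q i \<in> frontier \<Omega>" if "i < n" for i using q P(1) that by auto
  define cy where "cy i = (if i < n then ?cyl (q i) else {})" for i
  \<comment> \<open>Disjoint Borel pieces, each inside one cylinder, so that overlaps of charts are
    counted once.\<close>
  define C where "C = disjointed cy"
  have cy_open: "open (cy i)" for i
    unfolding cy_def using open_cylinder[OF lg[OF q_in]] by auto
  have C_meas: "C i \<in> sets borel" for i
  proof -
    have "C i = cy i - (\<Union>j\<in>{0..<i}. cy j)" by (simp add: C_def disjointed_def)
    then show ?thesis using cy_open by (simp only:) (intro sets.Diff borel_open open_UN ballI)
  qed
  have C_disj: "disjoint_family C" unfolding C_def by (rule disjoint_family_disjointed)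
  have C_sub: "C i \<subseteq> cy i" for i unfolding C_def by (rule disjointed_subset)
  have C_cover: "frontier \<Omega> \<subseteq> (\<Union>i<n. C i)"
  proof
    fix x assume "x \<in> frontier \<Omega>"
    then obtain i where "i < n" "x \<in> ?cyl (q i)" using P(3) q by auto
    then have "x \<in> (\<Union>i. cy i)" by (auto simp: cy_def)
    then have "x \<in> (\<Union>i. C i)" unfolding C_def UN_disjointed_eq .
    then obtain j where j: "x \<in> C j" by blast
    moreover have "j < n" using C_sub[of j] j by (auto simp: cy_def split: if_splits)
    ultimately show "x \<in> (\<Union>i<n. C i)" by blast
  qed
  have F: "frontier \<Omega> \<in> sets borel" by (intro borel_closed) simp
  have piece: "A \<inter> frontier \<Omega> \<inter> C i \<in> sets borel" "A \<inter> C i \<in> sets borel" if "A \<in> sets borel" for A i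
    using that F C_meas by auto
  \<comment> \<open>The right-hand side does not mention \<sigma>; this gives uniqueness at once,
    and finiteness because graph measures are finite.\<close>
  have decomp: "emeasure \<sigma> A = (\<Sum>i<n. emeasure (?gm (q i)) (A \<inter> C i))"
    if \<sigma>: "is_surface_measure \<Omega> \<sigma>" and A: "A \<in> sets borel" for \<sigma> A
  proof -
    have \<sigma>': "sets \<sigma> = sets borel" "emeasure \<sigma> (- frontier \<Omega>) = 0" using \<sigma> by (auto simp: is_surface_measure_iff)
    have AF: "A \<inter> frontier \<Omega> \<in> sets \<sigma>" using A F \<sigma>' by auto
    have "- frontier \<Omega> \<in> null_sets \<sigma>" using \<sigma>' F by (intro null_setsI) (auto simp: Compl_in_sets_lebesgue)
    then have "emeasure \<sigma> A = emeasure \<sigma> (A \<inter> frontier \<Omega>)"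
    proof -
      have "emeasure \<sigma> (A \<inter> frontier \<Omega>) = emeasure \<sigma> (A - (- frontier \<Omega>))" by (simp add: Diff_eq)
      also have "\<dots> = emeasure \<sigma> A"
        using A \<sigma>' \<open>- frontier \<Omega> \<in> null_sets \<sigma>\<close> by (intro emeasure_Diff_null_set) auto
      finally show ?thesis by simp
    qed
    also have "\<dots> = (\<Sum>i<n. emeasure \<sigma> (A \<inter> frontier \<Omega> \<inter> C i))"
      using C_disj C_meas C_cover \<sigma>' AF by (intro finite_cover_sum) auto
    also have "\<dots> = (\<Sum>i<n. emeasure (?gm (q i)) (A \<inter> C i))"
    proof (rule sum.cong)
      fix i assume "i \<in> {..<n}"
      then have i: "q i \<in> frontier \<Omega>" "i < n" using q_in by auto
      have "A \<inter> frontier \<Omega> \<inter> C i \<subseteq> ?cyl (q i)" using C_sub[of i] i by (auto simp: cy_def)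
      then have "emeasure \<sigma> (A \<inter> frontier \<Omega> \<inter> C i) = emeasure (?gm (q i)) (A \<inter> frontier \<Omega> \<inter> C i)"
        using \<sigma> i lg[OF i(1)] piece[OF A] unfolding is_surface_measure_iff by blast
      also have "emeasure (?gm (q i)) (A \<inter> frontier \<Omega> \<inter> C i) = emeasure (?gm (q i)) (A \<inter> C i \<inter> frontier \<Omega>)"
        by (simp only: Int_ac)
      also have "\<dots> = emeasure (?gm (q i)) (A \<inter> C i)"
        by (rule graph_measure_frontier[OF lg[OF i(1)] assms(2) piece(2)[OF A]])
      finally show "emeasure \<sigma> (A \<inter> frontier \<Omega> \<inter> C i) = emeasure (?gm (q i)) (A \<inter> C i)" .
    qed simp
    finally show ?thesis .
  qed
  show "emeasure \<sigma> UNIV < \<infinity>" if "is_surface_measure \<Omega> \<sigma>"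
    unfolding decomp[OF that borel_open[OF open_UNIV]]
    using graph_measure_finite[OF lg[OF q_in]] unfolding infinity_ennreal_def by (subst ennreal_sum_less_top) simp_all
  show "\<exists>!\<sigma>. is_surface_measure \<Omega> \<sigma>"
  proof (rule ex_ex1I)
    fix \<sigma> \<tau> assume st: "is_surface_measure \<Omega> \<sigma>" "is_surface_measure \<Omega> \<tau>"
    then have "sets \<sigma> = sets borel" "sets \<tau> = sets borel"
      unfolding is_surface_measure_def by simp_all
    moreover have "emeasure \<sigma> A = emeasure \<tau> A" if "A \<in> sets borel" for A
      using decomp[OF st(1) that] decomp[OF st(2) that] by (rule trans[OF _ sym])
    ultimately show "\<sigma> = \<tau>" by (intro measure_eqI) simp_all
  next
    \<comment> \<open>The formula forced by uniqueness now serves as the definition.\<close>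
    define \<mu> where "\<mu> A = (\<Sum>i<n. emeasure (?gm (q i)) (A \<inter> C i))" for A
    define \<sigma> where "\<sigma> = measure_of UNIV (sets borel) \<mu>"
    have sets: "sets \<sigma> = sets borel"
      unfolding \<sigma>_def using sets.sigma_sets_eq[of "borel :: 'm rn measure"] by simp
    have ca: "countably_additive (sets borel) \<mu>"
    proof (rule countably_additiveI)
      fix A :: "nat \<Rightarrow> 'm rn set"
      assume A: "range A \<subseteq> sets borel" "disjoint_family A" "(\<Union>i. A i) \<in> sets borel"
      have "(\<Sum>j. \<mu> (A j)) = (\<Sum>i<n. \<Sum>j. emeasure (?gm (q i)) (A j \<inter> C i))"
        unfolding \<mu>_def by (rule suminf_sum) simp
      also have "\<dots> = \<mu> (\<Union>j. A j)"
        unfolding \<mu>_def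
      proof (rule sum.cong)
        fix i
        have "(\<Sum>j. emeasure (?gm (q i)) (A j \<inter> C i)) = emeasure (?gm (q i)) (\<Union>j. A j \<inter> C i)"
          using A C_meas by (intro suminf_emeasure) (auto simp: disjoint_family_on_def)
        also have "(\<Union>j. A j \<inter> C i) = (\<Union>j. A j) \<inter> C i" by blast
        finally show "(\<Sum>j. emeasure (?gm (q i)) (A j \<inter> C i)) = emeasure (?gm (q i)) ((\<Union>j. A j) \<inter> C i)" .
      qed simp
      finally show "(\<Sum>j. \<mu> (A j)) = \<mu> (\<Union>j. A j)" .
    qed
    have em: "emeasure \<sigma> A = \<mu> A" if "A \<in> sets borel" for A
      unfolding \<sigma>_def
    proof (rule emeasure_measure_of_sigma)
      show "sigma_algebra UNIV (sets (borel :: 'm rn measure))"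
        using sets.sigma_algebra_axioms[of "borel :: 'm rn measure"] by simp
      show "positive (sets borel) \<mu>" by (simp add: positive_def \<mu>_def)
    qed (use ca that in auto)
    have "is_surface_measure \<Omega> \<sigma>"
      unfolding is_surface_measure_iff
    proof (intro conjI ballI allI impI)
      show "sets \<sigma> = sets borel" by (rule sets)
      have "emeasure (?gm (q i)) (- frontier \<Omega> \<inter> C i) = 0" if "i < n" for i
      proof -
        have "emeasure (?gm (q i)) (- frontier \<Omega> \<inter> C i) = emeasure (?gm (q i)) ((- frontier \<Omega> \<inter> C i) \<inter> frontier \<Omega>)"
          using F by (intro graph_measure_frontier[OF lg[OF q_in[OF that]] assms(2), symmetric] piece) auto
        also have "(- frontier \<Omega> \<inter> C i) \<inter> frontier \<Omega> = {}" by blast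
        finally show ?thesis by simp
      qed
      then show "emeasure \<sigma> (- frontier \<Omega>) = 0" using F by (subst em) (auto simp: \<mu>_def)
      fix p R' r' \<delta>' \<gamma>' A
      assume p: "p \<in> frontier \<Omega>" "local_graph \<Omega> p R' r' \<delta>' \<gamma>'" and A: "A \<in> sets borel" "A \<subseteq> cylinder p R' r' \<delta>'"
      let ?G = "graph_measure p R' r' \<gamma>'"
      have AF: "A \<inter> frontier \<Omega> \<in> sets borel" using A F by auto
      have "emeasure ?G A = emeasure ?G (A \<inter> frontier \<Omega>)"
        by (rule graph_measure_frontier[OF p(2) assms(2) A(1), symmetric])
      also have "\<dots> = (\<Sum>i<n. emeasure ?G (A \<inter> frontier \<Omega> \<inter> C i))"
        using C_disj C_meas C_cover AF by (intro finite_cover_sum) auto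
      also have "\<dots> = (\<Sum>i<n. emeasure (?gm (q i)) (A \<inter> C i))"
      proof (rule sum.cong)
        fix i assume "i \<in> {..<n}"
        then have i: "q i \<in> frontier \<Omega>" "i < n" using q_in by auto
        have "A \<inter> frontier \<Omega> \<inter> C i \<subseteq> ?cyl (q i)" using C_sub[of i] i by (auto simp: cy_def)
        \<comment> \<open>Here the arbitrary chart at p is exchanged for the chart chosen for the
          i-th piece.\<close>
        then have "emeasure ?G (A \<inter> frontier \<Omega> \<inter> C i) = emeasure (?gm (q i)) (A \<inter> frontier \<Omega> \<inter> C i)"
          using A by (intro graph_measure_compatible[OF p(2) lg[OF i(1)] assms(2)] piece) auto
        also have "emeasure (?gm (q i)) (A \<inter> frontier \<Omega> \<inter> C i) = emeasure (?gm (q i)) (A \<inter> C i \<inter> frontier \<Omega>)"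
          by (simp only: Int_ac)
        also have "\<dots> = emeasure (?gm (q i)) (A \<inter> C i)"
          by (rule graph_measure_frontier[OF lg[OF i(1)] assms(2) piece(2)[OF A(1)]])
        finally show "emeasure ?G (A \<inter> frontier \<Omega> \<inter> C i) = emeasure (?gm (q i)) (A \<inter> C i)" .
      qed simp
      finally show "emeasure \<sigma> A = emeasure ?G A" using em[OF A(1)] by (simp add: \<mu>_def)
    qed
    then show "\<exists>\<sigma>. is_surface_measure \<Omega> \<sigma>" ..
  qed
qed

section \<open>The modulus of continuity\<close>

lemma omega1_small: "0 < r \<Longrightarrow> r \<le> exp (-1) \<Longrightarrow> omega1 r = r * (- ln r) \<and> 1 \<le> - ln r"
proof -
  assume r: "0 < r" "r \<le> exp (-1)"
  then have "ln r \<le> -1" by (metis ln_exp ln_le_cancel_iff exp_gt_zero)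
  then show ?thesis using r by (simp add: omega1_def)
qed

lemma le_omega1: "0 \<le> r \<Longrightarrow> r \<le> exp (-1) \<Longrightarrow> r \<le> omega1 r"
proof (cases "r = 0")
  case False
  assume r: "0 \<le> r" "r \<le> exp (-1)"
  with False have "r * 1 \<le> r * (- ln r)" using omega1_small[of r] by (intro mult_left_mono) auto
  then show ?thesis using omega1_small[of r] False r by simp
qed (simp add: omega1_def)

text \<open>The derivative -ln x - 1 is nonnegative exactly for x up to exp (-1), the threshold
  beyond which \<open>omega1\<close> is constant.\<close>

lemma omega1_mono_small:
  fixes r s :: real
  assumes "0 < r" "r \<le> s" "s \<le> exp (-1)"
  shows "r * (- ln r) \<le> s * (- ln s)"
proof (rule DERIV_nonneg_imp_nondecreasing[where f = "\<lambda>x. x * (- ln x)", OF assms(2)])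
  fix x assume x: "r \<le> x" "x \<le> s"
  have "((\<lambda>x. x * (- ln x)) has_real_derivative (- ln x - 1)) (at x)"
    using x assms by (auto intro!: derivative_eq_intros)
  moreover have "0 \<le> - ln x - 1" using omega1_small[of x] x assms by auto
  ultimately show "\<exists>y. ((\<lambda>x. x * (- ln x)) has_real_derivative y) (at x) \<and> 0 \<le> y" by blast
qed

lemma omega1_le: "omega1 r \<le> exp (-1)"
proof (cases "0 < r \<and> r \<le> exp (-1)")
  case True
  then have "r * (- ln r) \<le> exp (-1) * (- ln (exp (-1)))" by (intro omega1_mono_small) auto
  then show ?thesis using omega1_small[of r] True by simp
qed (auto simp: omega1_def)

lemma omega1_nonneg: "0 \<le> omega1 r"
  by (simp add: omega1_def)

lemma omega1_pos: "0 < r \<Longrightarrow> 0 < omega1 r"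
proof (cases "r \<le> exp (-1)")
  case True
  assume "0 < r"
  with True have *: "omega1 r = r * (- ln r)" "1 \<le> - ln r" using omega1_small[of r] by auto
  have "0 < - ln r" using *(2) by linarith
  with \<open>0 < r\<close> have "0 < r * (- ln r)" by (rule mult_pos_pos)
  then show ?thesis unfolding *(1) .
qed (simp add: omega1_def)

lemma omega1_mono: "r \<le> s \<Longrightarrow> omega1 r \<le> omega1 s"
proof (cases "0 < r")
  case True
  assume rs: "r \<le> s"
  show ?thesis
  proof (cases "s \<le> exp (-1)")
    case True
    then show ?thesis
      using omega1_mono_small[OF \<open>0 < r\<close> rs True] omega1_small[of r] omega1_small[of s] \<open>0 < r\<close> rs by simp
  next
    case False
    then have "omega1 s = exp (-1)" using \<open>0 < r\<close> rs by (simp add: omega1_def)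
    then show ?thesis using omega1_le by simp
  qed
next
  case False
  then show ?thesis using omega1_nonneg[of s] by (simp add: omega1_def)
qed

text \<open>For C \<ge> 1 the logarithmic factor only decreases, -ln (C d) \<le> -ln d, and past the
  threshold \<open>omega1\<close> is constant. The inequality absorbs the distortion between
  Euclidean distance and chart coordinates.\<close>

lemma omega1_mult_le:
  assumes "1 \<le> C" "0 \<le> d" shows "omega1 (C * d) \<le> C * omega1 d"
proof (cases "d = 0")
  case False
  then have d: "0 < d" using assms by simp
  have Cd: "0 < C * d" "d \<le> C * d" using d assms by auto
  show ?thesis
  proof (cases "C * d \<le> exp (-1)")
    case True
    have "- ln (C * d) \<le> - ln d" using Cd d by (simp add: ln_mono)
    then have "(C * d) * (- ln (C * d)) \<le> (C * d) * (- ln d)" using Cd by (intro mult_left_mono) auto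
    then show ?thesis using omega1_small[of "C * d"] omega1_small[of d] True Cd d by (simp add: mult.assoc)
  next
    case big: False
    show ?thesis
    proof (cases "d \<le> exp (-1)")
      case True
      then have "C * d \<le> C * omega1 d" using le_omega1[of d] d assms by (intro mult_left_mono) auto
      then show ?thesis using omega1_le[of "C * d"] big by linarith
    next
      case False
      then have d': "omega1 d = exp (-1)" using d by (simp add: omega1_def)
      have "omega1 (C * d) \<le> 1 * exp (-1)" using omega1_le[of "C * d"] by simp
      also have "\<dots> \<le> C * exp (-1)" using assms by (intro mult_right_mono) auto
      finally show ?thesis unfolding d' .
    qed
  qed
qed (simp add: omega1_def)

text \<open>This is ln y \<le> y - 1 at y = 1/sqrt r. The square root supplies an explicit \<delta>
  for uniform continuity.\<close>

lemma omega1_le_sqrt: "0 \<le> r \<Longrightarrow> omega1 r \<le> 2 * sqrt r"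
proof (cases "0 < r \<and> r \<le> exp (-1)")
  case True
  have s: "0 < sqrt r" using True by simp
  have "ln (1 / sqrt r) \<le> 1 / sqrt r - 1" using s by (intro ln_le_minus_one) auto
  then have "- ln r \<le> 2 / sqrt r" using True by (simp add: ln_div ln_sqrt)
  then have "r * (- ln r) \<le> r * (2 / sqrt r)" using True by (intro mult_left_mono) auto
  also have "\<dots> = 2 * sqrt r" using s True by (simp add: field_simps)
  finally show ?thesis using omega1_small[of r] True by simp
next
  case False
  assume "0 \<le> r"
  show ?thesis
  proof (cases "r = 0")
    case False
    then have r: "exp (-1) < r" using \<open>0 \<le> r\<close> \<open>\<not> (0 < r \<and> r \<le> exp (-1))\<close> by auto
    have "exp (-1) \<le> sqrt (exp (-1::real))"
      by (rule real_le_rsqrt) (simp add: power2_eq_square mult_left_le)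
    also have "\<dots> \<le> 2 * sqrt r"
      using real_sqrt_le_mono[of "exp (-1)" r] real_sqrt_ge_zero[of r] r \<open>0 \<le> r\<close> by linarith
    finally show ?thesis using omega1_le[of r] by linarith
  qed (simp add: omega1_def)
qed

text \<open>For h \<le> exp (-1) one has 1 \<le> -ln h, so the linear term a h is absorbed into the
  logarithmic one.\<close>

lemma ln_le_omega1:
  assumes "0 < h" "h \<le> exp (-1)" "0 \<le> a" "0 \<le> b"
  shows "h * (a + b * \<bar>ln h\<bar>) \<le> (a + b) * omega1 h"
proof -
  have h: "omega1 h = h * (- ln h)" "1 \<le> - ln h" using omega1_small[OF assms(1,2)] by auto
  have "h * (a * 1 + b * \<bar>ln h\<bar>) \<le> h * (a * (- ln h) + b * (- ln h))"
    using h assms by (intro mult_left_mono add_mono) auto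
  then show ?thesis using h by (simp add: algebra_simps)
qed

section \<open>Estimates of the layer potential\<close>

definition good_graph ::
  "real \<Rightarrow> real \<Rightarrow> ('v::euclidean_space \<Rightarrow> real) \<Rightarrow> ('v \<Rightarrow> 'v \<Rightarrow>\<^sub>L real) \<Rightarrow> bool" where
  "good_graph \<rho> \<Lambda> \<gamma> D \<longleftrightarrow>
     (\<forall>x\<in>ball 0 (2 * \<rho>). (\<gamma> has_derivative blinfun_apply (D x)) (at x) \<and> norm (D x) \<le> \<Lambda> \<and>
        (\<forall>y\<in>ball 0 (2 * \<rho>). norm (D x - D y) \<le> \<Lambda> * norm (x - y)))"

definition good_weight :: "real \<Rightarrow> real \<Rightarrow> ('v::euclidean_space \<Rightarrow> complex) \<Rightarrow> bool" where
  "good_weight \<rho> W w \<longleftrightarrow> 0 \<le> W \<and>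
     (\<forall>x\<in>ball 0 (2 * \<rho>). norm (w x) \<le> W \<and> (\<forall>y\<in>ball 0 (2 * \<rho>). norm (w x - w y) \<le> W * norm (x - y)))"

text \<open>K depends only on \<rho>, \<Lambda> and the dimension and is obtained before kernel,
  graph and weight. The explicit constants are gathered here once and stay hidden behind K
  afterwards.\<close>

lemma graph_potential_estimates:
  assumes \<rho>: "0 < \<rho>" and \<Lambda>: "0 \<le> \<Lambda>"
  obtains K where "0 \<le> K"
    and "\<And>k N \<gamma> (D :: 'v::euclidean_space \<Rightarrow> 'v \<Rightarrow>\<^sub>L real) w W \<xi> t. kernel_bounds N k \<Longrightarrow> good_graph \<rho> \<Lambda> \<gamma> D \<Longrightarrow>
      good_weight \<rho> W w \<Longrightarrow> \<xi> \<in> ball 0 \<rho> \<Longrightarrow> t \<noteq> 0 \<Longrightarrow> norm (graph_potential k \<rho> \<gamma> w \<xi> t) \<le> N * W * K"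
    and "\<And>k N \<gamma> (D :: 'v::euclidean_space \<Rightarrow> 'v \<Rightarrow>\<^sub>L real) w W \<xi> t \<xi>' t' h. kernel_bounds N k \<Longrightarrow> good_graph \<rho> \<Lambda> \<gamma> D \<Longrightarrow>
      good_weight \<rho> W w \<Longrightarrow> \<xi> \<in> ball 0 \<rho> \<Longrightarrow> \<xi>' \<in> ball 0 \<rho> \<Longrightarrow> 0 < t * t' \<Longrightarrow>
      h = norm (\<xi> - \<xi>') + \<bar>t - t'\<bar> \<Longrightarrow> 0 < h \<Longrightarrow> h \<le> \<rho> \<Longrightarrow> h \<le> exp (-1) \<Longrightarrow>
      norm (graph_potential k \<rho> \<gamma> w \<xi> t - graph_potential k \<rho> \<gamma> w \<xi>' t') \<le> N * W * (K * omega1 h)"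
proof
  let ?S = "sphere_area TYPE('v)" and ?F = "flat_const TYPE('v) \<Lambda>"
  let ?c = "corr_const \<Lambda> \<rho>" and ?m = "mid_const TYPE('v) \<Lambda> \<rho>"
  let ?h = "2 * ?F + \<Lambda> * ?F + ?S / \<rho> + ?c * ?S * (5 + 2 * 2 ^ DIM('v)) + ?m * ?S * (\<bar>ln (3 * \<rho>)\<bar>)"
  let ?K1 = "?F + ?c * (?S * (3 * \<rho>))" and ?K2 = "?h + ?m * ?S"
  have F: "0 \<le> ?F" using \<Lambda> by (simp add: flat_const_def)
  have c: "0 \<le> ?c" using \<rho> \<Lambda> by (simp add: corr_const_def)
  have m: "0 \<le> ?m" using \<rho> \<Lambda> by (simp add: mid_const_def)
  have K1: "0 \<le> ?K1" using F c \<rho> by (intro add_nonneg_nonneg mult_nonneg_nonneg) auto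
  have h: "0 \<le> ?h" using F c m \<rho> \<Lambda> by (intro add_nonneg_nonneg mult_nonneg_nonneg divide_nonneg_nonneg) auto
  then have K2: "0 \<le> ?K2" using mult_nonneg_nonneg[OF m sphere_area_nonneg] by (rule add_nonneg_nonneg)
  show "0 \<le> ?K1 + ?K2" using K1 K2 by (rule add_nonneg_nonneg)
  fix k :: "'v \<times> real \<Rightarrow> complex" and N :: real and \<gamma> and D :: "'v \<Rightarrow> 'v \<Rightarrow>\<^sub>L real" and w :: "'v \<Rightarrow> complex" and W
  assume k: "kernel_bounds N k" and g: "good_graph \<rho> \<Lambda> \<gamma> D" and w: "good_weight \<rho> W w"
  have W: "0 \<le> W" and N: "0 \<le> N" using w kernel_bounds_nonneg[OF k] by (auto simp: good_weight_def)
  have der: "(\<gamma> has_derivative blinfun_apply (D x)) (at x)" if "x \<in> ball 0 (2 * \<rho>)" for x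
    using g that unfolding good_graph_def by simp
  have Db: "norm (D x) \<le> \<Lambda>" if "x \<in> ball 0 (2 * \<rho>)" for x
    using g that unfolding good_graph_def by simp
  have Dl: "norm (D x - D y) \<le> \<Lambda> * norm (x - y)" if "x \<in> ball 0 (2 * \<rho>)" "y \<in> ball 0 (2 * \<rho>)" for x y
    using g that unfolding good_graph_def by simp
  have wb: "norm (w x) \<le> W" if "x \<in> ball 0 (2 * \<rho>)" for x
    using w that unfolding good_weight_def by simp
  have wl: "norm (w x - w y) \<le> W * norm (x - y)" if "x \<in> ball 0 (2 * \<rho>)" "y \<in> ball 0 (2 * \<rho>)" for x y
    using w that unfolding good_weight_def by simp
  {
    fix \<xi> :: 'v and t :: real
    assume "\<xi> \<in> ball 0 \<rho>" "t \<noteq> 0"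
    from norm_graph_potential_le[OF k \<rho> \<Lambda> W der Db Dl wb wl this]
    have "norm (graph_potential k \<rho> \<gamma> w \<xi> t) \<le> N * W * ?K1" .
    also have "\<dots> \<le> N * W * (?K1 + ?K2)" using N W K2 by (intro mult_left_mono) auto
    finally show "norm (graph_potential k \<rho> \<gamma> w \<xi> t) \<le> N * W * (?K1 + ?K2)" .
  }
  fix \<xi> \<xi>' :: 'v and t t' h :: real
  assume \<xi>: "\<xi> \<in> ball 0 \<rho>" "\<xi>' \<in> ball 0 \<rho>" "0 < t * t'" "h = norm (\<xi> - \<xi>') + \<bar>t - t'\<bar>" "0 < h" "h \<le> \<rho>" and he: "h \<le> exp (-1)"
  have "norm (graph_potential k \<rho> \<gamma> w \<xi> t - graph_potential k \<rho> \<gamma> w \<xi>' t') \<le> N * W * h * (?h + ?m * ?S * \<bar>ln h\<bar>)"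
    using graph_potential_hoelder[OF k \<rho> \<Lambda> W der Db Dl wb wl \<xi>] unfolding hoelder_const_def .
  also have "\<dots> = N * W * (h * (?h + ?m * ?S * \<bar>ln h\<bar>))" by (simp only: mult.assoc)
  also have "\<dots> \<le> N * W * (?K2 * omega1 h)"
    using ln_le_omega1[OF \<xi>(5) he h, of "?m * ?S"] m N W by (intro mult_left_mono) auto
  also have "\<dots> \<le> N * W * ((?K1 + ?K2) * omega1 h)"
    using K1 N W omega1_nonneg by (intro mult_left_mono mult_right_mono) auto
  finally show "norm (graph_potential k \<rho> \<gamma> w \<xi> t - graph_potential k \<rho> \<gamma> w \<xi>' t') \<le> N * W * ((?K1 + ?K2) * omega1 h)" .
qed

definition density_bounds :: "real \<Rightarrow> 'a::metric_space set \<Rightarrow> ('a \<Rightarrow> complex) \<Rightarrow> bool" where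
  "density_bounds M S \<mu> \<longleftrightarrow> 0 \<le> M \<and> (\<forall>y\<in>S. norm (\<mu> y) \<le> M) \<and> (\<forall>y\<in>S. \<forall>z\<in>S. norm (\<mu> y - \<mu> z) \<le> M * dist y z)"

lemma density_bounds_continuous: "density_bounds M S \<mu> \<Longrightarrow> continuous_on S \<mu>"
  by (rule lipschitz_on_continuous_on[where L = M]) (auto simp: density_bounds_def dist_norm intro!: lipschitz_onI)

text \<open>The reverse triangle inequality for the plane vectors (1, a) and (1, b). It makes the
  area element as Lipschitz as the derivative.\<close>

lemma sqrt_one_plus_square_diff: "\<bar>sqrt (1 + a\<^sup>2) - sqrt (1 + b\<^sup>2)\<bar> \<le> \<bar>a - b\<bar>"
  using norm_triangle_ineq3[of "(1::real, a)" "(1, b)"] by (simp add: norm_Pair)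

text \<open>The surface measure and a graph measure are known to agree only on subsets of A;
  multiplied by the indicator of A they become equal as measures.\<close>

lemma set_integral_cong_measure:
  fixes f :: "'a::euclidean_space \<Rightarrow> complex"
  assumes sets: "sets M = sets borel" "sets N = sets borel" and A: "A \<in> sets borel"
    and eq: "\<And>B. B \<in> sets borel \<Longrightarrow> B \<subseteq> A \<Longrightarrow> emeasure M B = emeasure N B"
    and f: "(\<lambda>x. indicator A x *\<^sub>R f x) \<in> borel_measurable borel"
  shows "(LINT x:A|M. f x) = (LINT x:A|N. f x)"
proof -
  have dens: "density M (indicator A) = density N (indicator A)"
  proof (rule measure_eqI)
    show "emeasure (density M (indicator A)) X = emeasure (density N (indicator A)) X"
      if "X \<in> sets (density M (indicator A))" for X
    proof -
      have X: "X \<in> sets borel" using that sets by simp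
      have "emeasure (density L (indicator A)) X = emeasure L (A \<inter> X)" if "sets L = sets borel" for L :: "'a measure"
      proof -
        have "emeasure (density L (indicator A)) X = (\<integral>\<^sup>+x. indicator A x * indicator X x \<partial>L)"
          using that A X by (intro emeasure_density borel_measurable_indicator) simp_all
        also have "(\<lambda>x. indicator A x * indicator X x :: ennreal) = indicator (A \<inter> X)"
          by (auto simp: indicator_def)
        finally show ?thesis using that A X by simp
      qed
      then show ?thesis using sets eq[of "A \<inter> X"] A X by simp
    qed
  qed (use sets in simp)
  have "(LINT x:A|L. f x) = (\<integral>x. indicator A x *\<^sub>R f x \<partial>density L (indicator A))" if L: "sets L = sets borel" for L
  proof -
    have "(\<integral>x. indicator A x *\<^sub>R f x \<partial>density L (\<lambda>x. ennreal (indicator A x))) =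
        (\<integral>x. indicator A x *\<^sub>R (indicator A x *\<^sub>R f x) \<partial>L)"
    proof (rule integral_density)
      show "(\<lambda>x. indicator A x *\<^sub>R f x) \<in> borel_measurable L" using f measurable_cong_sets[OF L refl] by blast
      show "indicat_real A \<in> borel_measurable L" using A L by simp
    qed simp
    also have "(\<lambda>x. indicator A x *\<^sub>R (indicator A x *\<^sub>R f x)) = (\<lambda>x. indicator A x *\<^sub>R f x)"
      by (auto simp: indicator_def)
    finally show ?thesis by (simp add: set_lebesgue_integral_def ennreal_indicator)
  qed
  then show ?thesis using dens sets by simp
qed

lemma finite_measure_set_integrable:
  fixes f :: "'a::euclidean_space \<Rightarrow> complex"
  assumes M: "sets M = sets borel" "emeasure M UNIV < \<infinity>"
    and S: "S \<in> sets borel" "continuous_on S f" and le: "\<And>x. x \<in> S \<Longrightarrow> norm (f x) \<le> B"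
  shows "set_integrable M S f"
    and "0 \<le> B \<Longrightarrow> norm (LINT x:S|M. f x) \<le> B * measure M UNIV"
proof -
  interpret finite_measure M using M sets_eq_imp_space_eq[OF M(1)] by (intro finite_measureI) auto
  have meas: "(\<lambda>x. indicator S x *\<^sub>R f x) \<in> borel_measurable M"
    using borel_measurable_continuous_on_indicator[OF S] measurable_cong_sets[OF M(1) refl] by blast
  have le2: "norm (indicator S x *\<^sub>R f x) \<le> \<bar>B\<bar>" for x
    using le[of x] by (auto simp: indicator_def)
  show int: "set_integrable M S f" unfolding set_integrable_def
    by (rule integrable_const_bound[OF _ meas]) (use le2 in auto)
  show "norm (LINT x:S|M. f x) \<le> B * measure M UNIV" if "0 \<le> B"
  proof -
    have "norm (LINT x:S|M. f x) \<le> (\<integral>x. norm (indicator S x *\<^sub>R f x) \<partial>M)"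
      unfolding set_lebesgue_integral_def by (rule integral_norm_bound)
    also have "\<dots> \<le> (\<integral>x. B \<partial>M)"
      using int le2 that unfolding set_integrable_def by (intro integral_mono integrable_norm) auto
    also have "\<dots> = B * measure M UNIV" using sets_eq_imp_space_eq[OF M(1)] by simp
    finally show ?thesis .
  qed
qed

context
  fixes \<Omega> :: "('m::finite) rn set"
  assumes bounded: "bounded \<Omega>" and opn: "open \<Omega>" and C11: "class_C11 \<Omega>"
begin

abbreviation \<sigma> where "\<sigma> \<equiv> surface_measure \<Omega>"

lemma is_surface_measure: "is_surface_measure \<Omega> \<sigma>"
  unfolding surface_measure_def by (rule theI'[OF surface_measure_unique_exists(1)[OF bounded opn C11]])

lemma sets_surface_measure: "sets \<sigma> = sets borel"
  using is_surface_measure by (simp add: is_surface_measure_def)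

lemma finite_surface_measure: "emeasure \<sigma> UNIV < \<infinity>"
  by (rule surface_measure_unique_exists(2)[OF bounded opn C11 is_surface_measure])

lemma frontier_borel: "frontier \<Omega> \<in> sets borel" by (intro borel_closed) simp

definition part :: "('m rn \<Rightarrow> complex) \<Rightarrow> ('m rn \<Rightarrow> complex) \<Rightarrow> 'm rn set \<Rightarrow> 'm rn \<Rightarrow> complex" where
  "part k \<mu> A x = (LINT y:A|\<sigma>. k (x - y) * \<mu> y)"

lemma continuous_integrand:
  assumes k: "kernel_bounds N k" and \<mu>: "density_bounds M (frontier \<Omega>) \<mu>"
    and A: "A \<subseteq> frontier \<Omega>" and x: "x \<notin> A"
  shows "continuous_on A (\<lambda>y. k (x - y) * \<mu> y)"
proof (rule continuous_on_mult)
  show "continuous_on A (\<lambda>y. k (x - y))"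
  proof (rule continuous_on_compose2[OF kernel_bounds_continuous[OF k]])
    show "continuous_on A (\<lambda>y. x - y)" by (intro continuous_intros)
    show "(\<lambda>y. x - y) ` A \<subseteq> - {0}"
    proof (rule image_subsetI)
      fix y assume "y \<in> A"
      then have "x \<noteq> y" using x by blast
      then show "x - y \<in> - {0}" by simp
    qed
  qed
  show "continuous_on A \<mu>" using density_bounds_continuous[OF \<mu>] A continuous_on_subset by blast
qed

text \<open>At distance at least c from A the kernel and its increments are bounded by inverse
  powers of c, and the surface measure is finite. For increments the whole segment from x' to x has
  to keep that distance.\<close>

lemma part_far:
  assumes k: "kernel_bounds N k" and \<mu>: "density_bounds M (frontier \<Omega>) \<mu>"
    and A: "A \<subseteq> frontier \<Omega>" "A \<in> sets borel" and c: "0 < c" and far: "\<And>y. y \<in> A \<Longrightarrow> c \<le> dist x y"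
  shows "set_integrable \<sigma> A (\<lambda>y. k (x - y) * \<mu> y)"
    and "norm (part k \<mu> A x) \<le> N / c ^ CARD('m) * M * measure \<sigma> UNIV"
    and "(\<And>s y. s \<in> {0..1} \<Longrightarrow> y \<in> A \<Longrightarrow> c \<le> dist (x' + s *\<^sub>R (x - x')) y) \<Longrightarrow>
      norm (part k \<mu> A x - part k \<mu> A x') \<le> N * dist x x' / c ^ (CARD('m) + 1) * M * measure \<sigma> UNIV"
proof -
  have N: "0 \<le> N" by (rule kernel_bounds_nonneg[OF k])
  have M: "0 \<le> M" "\<And>y. y \<in> A \<Longrightarrow> norm (\<mu> y) \<le> M" using \<mu> A by (auto simp: density_bounds_def)
  have cont: "continuous_on A (\<lambda>y. k (x - y) * \<mu> y)" if "\<And>y. y \<in> A \<Longrightarrow> c \<le> dist x y" for x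
  proof (rule continuous_integrand[OF k \<mu> A(1)])
    show "x \<notin> A" using that[of x] c by auto
  qed
  have le: "norm (k (x - y) * \<mu> y) \<le> N / c ^ CARD('m) * M" if "y \<in> A" "\<And>y. y \<in> A \<Longrightarrow> c \<le> dist x y" for x y
    unfolding norm_mult using norm_kernel_le[OF k c, of "x - y"] that M N c
    by (intro mult_mono) (auto simp: dist_norm)
  show 1: "set_integrable \<sigma> A (\<lambda>y. k (x - y) * \<mu> y)"
    by (rule finite_measure_set_integrable(1)[OF sets_surface_measure finite_surface_measure A(2) cont le]) (use far in auto)
  show "norm (part k \<mu> A x) \<le> N / c ^ CARD('m) * M * measure \<sigma> UNIV"
    unfolding part_def
    by (rule finite_measure_set_integrable(2)[OF sets_surface_measure finite_surface_measure A(2) cont le])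
      (use far N M c in auto)
  assume seg: "\<And>s y. s \<in> {0..1} \<Longrightarrow> y \<in> A \<Longrightarrow> c \<le> dist (x' + s *\<^sub>R (x - x')) y"
  have far': "\<And>y. y \<in> A \<Longrightarrow> c \<le> dist x' y" using seg[of 0] by simp
  have 2: "set_integrable \<sigma> A (\<lambda>y. k (x' - y) * \<mu> y)"
    by (rule finite_measure_set_integrable(1)[OF sets_surface_measure finite_surface_measure A(2) cont le]) (use far' in auto)
  have "part k \<mu> A x - part k \<mu> A x' = (LINT y:A|\<sigma>. k (x - y) * \<mu> y - k (x' - y) * \<mu> y)"
    unfolding part_def using set_integral_diff(2)[OF 1 2] by simp
  also have "norm \<dots> \<le> N * dist x x' / c ^ (CARD('m) + 1) * M * measure \<sigma> UNIV"
  proof (rule finite_measure_set_integrable(2)[OF sets_surface_measure finite_surface_measure A(2)])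
    show "continuous_on A (\<lambda>y. k (x - y) * \<mu> y - k (x' - y) * \<mu> y)"
      by (intro continuous_on_diff cont far far')
    show "norm (k (x - y) * \<mu> y - k (x' - y) * \<mu> y) \<le> N * dist x x' / c ^ (CARD('m) + 1) * M" if y: "y \<in> A" for y
    proof -
      have "norm (k ((x' - y) + (x - x')) - k (x' - y)) \<le> N * norm (x - x') / c ^ DIM('m rn)"
      proof (rule kernel_bounds_diff[OF k c])
        fix s :: real assume "s \<in> {0..1}"
        from seg[OF this y] show "c \<le> norm (x' - y + s *\<^sub>R (x - x'))" by (simp add: dist_norm algebra_simps)
      qed
      then have "norm (k (x - y) - k (x' - y)) \<le> N * dist x x' / c ^ (CARD('m) + 1)" by (simp add: dist_norm)
      then have "norm (k (x - y) - k (x' - y)) * norm (\<mu> y) \<le> N * dist x x' / c ^ (CARD('m) + 1) * M"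
        using M y N c by (intro mult_mono) auto
      then show ?thesis by (simp add: left_diff_distrib[symmetric] norm_mult)
    qed
    show "0 \<le> N * dist x x' / c ^ (CARD('m) + 1) * M" using N M c by simp
  qed
  finally show "norm (part k \<mu> A x - part k \<mu> A x') \<le> N * dist x x' / c ^ (CARD('m) + 1) * M * measure \<sigma> UNIV" .
qed

lemma frontier_integrable:
  assumes k: "kernel_bounds N k" and \<mu>: "density_bounds M (frontier \<Omega>) \<mu>" and x: "x \<notin> frontier \<Omega>"
  shows "set_integrable \<sigma> (frontier \<Omega>) (\<lambda>y. k (x - y) * \<mu> y)"
proof -
  obtain c where "0 < c" "\<And>y. y \<in> frontier \<Omega> \<Longrightarrow> c \<le> dist x y"
    using separate_point_closed[OF frontier_closed x] by blast
  from part_far(1)[OF k \<mu> order_refl frontier_borel this] show ?thesis .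
qed

lemma potential_eq_part: "potential \<Omega> k \<mu> x = part k \<mu> (frontier \<Omega>) x"
  by (simp add: potential_def part_def)

context
  fixes p R r \<delta> \<gamma> \<Lambda>
  assumes p: "p \<in> frontier \<Omega>" and lg: "local_graph \<Omega> p R r \<delta> \<gamma>" and \<Lambda>: "0 \<le> \<Lambda>"
    and D_bound: "\<And>\<eta>. \<eta> \<in> ball 0 r \<Longrightarrow> norm (total_deriv \<gamma> \<eta>) \<le> \<Lambda>"
    and D_lip: "\<And>\<eta> \<eta>'. \<eta> \<in> ball 0 r \<Longrightarrow> \<eta>' \<in> ball 0 r \<Longrightarrow> norm (total_deriv \<gamma> \<eta> - total_deriv \<gamma> \<eta>') \<le> \<Lambda> * norm (\<eta> - \<eta>')"
begin

lemmas lgb = local_graph_basic[OF lg]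
lemmas RR = orthogonal_inv[OF local_graph_basic(1)[OF lg]]

text \<open>The radius r/2 is \<open>2 * (r / 4)\<close>: the estimates for graphs are applied with
  \<rho> = r/4.\<close>

definition piece :: "'m rn set" where
  "piece = {x \<in> cylinder p R r \<delta>. norm (fst (R (x - p))) < r / 2} \<inter> frontier \<Omega>"

text \<open>The area element is absorbed into the density, which turns the surface integral into a
  Lebesgue integral over the base.\<close>

definition weight :: "('m rn \<Rightarrow> complex) \<Rightarrow> real^'m \<Rightarrow> complex" where
  "weight \<mu> \<eta> = area_element \<gamma> \<eta> *\<^sub>R \<mu> (graph_point p R \<gamma> \<eta>)"

lemma small_ball: "\<eta> \<in> ball 0 (2 * (r / 4)) \<Longrightarrow> \<eta> \<in> ball (0 :: real^'m) r"
  using lgb(2) by auto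

lemma piece_borel: "piece \<in> sets borel" "piece \<subseteq> frontier \<Omega>" "piece \<subseteq> cylinder p R r \<delta>"
proof -
  have c: "continuous_on (cylinder p R r \<delta>) (\<lambda>x. norm (fst (R (x - p))))"
    by (intro continuous_on_norm continuous_on_fst continuous_on_loc[OF lg])
  have "open (cylinder p R r \<delta> \<inter> (\<lambda>x. norm (fst (R (x - p)))) -` {..<r / 2})"
    by (rule continuous_open_preimage[OF c open_cylinder[OF lg]]) simp
  moreover have "piece = (cylinder p R r \<delta> \<inter> (\<lambda>x. norm (fst (R (x - p)))) -` {..<r / 2}) \<inter> frontier \<Omega>"
    by (auto simp: piece_def)
  ultimately show "piece \<in> sets borel"
    using sets.Int[OF borel_open frontier_borel] by (simp only:)
qed (auto simp: piece_def)

lemma graph_point_in_piece: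
  assumes "\<eta> \<in> ball 0 r"
  shows "graph_point p R \<gamma> \<eta> \<in> piece \<longleftrightarrow> \<eta> \<in> ball 0 (2 * (r / 4))"
  using graph_point_in_cylinder[OF lg assms] graph_point_in_frontier[OF lg opn assms]
  by (simp add: piece_def loc_graph_point[OF lg])

lemma graph_lip:
  assumes "\<eta> \<in> ball 0 r" "\<eta>' \<in> ball 0 r"
  shows "\<bar>\<gamma> \<eta> - \<gamma> \<eta>'\<bar> \<le> \<Lambda> * norm (\<eta> - \<eta>')"
  using differentiable_bound[OF convex_ball, of 0 r \<gamma> "\<lambda>x. blinfun_apply (total_deriv \<gamma> x)" \<Lambda> \<eta> \<eta>']
    has_derivative_at_withinI[OF has_derivative_graph[OF lg]] D_bound assms by (simp add: norm_blinfun.rep_eq)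

lemma good_graph: "good_graph (r / 4) \<Lambda> \<gamma> (total_deriv \<gamma>)"
  unfolding good_graph_def using has_derivative_graph[OF lg] D_bound D_lip small_ball by blast

text \<open>The area element is at most 1 + \<Lambda> and \<Lambda>-Lipschitz; the density on the
  graph is at most M and Lipschitz with constant M (1 + \<Lambda>), as the parametrization stretches
  by at most 1 + \<Lambda>. The product rule for increments gives the constant.\<close>

lemma good_weight:
  assumes \<mu>: "density_bounds M (frontier \<Omega>) \<mu>"
  shows "good_weight (r / 4) (M * ((1 + \<Lambda>) * (1 + \<Lambda>) + \<Lambda>)) (weight \<mu>)"
proof -
  let ?g = "graph_point p R \<gamma>" and ?a = "area_element \<gamma>"
  have M: "0 \<le> M" using \<mu> by (simp add: density_bounds_def)
  have fr: "?g \<eta> \<in> frontier \<Omega>" if "\<eta> \<in> ball 0 r" for \<eta> by (rule graph_point_in_frontier[OF lg opn that])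
  have mu: "norm (\<mu> (?g \<eta>)) \<le> M" if "\<eta> \<in> ball 0 r" for \<eta> using \<mu> fr[OF that] by (simp add: density_bounds_def)
  have mul: "norm (\<mu> (?g \<eta>) - \<mu> (?g \<eta>')) \<le> M * ((1 + \<Lambda>) * norm (\<eta> - \<eta>'))" if \<eta>: "\<eta> \<in> ball 0 r" "\<eta>' \<in> ball 0 r" for \<eta> \<eta>'
  proof -
    have "?g \<eta> - ?g \<eta>' = inv R ((\<eta>, \<gamma> \<eta>) - (\<eta>', \<gamma> \<eta>'))"
      unfolding graph_point_def linear_diff[OF RR(4)] by simp
    then have "dist (?g \<eta>) (?g \<eta>') = norm (\<eta> - \<eta>', \<gamma> \<eta> - \<gamma> \<eta>')" by (simp add: dist_norm RR)
    also have "\<dots> \<le> norm (\<eta> - \<eta>') + \<bar>\<gamma> \<eta> - \<gamma> \<eta>'\<bar>" using norm_Pair_le[of "\<eta> - \<eta>'" "\<gamma> \<eta> - \<gamma> \<eta>'"] by simp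
    also have "\<dots> \<le> (1 + \<Lambda>) * norm (\<eta> - \<eta>')" using graph_lip[OF \<eta>] by (simp add: distrib_right)
    finally have "M * dist (?g \<eta>) (?g \<eta>') \<le> M * ((1 + \<Lambda>) * norm (\<eta> - \<eta>'))" using M by (rule mult_left_mono)
    moreover have "norm (\<mu> (?g \<eta>) - \<mu> (?g \<eta>')) \<le> M * dist (?g \<eta>) (?g \<eta>')"
      using \<mu> fr \<eta> by (simp add: density_bounds_def)
    ultimately show ?thesis by linarith
  qed
  have a: "0 \<le> ?a \<eta>" "?a \<eta> \<le> 1 + \<Lambda>" if "\<eta> \<in> ball 0 r" for \<eta>
  proof -
    show "0 \<le> ?a \<eta>" by (simp add: area_element_def)
    have "?a \<eta> \<le> 1 + norm (total_deriv \<gamma> \<eta>)"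
      unfolding area_element_def by (rule real_le_lsqrt) (auto simp: power2_eq_square algebra_simps)
    then show "?a \<eta> \<le> 1 + \<Lambda>" using D_bound[OF that] by linarith
  qed
  have al: "\<bar>?a \<eta> - ?a \<eta>'\<bar> \<le> \<Lambda> * norm (\<eta> - \<eta>')" if \<eta>: "\<eta> \<in> ball 0 r" "\<eta>' \<in> ball 0 r" for \<eta> \<eta>'
  proof -
    have "\<bar>?a \<eta> - ?a \<eta>'\<bar> \<le> \<bar>norm (total_deriv \<gamma> \<eta>) - norm (total_deriv \<gamma> \<eta>')\<bar>"
      unfolding area_element_def by (rule sqrt_one_plus_square_diff)
    also have "\<dots> \<le> norm (total_deriv \<gamma> \<eta> - total_deriv \<gamma> \<eta>')" by (rule norm_triangle_ineq3)
    also have "\<dots> \<le> \<Lambda> * norm (\<eta> - \<eta>')" by (rule D_lip[OF \<eta>])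
    finally show ?thesis .
  qed
  let ?W = "M * ((1 + \<Lambda>) * (1 + \<Lambda>) + \<Lambda>)"
  show ?thesis
    unfolding good_weight_def
  proof (intro conjI ballI)
    show "0 \<le> ?W" using M \<Lambda> by simp
    fix \<eta> :: "real^'m" assume "\<eta> \<in> ball 0 (2 * (r / 4))"
    then have \<eta>: "\<eta> \<in> ball 0 r" by (rule small_ball)
    have "norm (weight \<mu> \<eta>) \<le> (1 + \<Lambda>) * M"
      unfolding weight_def norm_scaleR using a[OF \<eta>] mu[OF \<eta>] \<Lambda> by (intro mult_mono) auto
    also have "\<dots> = M * (1 * (1 + \<Lambda>) + 0)" by simp
    also have "\<dots> \<le> ?W" using M \<Lambda> by (intro mult_left_mono add_mono mult_right_mono) auto
    finally show "norm (weight \<mu> \<eta>) \<le> ?W" .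
    fix \<eta>' :: "real^'m" assume "\<eta>' \<in> ball 0 (2 * (r / 4))"
    then have \<eta>': "\<eta>' \<in> ball 0 r" by (rule small_ball)
    have "weight \<mu> \<eta> - weight \<mu> \<eta>' = ?a \<eta> *\<^sub>R (\<mu> (?g \<eta>) - \<mu> (?g \<eta>')) + (?a \<eta> - ?a \<eta>') *\<^sub>R \<mu> (?g \<eta>')"
      by (simp add: weight_def algebra_simps)
    then have "norm (weight \<mu> \<eta> - weight \<mu> \<eta>') \<le> norm (?a \<eta> *\<^sub>R (\<mu> (?g \<eta>) - \<mu> (?g \<eta>'))) + norm ((?a \<eta> - ?a \<eta>') *\<^sub>R \<mu> (?g \<eta>'))"
      by (simp only: norm_triangle_ineq)
    also have "\<dots> \<le> (1 + \<Lambda>) * (M * ((1 + \<Lambda>) * norm (\<eta> - \<eta>'))) + (\<Lambda> * norm (\<eta> - \<eta>')) * M"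
      unfolding norm_scaleR real_norm_def[symmetric]
      using a[OF \<eta>] mul[OF \<eta> \<eta>'] al[OF \<eta> \<eta>'] mu[OF \<eta>'] \<Lambda> by (intro add_mono mult_mono) auto
    also have "\<dots> = ?W * norm (\<eta> - \<eta>')" by (simp add: algebra_simps)
    finally show "norm (weight \<mu> \<eta> - weight \<mu> \<eta>') \<le> ?W * norm (\<eta> - \<eta>')" .
  qed
qed

text \<open>x minus the graph point over \<eta> is \<open>inv R\<close> applied to the chord, so the
  chart turns k into its composition with \<open>inv R\<close>. The last coordinate of x is \<gamma>
  \<xi> - t; inside the cylinder a positive t thus means that x lies in \<Omega>.\<close>

lemma part_piece:
  assumes k: "kernel_bounds N k" and \<mu>: "density_bounds M (frontier \<Omega>) \<mu>"
    and x: "x \<notin> frontier \<Omega>" "R (x - p) = (\<xi>, \<gamma> \<xi> - t)"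
  shows "part k \<mu> piece x = graph_potential (\<lambda>z. k (inv R z)) (r / 4) \<gamma> (weight \<mu>) \<xi> t"
proof -
  let ?G = "graph_measure p R r \<gamma>" and ?f = "\<lambda>y. k (x - y) * \<mu> y" and ?g = "graph_point p R \<gamma>"
  let ?g' = "\<lambda>\<eta>. if \<eta> \<in> ball 0 r then ?g \<eta> else p"
  let ?d = "\<lambda>\<eta>. indicator (ball 0 r) \<eta> * area_element \<gamma> \<eta>"
  have xp: "x \<notin> piece" using x piece_borel by blast
  have meas: "(\<lambda>y. indicator piece y *\<^sub>R ?f y) \<in> borel_measurable borel"
    by (intro borel_measurable_continuous_on_indicator piece_borel continuous_integrand[OF k \<mu> piece_borel(2) xp])
  have "part k \<mu> piece x = (LINT y:piece|?G. ?f y)"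
    unfolding part_def
  proof (rule set_integral_cong_measure[OF sets_surface_measure sets_graph_measure piece_borel(1) _ meas])
    show "emeasure \<sigma> B = emeasure ?G B" if "B \<in> sets borel" "B \<subseteq> piece" for B
      using is_surface_measure p lg that piece_borel(3) unfolding is_surface_measure_iff by blast
  qed
  also have "\<dots> = (\<integral>\<eta>. indicator piece (?g' \<eta>) *\<^sub>R ?f (?g' \<eta>) \<partial>density lborel (\<lambda>\<eta>. ennreal (?d \<eta>)))"
    unfolding set_lebesgue_integral_def graph_measure_def
    by (rule integral_distr) (use graph_point_measurable[OF lg] meas in \<open>simp_all del: mem_ball\<close>)
  also have "\<dots> = (\<integral>\<eta>. ?d \<eta> *\<^sub>R (indicator piece (?g' \<eta>) *\<^sub>R ?f (?g' \<eta>)) \<partial>lborel)"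
  proof (rule integral_density)
    have "(\<lambda>\<eta>. indicator piece (?g' \<eta>) *\<^sub>R ?f (?g' \<eta>)) \<in> borel_measurable borel"
      by (rule measurable_compose[OF graph_point_measurable[OF lg] meas])
    then show "(\<lambda>\<eta>. indicator piece (?g' \<eta>) *\<^sub>R ?f (?g' \<eta>)) \<in> borel_measurable lborel" by simp
    show "?d \<in> borel_measurable lborel" using area_element_measurable[OF lg] by simp
  qed (simp add: area_element_def)
  also have "\<dots> = graph_potential (\<lambda>z. k (inv R z)) (r / 4) \<gamma> (weight \<mu>) \<xi> t"
    unfolding graph_potential_def set_lebesgue_integral_def
  proof (intro Bochner_Integration.integral_cong refl)
    fix \<eta> :: "real^'m"
    show "?d \<eta> *\<^sub>R (indicator piece (?g' \<eta>) *\<^sub>R ?f (?g' \<eta>)) =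
        indicator (ball 0 (2 * (r / 4))) \<eta> *\<^sub>R (k (inv R (chord \<gamma> \<xi> t \<eta>)) * weight \<mu> \<eta>)"
    proof (cases "\<eta> \<in> ball 0 (2 * (r / 4))")
      case True
      have \<eta>: "\<eta> \<in> ball 0 r" using True by (rule small_ball)
      have "x - ?g \<eta> = (x - p) - inv R (\<eta>, \<gamma> \<eta>)" by (simp add: graph_point_def)
      also have "x - p = inv R (\<xi>, \<gamma> \<xi> - t)" using RR(2)[of "x - p"] x(2) by simp
      also have "inv R (\<xi>, \<gamma> \<xi> - t) - inv R (\<eta>, \<gamma> \<eta>) = inv R (chord \<gamma> \<xi> t \<eta>)"
        unfolding linear_diff[OF RR(4), symmetric] by (simp add: chord_def algebra_simps)
      finally have "x - ?g \<eta> = inv R (chord \<gamma> \<xi> t \<eta>)" .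
      moreover have "?g' \<eta> = ?g \<eta>" using \<eta> by (rule if_P)
      moreover have "indicator piece (?g \<eta>) = (1 :: real)" using graph_point_in_piece[OF \<eta>] True by (simp only: indicator_simps)
      moreover have "?d \<eta> = area_element \<gamma> \<eta>" using \<eta> by simp
      moreover have "indicator (ball 0 (2 * (r / 4))) \<eta> = (1 :: real)" using True by (simp only: indicator_simps)
      ultimately show ?thesis by (simp only: weight_def) simp
    next
      case False
      then have "?d \<eta> *\<^sub>R (indicator piece (?g' \<eta>) *\<^sub>R ?f (?g' \<eta>)) = 0"
        using graph_point_in_piece[of \<eta>] by (cases "\<eta> \<in> ball 0 r") auto
      then show ?thesis using False by (simp only: indicator_simps scaleR_zero_left not_False_eq_True)
    qed
  qed
  finally show ?thesis .
qed

text \<open>Near p the potential is the graph potential of \<open>piece\<close> plus the integral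
  over the rest of the frontier, which keeps a positive distance from p. The numbers e and C are
  chosen before kernel, density and points.\<close>

lemma local_estimate_near:
  shows "\<exists>e>0. \<exists>C\<ge>0. \<forall>k N \<mu> M x x'. kernel_bounds N k \<longrightarrow> density_bounds M (frontier \<Omega>) \<mu> \<longrightarrow>
    x \<in> ball p e \<longrightarrow> x' \<in> ball p e \<longrightarrow> x \<notin> frontier \<Omega> \<longrightarrow> x' \<notin> frontier \<Omega> \<longrightarrow> (x \<in> \<Omega> \<longleftrightarrow> x' \<in> \<Omega>) \<longrightarrow>
    norm (potential \<Omega> k \<mu> x) \<le> N * M * C \<and>
    norm (potential \<Omega> k \<mu> x - potential \<Omega> k \<mu> x') \<le> N * M * (C * omega1 (dist x x'))"
proof -
  let ?\<rho> = "r / 4"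
  have \<rho>: "0 < ?\<rho>" using lgb(2) by simp
  obtain K where K: "0 \<le> K"
    and K1: "\<And>k N \<gamma> (D :: real^'m \<Rightarrow> (real^'m) \<Rightarrow>\<^sub>L real) w W \<xi> t. kernel_bounds N k \<Longrightarrow> good_graph ?\<rho> \<Lambda> \<gamma> D \<Longrightarrow>
      good_weight ?\<rho> W w \<Longrightarrow> \<xi> \<in> ball 0 ?\<rho> \<Longrightarrow> t \<noteq> 0 \<Longrightarrow> norm (graph_potential k ?\<rho> \<gamma> w \<xi> t) \<le> N * W * K"
    and K2: "\<And>k N \<gamma> (D :: real^'m \<Rightarrow> (real^'m) \<Rightarrow>\<^sub>L real) w W \<xi> t \<xi>' t' h. kernel_bounds N k \<Longrightarrow> good_graph ?\<rho> \<Lambda> \<gamma> D \<Longrightarrow>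
      good_weight ?\<rho> W w \<Longrightarrow> \<xi> \<in> ball 0 ?\<rho> \<Longrightarrow> \<xi>' \<in> ball 0 ?\<rho> \<Longrightarrow> 0 < t * t' \<Longrightarrow>
      h = norm (\<xi> - \<xi>') + \<bar>t - t'\<bar> \<Longrightarrow> 0 < h \<Longrightarrow> h \<le> ?\<rho> \<Longrightarrow> h \<le> exp (-1) \<Longrightarrow>
      norm (graph_potential k ?\<rho> \<gamma> w \<xi> t - graph_potential k ?\<rho> \<gamma> w \<xi>' t') \<le> N * W * (K * omega1 h)"
    using graph_potential_estimates[where 'v = "real^'m", OF \<rho> \<Lambda>] by metis
  \<comment> \<open>Frontier points outside \<open>piece\<close> have distance at least 2 c from p;
    points of the ball of radius e \<le> c therefore keep distance c from them.\<close>
  define c where "c = min (r / 2) \<delta> / 2"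
  \<comment> \<open>In chart coordinates the increment h is at most (2 + \<Lambda>) |x - x'|, and |x
    - x'| < 2 e. The choice makes h \<le> \<rho> and h \<le> exp (-1).\<close>
  define e where "e = min c (min (?\<rho> / (2 * (2 + \<Lambda>))) (exp (-1) / (2 * (2 + \<Lambda>))))"
  define S where "S = measure \<sigma> UNIV"
  define A where "A = frontier \<Omega> - piece"
  define cW where "cW = (1 + \<Lambda>) * (1 + \<Lambda>) + \<Lambda>"
  define C where "C = cW * K * (2 + \<Lambda>) + S / c ^ CARD('m) + S / c ^ (CARD('m) + 1)"
  have c: "0 < c" using lgb(2,3) by (simp add: c_def)
  have e: "0 < e" using c \<rho> \<Lambda> by (simp add: e_def)
  have ec: "e \<le> c" "e * (2 * (2 + \<Lambda>)) \<le> ?\<rho>" "e * (2 * (2 + \<Lambda>)) \<le> exp (-1)"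
  proof -
    show "e \<le> c" by (simp add: e_def)
    have q: "0 < 2 * (2 + \<Lambda>)" using \<Lambda> by simp
    have "e \<le> ?\<rho> / (2 * (2 + \<Lambda>))" "e \<le> exp (-1) / (2 * (2 + \<Lambda>))" by (auto simp: e_def)
    then show "e * (2 * (2 + \<Lambda>)) \<le> ?\<rho>" "e * (2 * (2 + \<Lambda>)) \<le> exp (-1)"
      by (simp_all only: pos_le_divide_eq[OF q])
  qed
  have S: "0 \<le> S" by (simp add: S_def)
  have cW: "0 \<le> cW" using \<Lambda> by (simp add: cW_def)
  have C: "0 \<le> C" using cW K \<Lambda> S c by (simp add: C_def)
  have A: "A \<subseteq> frontier \<Omega>" "A \<in> sets borel" using frontier_borel piece_borel(1) by (auto simp: A_def)
  have A_far: "2 * c \<le> dist p y" if y: "y \<in> A" for y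
  proof (rule ccontr)
    assume "\<not> 2 * c \<le> dist p y"
    then have "dist p y < min (r / 2) \<delta>" unfolding c_def by linarith
    moreover have "norm (R (y - p)) = dist p y" unfolding RR(6) by (simp add: dist_norm norm_minus_commute)
    ultimately have "norm (R (y - p)) < min (r / 2) \<delta>" by (simp only:)
    moreover obtain a b where ab: "R (y - p) = (a, b)" by (rule prod.exhaust)
    ultimately have "norm a < r / 2" "\<bar>b\<bar> < \<delta>"
      using norm_fst_le[of a b] norm_snd_le[of b a] by auto
    then have "y \<in> piece" using y ab lgb(2) by (auto simp: piece_def A_def cylinder_def)
    then show False using y by (simp add: A_def)
  qed
  have ball_far: "c \<le> dist x y" if "x \<in> ball p e" "y \<in> A" for x y
    using A_far[OF that(2)] that(1) ec(1) dist_triangle[of p y x] by (auto simp: dist_commute)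
  have coords: "\<exists>\<xi> t. R (x - p) = (\<xi>, \<gamma> \<xi> - t) \<and> \<xi> \<in> ball 0 ?\<rho> \<and> x \<in> cylinder p R r \<delta>" if x: "x \<in> ball p e" for x
  proof -
    obtain a b where ab: "R (x - p) = (a, b)" by (rule prod.exhaust)
    have "norm (R (x - p)) < c" using x ec(1) by (simp add: RR dist_norm norm_minus_commute)
    then have "norm a < c" "\<bar>b\<bar> < c" using ab norm_fst_le[of a b] norm_snd_le[of b a] by auto
    moreover have "c \<le> r / 4" "c \<le> \<delta> / 2" by (auto simp: c_def)
    ultimately have "norm a < r / 4" "norm a < r" "\<bar>b\<bar> < \<delta>" using lgb(2,3) by auto
    then show ?thesis using ab by (intro exI[of _ a] exI[of _ "\<gamma> a - b"]) (auto simp: cylinder_def)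
  qed
  {
    fix k \<mu> :: "'m rn \<Rightarrow> complex" and N M x x'
    assume k: "kernel_bounds N k" and \<mu>: "density_bounds M (frontier \<Omega>) \<mu>"
      and xe: "x \<in> ball p e" and xe': "x' \<in> ball p e" and xf: "x \<notin> frontier \<Omega>" and xf': "x' \<notin> frontier \<Omega>"
      and side: "x \<in> \<Omega> \<longleftrightarrow> x' \<in> \<Omega>"
    have N: "0 \<le> N" by (rule kernel_bounds_nonneg[OF k])
    have M: "0 \<le> M" using \<mu> by (simp add: density_bounds_def)
    let ?k = "\<lambda>z. k (inv R z)" and ?w = "weight \<mu>"
    have k': "kernel_bounds N ?k" by (rule kernel_bounds_isometry[OF k RR(5)])
    have w: "good_weight ?\<rho> (M * cW) ?w" unfolding cW_def by (rule good_weight[OF \<mu>])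
    obtain \<xi> t where x: "R (x - p) = (\<xi>, \<gamma> \<xi> - t)" "\<xi> \<in> ball 0 ?\<rho>" "x \<in> cylinder p R r \<delta>" using coords[OF xe] by blast
    obtain \<xi>' t' where x': "R (x' - p) = (\<xi>', \<gamma> \<xi>' - t')" "\<xi>' \<in> ball 0 ?\<rho>" "x' \<in> cylinder p R r \<delta>" using coords[OF xe'] by blast
    have t0: "t \<noteq> 0" "t' \<noteq> 0"
      using in_frontier_iff[OF lg opn x(1,3)] in_frontier_iff[OF lg opn x'(1,3)] xf xf' by auto
    \<comment> \<open>Lying on the same side of the frontier is equality of the signs of t and
      t'.\<close>
    have "0 < t \<longleftrightarrow> 0 < t'"
      using in_domain_iff[OF lg x(1,3)] in_domain_iff[OF lg x'(1,3)] side by auto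
    then have tt: "0 < t * t'" using t0 by (auto simp: zero_less_mult_iff)
    have split: "potential \<Omega> k \<mu> x = graph_potential ?k ?\<rho> \<gamma> ?w \<xi> t + part k \<mu> A x"
      if "x \<notin> frontier \<Omega>" "R (x - p) = (\<xi>, \<gamma> \<xi> - t)" for x \<xi> t
    proof -
      have int: "set_integrable \<sigma> (frontier \<Omega>) (\<lambda>y. k (x - y) * \<mu> y)" by (rule frontier_integrable[OF k \<mu> that(1)])
      have ints: "set_integrable \<sigma> piece (\<lambda>y. k (x - y) * \<mu> y)" "set_integrable \<sigma> A (\<lambda>y. k (x - y) * \<mu> y)"
        using piece_borel A sets_surface_measure by (auto intro: set_integrable_subset[OF int])
      have "frontier \<Omega> = piece \<union> A" using piece_borel(2) by (auto simp: A_def)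
      then have "part k \<mu> (frontier \<Omega>) x = part k \<mu> piece x + part k \<mu> A x"
        using set_integral_Un[OF _ ints] by (simp add: part_def A_def)
      then show ?thesis unfolding potential_eq_part part_piece[OF k \<mu> that] .
    qed
    have "norm (potential \<Omega> k \<mu> x) \<le> N * (M * cW) * K + N / c ^ CARD('m) * M * S"
      unfolding split[OF xf x(1)]
      using K1[OF k' good_graph w x(2) t0(1)] part_far(2)[OF k \<mu> A c ball_far[OF xe]]
      by (intro norm_triangle_le add_mono) (simp_all add: S_def)
    also have "\<dots> = N * M * (cW * K * 1 + S / c ^ CARD('m))" by (simp add: algebra_simps)
    also have "\<dots> \<le> N * M * C"
    proof (rule mult_left_mono)
      have "cW * K * 1 \<le> cW * K * (2 + \<Lambda>)" using cW K \<Lambda> by (intro mult_left_mono) auto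
      moreover have "0 \<le> S / c ^ (CARD('m) + 1)" using S c by simp
      ultimately show "cW * K * 1 + S / c ^ CARD('m) \<le> C" by (simp add: C_def)
    qed (use N M in simp)
    finally have 1: "norm (potential \<Omega> k \<mu> x) \<le> N * M * C" .
    let ?d = "dist x x'" and ?h = "norm (\<xi> - \<xi>') + \<bar>t - t'\<bar>"
    have 2: "norm (potential \<Omega> k \<mu> x - potential \<Omega> k \<mu> x') \<le> N * M * (C * omega1 ?d)"
    proof (cases "x = x'")
      case True
      then show ?thesis using N M C omega1_nonneg by simp
    next
      case False
      have eq: "R (x - p) - R (x' - p) = R (x - x')" unfolding linear_diff[OF RR(3), symmetric] by simp
      have dd: "norm (\<xi> - \<xi>') \<le> ?d" "\<bar>(\<gamma> \<xi> - t) - (\<gamma> \<xi>' - t')\<bar> \<le> ?d"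
      proof -
        have "?d = norm (\<xi> - \<xi>', (\<gamma> \<xi> - t) - (\<gamma> \<xi>' - t'))"
        proof -
          have "?d = norm (R (x - x'))" by (simp only: RR(6) dist_norm)
          also have "\<dots> = norm (\<xi> - \<xi>', (\<gamma> \<xi> - t) - (\<gamma> \<xi>' - t'))"
            unfolding eq[symmetric] x(1) x'(1) by (simp only: diff_Pair)
          finally show ?thesis .
        qed
        then show "norm (\<xi> - \<xi>') \<le> ?d" "\<bar>(\<gamma> \<xi> - t) - (\<gamma> \<xi>' - t')\<bar> \<le> ?d"
          using norm_fst_le[of "\<xi> - \<xi>'" "(\<gamma> \<xi> - t) - (\<gamma> \<xi>' - t')"] norm_snd_le[of "(\<gamma> \<xi> - t) - (\<gamma> \<xi>' - t')" "\<xi> - \<xi>'"]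
          by simp_all
      qed
      have \<xi>r: "\<xi> \<in> ball 0 r" "\<xi>' \<in> ball 0 r" using x(2) x'(2) lgb(2) by auto
      have "?h \<le> ?d + (?d + \<Lambda> * ?d)"
        using dd graph_lip[OF \<xi>r] mult_left_mono[OF dd(1) \<Lambda>] by linarith
      then have h: "?h \<le> (2 + \<Lambda>) * ?d" by (simp add: algebra_simps)
      have "?d < 2 * e" using xe xe' dist_triangle2[of x x' p] by (simp add: dist_commute)
      then have "(2 + \<Lambda>) * ?d \<le> (2 + \<Lambda>) * (2 * e)" using \<Lambda> by (intro mult_left_mono) auto
      also have "\<dots> = e * (2 * (2 + \<Lambda>))" by simp
      finally have hs: "(2 + \<Lambda>) * ?d \<le> ?\<rho>" "(2 + \<Lambda>) * ?d \<le> exp (-1)" using ec by linarith+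
      have h0: "0 < ?h"
      proof (rule ccontr)
        assume "\<not> 0 < ?h"
        then have "\<xi> = \<xi>'" "t = t'" using norm_ge_zero[of "\<xi> - \<xi>'"] abs_ge_zero[of "t - t'"]
          by (smt (verit) norm_eq_zero right_minus_eq)+
        then have "R (x - x') = 0" using eq x(1) x'(1) by simp
        then show False using RR(6)[of "x - x'"] False by simp
      qed
      have "norm (graph_potential ?k ?\<rho> \<gamma> ?w \<xi> t - graph_potential ?k ?\<rho> \<gamma> ?w \<xi>' t') \<le> N * (M * cW) * (K * omega1 ?h)"
        using h hs by (intro K2[OF k' good_graph w x(2) x'(2) tt refl h0]) linarith+
      also have "\<dots> \<le> N * (M * cW) * (K * ((2 + \<Lambda>) * omega1 ?d))"
        using omega1_mono[OF h] omega1_mult_le[of "2 + \<Lambda>" ?d] \<Lambda> N M cW K by (intro mult_left_mono) auto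
      finally have g: "norm (graph_potential ?k ?\<rho> \<gamma> ?w \<xi> t - graph_potential ?k ?\<rho> \<gamma> ?w \<xi>' t') \<le>
          N * M * (cW * K * (2 + \<Lambda>)) * omega1 ?d" by (simp add: mult_ac)
      have "norm (part k \<mu> A x - part k \<mu> A x') \<le> N * ?d / c ^ (CARD('m) + 1) * M * measure \<sigma> UNIV"
      proof (rule part_far(3)[OF k \<mu> A c ball_far[OF xe]])
        fix s y assume s: "s \<in> {0..1::real}" and y: "y \<in> A"
        have "(1 - s) *\<^sub>R x' + s *\<^sub>R x \<in> ball p e"
          using convexD[OF convex_ball xe' xe, of "1 - s" s] s by simp
        moreover have "(1 - s) *\<^sub>R x' + s *\<^sub>R x = x' + s *\<^sub>R (x - x')" by (simp add: algebra_simps)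
        ultimately show "c \<le> dist (x' + s *\<^sub>R (x - x')) y" using ball_far y by (simp only:)
      qed
      also have "\<dots> = N * M * (S / c ^ (CARD('m) + 1)) * ?d" by (simp add: S_def)
      also have "\<dots> \<le> N * M * (S / c ^ (CARD('m) + 1)) * omega1 ?d"
      proof (rule mult_left_mono)
        have "1 * ?d \<le> (2 + \<Lambda>) * ?d" using \<Lambda> by (intro mult_right_mono) auto
        then show "?d \<le> omega1 ?d" using hs by (intro le_omega1) auto
      qed (use N M S c in simp)
      finally have a: "norm (part k \<mu> A x - part k \<mu> A x') \<le> N * M * (S / c ^ (CARD('m) + 1)) * omega1 ?d" .
      have "potential \<Omega> k \<mu> x - potential \<Omega> k \<mu> x' =
        (graph_potential ?k ?\<rho> \<gamma> ?w \<xi> t - graph_potential ?k ?\<rho> \<gamma> ?w \<xi>' t') + (part k \<mu> A x - part k \<mu> A x')"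
        unfolding split[OF xf x(1)] split[OF xf' x'(1)] by simp
      then have "norm (potential \<Omega> k \<mu> x - potential \<Omega> k \<mu> x') \<le>
        N * M * (cW * K * (2 + \<Lambda>)) * omega1 ?d + N * M * (S / c ^ (CARD('m) + 1)) * omega1 ?d"
        using g a by (simp only:) (intro norm_triangle_le add_mono)
      also have "\<dots> = N * M * ((cW * K * (2 + \<Lambda>) + S / c ^ (CARD('m) + 1)) * omega1 ?d)"
        by (simp add: algebra_simps)
      also have "\<dots> \<le> N * M * (C * omega1 ?d)"
        using N M S c omega1_nonneg by (intro mult_left_mono mult_right_mono) (auto simp: C_def)
      finally show ?thesis .
    qed
    note 1 2
  }
  then show ?thesis using e C by (intro exI[of _ e] conjI exI[of _ C] allI impI)
qed

end

definition local_estimate :: "'m rn \<Rightarrow> real \<Rightarrow> real \<Rightarrow> bool" where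
  "local_estimate p e C \<longleftrightarrow> (\<forall>k N \<mu> M x x'. kernel_bounds N k \<longrightarrow> density_bounds M (frontier \<Omega>) \<mu> \<longrightarrow>
    x \<in> ball p e \<longrightarrow> x' \<in> ball p e \<longrightarrow> x \<notin> frontier \<Omega> \<longrightarrow> x' \<notin> frontier \<Omega> \<longrightarrow> (x \<in> \<Omega> \<longleftrightarrow> x' \<in> \<Omega>) \<longrightarrow>
    norm (potential \<Omega> k \<mu> x) \<le> N * M * C \<and>
    norm (potential \<Omega> k \<mu> x - potential \<Omega> k \<mu> x') \<le> N * M * (C * omega1 (dist x x')))"

lemma local_estimate_exists:
  assumes p: "p \<in> frontier \<Omega>"
  shows "\<exists>e C. 0 < e \<and> 0 \<le> C \<and> local_estimate p e C"
proof -
  obtain R r \<delta> \<gamma> where lg: "local_graph \<Omega> p R r \<delta> \<gamma>" using C11 p by (auto simp: class_C11_def)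
  obtain b where b: "\<And>\<eta>. \<eta> \<in> ball 0 r \<Longrightarrow> norm (total_deriv \<gamma> \<eta>) \<le> b" using total_deriv_bounded[OF lg] by blast
  obtain L where L: "L-lipschitz_on (ball 0 r) (total_deriv \<gamma>)" using total_deriv_lipschitz[OF lg] by blast
  define \<Lambda> where "\<Lambda> = max \<bar>b\<bar> L"
  have "\<exists>e>0. \<exists>C\<ge>0. \<forall>k N \<mu> M x x'. kernel_bounds N k \<longrightarrow> density_bounds M (frontier \<Omega>) \<mu> \<longrightarrow>
    x \<in> ball p e \<longrightarrow> x' \<in> ball p e \<longrightarrow> x \<notin> frontier \<Omega> \<longrightarrow> x' \<notin> frontier \<Omega> \<longrightarrow> (x \<in> \<Omega> \<longleftrightarrow> x' \<in> \<Omega>) \<longrightarrow>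
    norm (potential \<Omega> k \<mu> x) \<le> N * M * C \<and>
    norm (potential \<Omega> k \<mu> x - potential \<Omega> k \<mu> x') \<le> N * M * (C * omega1 (dist x x'))"
  proof (rule local_estimate_near[OF p lg])
    show "0 \<le> \<Lambda>" by (simp add: \<Lambda>_def)
    show "norm (total_deriv \<gamma> \<eta>) \<le> \<Lambda>" if "\<eta> \<in> ball 0 r" for \<eta>
      using b[OF that] by (simp add: \<Lambda>_def)
    show "norm (total_deriv \<gamma> \<eta> - total_deriv \<gamma> \<eta>') \<le> \<Lambda> * norm (\<eta> - \<eta>')"
      if "\<eta> \<in> ball 0 r" "\<eta>' \<in> ball 0 r" for \<eta> \<eta>'
    proof -
      have "norm (total_deriv \<gamma> \<eta> - total_deriv \<gamma> \<eta>') \<le> L * norm (\<eta> - \<eta>')"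
        using lipschitz_onD[OF L that] by (simp add: dist_norm)
      also have "\<dots> \<le> \<Lambda> * norm (\<eta> - \<eta>')" by (intro mult_right_mono) (auto simp: \<Lambda>_def)
      finally show ?thesis .
    qed
  qed
  then show ?thesis unfolding local_estimate_def[symmetric] by blast
qed

text \<open>Compactness of the frontier makes the local estimates uniform in a neighbourhood of it;
  elsewhere the kernel is evaluated at a fixed positive distance from its singularity.\<close>

lemma potential_estimate:
  obtains C where "0 \<le> C"
    and "\<And>k N \<mu> M x. kernel_bounds N k \<Longrightarrow> density_bounds M (frontier \<Omega>) \<mu> \<Longrightarrow> x \<notin> frontier \<Omega> \<Longrightarrow>
      norm (potential \<Omega> k \<mu> x) \<le> N * M * C"
    and "\<And>k N \<mu> M x x'. kernel_bounds N k \<Longrightarrow> density_bounds M (frontier \<Omega>) \<mu> \<Longrightarrow> x \<notin> frontier \<Omega> \<Longrightarrow>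
      x' \<notin> frontier \<Omega> \<Longrightarrow> (x \<in> \<Omega> \<longleftrightarrow> x' \<in> \<Omega>) \<Longrightarrow>
      norm (potential \<Omega> k \<mu> x - potential \<Omega> k \<mu> x') \<le> N * M * (C * omega1 (dist x x'))"
proof -
  obtain e K where eK: "\<And>p. p \<in> frontier \<Omega> \<Longrightarrow> 0 < e p \<and> 0 \<le> K p \<and> local_estimate p (e p) (K p)"
    using local_estimate_exists by metis
  have cpt: "compact (frontier \<Omega>)" using bounded by (simp add: compact_frontier_bounded)
  then obtain P where P: "P \<subseteq> frontier \<Omega>" "finite P" "frontier \<Omega> \<subseteq> (\<Union>p\<in>P. ball p (e p))"
  proof (rule compactE_image)
    show "frontier \<Omega> \<subseteq> (\<Union>p\<in>frontier \<Omega>. ball p (e p))"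
    proof
      fix p assume "p \<in> frontier \<Omega>"
      moreover from this have "p \<in> ball p (e p)" using eK by simp
      ultimately show "p \<in> (\<Union>p\<in>frontier \<Omega>. ball p (e p))" by blast
    qed
  qed auto
  \<comment> \<open>A Lebesgue number of the cover: two close points near the frontier then share
    one ball on which a local estimate holds.\<close>
  obtain \<epsilon> where \<epsilon>: "0 < \<epsilon>" and leb: "\<And>y. y \<in> frontier \<Omega> \<Longrightarrow> \<exists>G\<in>(\<lambda>p. ball p (e p)) ` P. ball y \<epsilon> \<subseteq> G"
    by (rule Heine_Borel_lemma[OF cpt P(3)], erule imageE, simp, rule that)
  have leb': "\<exists>p\<in>P. ball y \<epsilon> \<subseteq> ball p (e p)" if "y \<in> frontier \<Omega>" for y using leb[OF that] by blast
  define S where "S = measure \<sigma> UNIV"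
  define K1 where "K1 = sum K P"
  \<comment> \<open>c \<le> \<epsilon>/2 keeps points within c of the frontier, together with their
    neighbours at distance below c/2, in such a ball; c \<le> exp (-1)/2 makes
    \<open>le_omega1\<close> applicable.\<close>
  define c where "c = min \<epsilon> (exp (-1)) / 2"
  define B where "B = K1 + S / c ^ CARD('m)"
  define C where "C = B + S / (c / 2) ^ (CARD('m) + 1) + 2 * B / omega1 (c / 2)"
  have c: "0 < c" "c \<le> \<epsilon> / 2" "c \<le> exp (-1) / 2" using \<epsilon> by (auto simp: c_def)
  have S: "0 \<le> S" by (simp add: S_def)
  have K: "0 \<le> K p" if "p \<in> P" for p using eK that P(1) by blast
  have K1: "K p \<le> K1" if "p \<in> P" for p unfolding K1_def using K P(2) that by (intro member_le_sum) auto
  have K1_0: "0 \<le> K1" unfolding K1_def using K by (rule sum_nonneg)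
  have B: "0 \<le> B" "K1 \<le> B" "S / c ^ CARD('m) \<le> B" using K1_0 S c by (auto simp: B_def)
  have om: "0 < omega1 (c / 2)" using c by (intro omega1_pos) simp
  have nn: "0 \<le> S / (c / 2) ^ (CARD('m) + 1)" "0 \<le> 2 * B / omega1 (c / 2)" using S c B om by auto
  have C: "0 \<le> C" "B \<le> C" "S / (c / 2) ^ (CARD('m) + 1) \<le> C" "2 * B / omega1 (c / 2) \<le> C"
    using nn B unfolding C_def by linarith+
  have near: "\<exists>p\<in>P. \<forall>x'. dist x x' < c / 2 \<longrightarrow> x \<in> ball p (e p) \<and> x' \<in> ball p (e p)"
    if y: "y \<in> frontier \<Omega>" "dist x y < c" for x y
  proof -
    obtain p where p: "p \<in> P" "ball y \<epsilon> \<subseteq> ball p (e p)" using leb'[OF y(1)] by blast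
    have "x \<in> ball y \<epsilon>" using y(2) c by (simp add: dist_commute)
    moreover have "x' \<in> ball y \<epsilon>" if "dist x x' < c / 2" for x'
      using y(2) c that dist_triangle3[of y x' x] by simp
    ultimately show ?thesis using p by blast
  qed
  have est: "local_estimate p (e p) (K p)" if "p \<in> P" for p using eK that P(1) by blast
  have bound: "norm (potential \<Omega> k \<mu> x) \<le> N * M * B"
    if k: "kernel_bounds N k" and \<mu>: "density_bounds M (frontier \<Omega>) \<mu>" and x: "x \<notin> frontier \<Omega>" for k N \<mu> M x
  proof -
    have N: "0 \<le> N" by (rule kernel_bounds_nonneg[OF k])
    have M: "0 \<le> M" using \<mu> by (simp add: density_bounds_def)
    show ?thesis
    proof (cases "\<exists>y\<in>frontier \<Omega>. dist x y < c")
      case True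
      then obtain y where y: "y \<in> frontier \<Omega>" "dist x y < c" by blast
      have "dist x x < c / 2" using c by simp
      then obtain p where p: "p \<in> P" "x \<in> ball p (e p)" using near[OF y] by blast
      have "norm (potential \<Omega> k \<mu> x) \<le> N * M * K p"
        using est[OF p(1)] k \<mu> x p(2) unfolding local_estimate_def by blast
      also have "\<dots> \<le> N * M * B" using K1[OF p(1)] B N M by (intro mult_left_mono) auto
      finally show ?thesis .
    next
      case False
      then have "norm (part k \<mu> (frontier \<Omega>) x) \<le> N / c ^ CARD('m) * M * S"
        unfolding S_def by (intro part_far(2)[OF k \<mu> order_refl frontier_borel c(1)]) force
      also have "\<dots> = N * M * (S / c ^ CARD('m))" by simp
      also have "\<dots> \<le> N * M * B" using B N M by (intro mult_left_mono) auto
      finally show ?thesis by (simp only: potential_eq_part)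
    qed
  qed
  show thesis
  proof (rule that[OF C(1)])
    fix k :: "'m rn \<Rightarrow> complex" and N \<mu> M x
    assume k: "kernel_bounds N k" and \<mu>: "density_bounds M (frontier \<Omega>) \<mu>" and x: "x \<notin> frontier \<Omega>"
    have N: "0 \<le> N" by (rule kernel_bounds_nonneg[OF k])
    have M: "0 \<le> M" using \<mu> by (simp add: density_bounds_def)
    have "norm (potential \<Omega> k \<mu> x) \<le> N * M * B" by (rule bound[OF k \<mu> x])
    also have "\<dots> \<le> N * M * C" using C N M by (intro mult_left_mono) auto
    finally show "norm (potential \<Omega> k \<mu> x) \<le> N * M * C" .
    fix x'
    assume x': "x' \<notin> frontier \<Omega>" and side: "x \<in> \<Omega> \<longleftrightarrow> x' \<in> \<Omega>"
    let ?d = "dist x x'"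
    \<comment> \<open>Distant points need only the bound B, since \<open>omega1\<close> of their
      distance is bounded below. Close points near the frontier share a local estimate. For close
      points away from it the segment between them stays at distance c/2 from the frontier.\<close>
    consider "c / 2 \<le> ?d" | y where "?d < c / 2" "y \<in> frontier \<Omega>" "dist x y < c"
      | "?d < c / 2" "\<And>y. y \<in> frontier \<Omega> \<Longrightarrow> c \<le> dist x y" by (meson not_le)
    then show "norm (potential \<Omega> k \<mu> x - potential \<Omega> k \<mu> x') \<le> N * M * (C * omega1 ?d)"
    proof cases
      case 1
      have "norm (potential \<Omega> k \<mu> x - potential \<Omega> k \<mu> x') \<le> N * M * B + N * M * B"
        using norm_triangle_ineq4[of "potential \<Omega> k \<mu> x" "potential \<Omega> k \<mu> x'"] bound[OF k \<mu> x] bound[OF k \<mu> x'] by linarith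
      also have "\<dots> = N * M * (2 * B / omega1 (c / 2) * omega1 (c / 2))" using om by simp
      also have "\<dots> \<le> N * M * (C * omega1 ?d)"
        using C om omega1_mono[OF 1] N M by (intro mult_left_mono mult_mono) auto
      finally show ?thesis .
    next
      case 2
      then obtain p where p: "p \<in> P" "x \<in> ball p (e p)" "x' \<in> ball p (e p)" using near[OF 2(2,3)] by blast
      have "norm (potential \<Omega> k \<mu> x - potential \<Omega> k \<mu> x') \<le> N * M * (K p * omega1 ?d)"
        using est[OF p(1)] k \<mu> x x' side p(2,3) unfolding local_estimate_def by blast
      also have "\<dots> \<le> N * M * (C * omega1 ?d)"
        using K1[OF p(1)] B C N M omega1_nonneg by (intro mult_left_mono mult_right_mono) auto
      finally show ?thesis .
    next
      case 3
      have c2: "0 < c / 2" using c by simp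
      have "norm (part k \<mu> (frontier \<Omega>) x - part k \<mu> (frontier \<Omega>) x') \<le> N * ?d / (c / 2) ^ (CARD('m) + 1) * M * measure \<sigma> UNIV"
      proof (rule part_far(3)[OF k \<mu> order_refl frontier_borel c2])
        show "c / 2 \<le> dist x y" if "y \<in> frontier \<Omega>" for y using 3(2)[OF that] c by simp
        fix s y assume s: "s \<in> {0..1::real}" and y: "y \<in> frontier \<Omega>"
        have "x' + s *\<^sub>R (x - x') - x = (1 - s) *\<^sub>R (x' - x)" by (simp add: algebra_simps)
        then have "dist (x' + s *\<^sub>R (x - x')) x = (1 - s) * ?d" using s by (simp add: dist_norm norm_minus_commute)
        also have "\<dots> \<le> 1 * ?d" using s by (intro mult_right_mono) auto
        finally show "c / 2 \<le> dist (x' + s *\<^sub>R (x - x')) y"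
          using 3(1) 3(2)[OF y] dist_triangle3[of x y "x' + s *\<^sub>R (x - x')"] by simp
      qed
      also have "\<dots> = N * M * (S / (c / 2) ^ (CARD('m) + 1) * ?d)" by (simp add: S_def)
      also have "\<dots> \<le> N * M * (C * omega1 ?d)"
        using 3(1) c C N M nn by (intro mult_left_mono mult_mono le_omega1) auto
      finally show ?thesis by (simp only: potential_eq_part)
    qed
  qed
qed

end

hide_const (open) \<sigma>

section \<open>Extension to the closure\<close>

definition modulus_bound :: "'a::metric_space set \<Rightarrow> ('a \<Rightarrow> complex) \<Rightarrow> real \<Rightarrow> bool" where
  "modulus_bound Q f A \<longleftrightarrow> 0 \<le> A \<and> (\<forall>x\<in>Q. norm (f x) \<le> A) \<and>
     (\<forall>x\<in>Q. \<forall>y\<in>Q. norm (f x - f y) \<le> A * omega1 (dist x y))"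

text \<open>A common form for both sides of the boundary: the interior and the exterior extension
  are both reduced to it, so existence, uniqueness and linearity are argued once.\<close>

definition continuous_ext :: "'a::metric_space set \<Rightarrow> ('a \<Rightarrow> complex) \<Rightarrow> ('a \<Rightarrow> complex) \<Rightarrow> bool" where
  "continuous_ext Q f F \<longleftrightarrow> F \<in> extensional (closure Q) \<and> continuous_on (closure Q) F \<and> (\<forall>x\<in>Q. F x = f x)"

lemma continuous_ext_unique:
  assumes "continuous_ext Q f F" "continuous_ext Q f G"
  shows "F = G"
proof (rule extensionalityI)
  show "F \<in> extensional (closure Q)" "G \<in> extensional (closure Q)"
    using assms by (auto simp: continuous_ext_def)
  fix x assume x: "x \<in> closure Q"
  have "continuous_on (closure Q) (\<lambda>x. F x - G x)"
    using assms by (auto simp: continuous_ext_def intro: continuous_on_diff)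
  moreover have "F x - G x = 0" if "x \<in> Q" for x using assms that by (simp add: continuous_ext_def)
  ultimately have "F x - G x = 0" using x by (rule continuous_constant_on_closure)
  then show "F x = G x" by simp
qed

lemma omega1_uniformly_continuous:
  assumes "0 \<le> A" and le: "\<And>x y. x \<in> Q \<Longrightarrow> y \<in> Q \<Longrightarrow> norm (f x - f y) \<le> A * omega1 (dist x y)"
  shows "uniformly_continuous_on Q f"
  unfolding uniformly_continuous_on_def
proof (intro allI impI)
  fix \<epsilon> :: real assume \<epsilon>: "0 < \<epsilon>"
  \<comment> \<open>A + 1 avoids a division by zero. As omega1 r \<le> 2 sqrt r, the radius ?q^2
    gives (A + 1) times 2 ?q, which is \<epsilon>.\<close>
  let ?q = "\<epsilon> / (2 * (A + 1))"
  have q: "0 < ?q" using \<epsilon> \<open>0 \<le> A\<close> by simp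
  show "\<exists>d>0. \<forall>x\<in>Q. \<forall>x'\<in>Q. dist x' x < d \<longrightarrow> dist (f x') (f x) < \<epsilon>"
  proof (intro exI[of _ "?q\<^sup>2"] conjI ballI impI)
    show "0 < ?q\<^sup>2" using q by (rule zero_less_power)
    fix x x' assume x: "x \<in> Q" "x' \<in> Q" "dist x' x < ?q\<^sup>2"
    have "sqrt (dist x' x) < ?q" using x(3) q by (intro real_less_lsqrt) auto
    then have "(A + 1) * (2 * sqrt (dist x' x)) < (A + 1) * (2 * ?q)" using \<open>0 \<le> A\<close> by (intro mult_strict_left_mono) auto
    also have "\<dots> = \<epsilon>" using \<open>0 \<le> A\<close> by (simp add: field_simps)
    finally have 1: "(A + 1) * (2 * sqrt (dist x' x)) < \<epsilon>" .
    have "dist (f x') (f x) \<le> A * omega1 (dist x' x)" using le[OF x(2,1)] by (simp add: dist_norm)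
    also have "\<dots> \<le> (A + 1) * (2 * sqrt (dist x' x))"
      using \<open>0 \<le> A\<close> omega1_nonneg by (intro mult_mono omega1_le_sqrt) auto
    finally show "dist (f x') (f x) < \<epsilon>" using 1 by linarith
  qed
qed

lemma continuous_ext_exists:
  fixes f :: "'a::metric_space \<Rightarrow> complex"
  assumes "modulus_bound Q f A"
  shows "\<exists>F. continuous_ext Q f F"
proof -
  have "uniformly_continuous_on Q f"
    using assms by (intro omega1_uniformly_continuous[of A]) (auto simp: modulus_bound_def)
  then obtain g where g: "uniformly_continuous_on (closure Q) g" "\<And>x. x \<in> Q \<Longrightarrow> f x = g x"
    by (rule uniformly_continuous_on_extension_on_closure) auto
  have "continuous_ext Q f (restrict g (closure Q))"
    unfolding continuous_ext_def
  proof (intro conjI ballI)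
    show "continuous_on (closure Q) (restrict g (closure Q))"
      using uniformly_continuous_imp_continuous[OF g(1)] by (rule continuous_on_eq) simp
    show "restrict g (closure Q) x = f x" if "x \<in> Q" for x
      using that g(2) closure_subset by (auto simp: restrict_def)
  qed simp
  then show ?thesis by blast
qed

text \<open>Approximating points eventually have distance below 2 |x - y|, and \<open>omega1\<close>
  grows at most by the factor 2 under doubling. This explains the factor 2 and avoids passing to the
  limit inside \<open>omega1\<close>.\<close>

lemma continuous_ext_bounds:
  assumes F: "continuous_ext Q f F" and f: "modulus_bound Q f A"
  shows "x \<in> closure Q \<Longrightarrow> norm (F x) \<le> A"
    and "x \<in> closure Q \<Longrightarrow> y \<in> closure Q \<Longrightarrow> norm (F x - F y) \<le> 2 * A * omega1 (dist x y)"
proof -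
  have cont: "continuous_on (closure Q) F" and eq: "\<And>x. x \<in> Q \<Longrightarrow> F x = f x"
    using F by (auto simp: continuous_ext_def)
  have A: "0 \<le> A" using f by (simp add: modulus_bound_def)
  show "norm (F x) \<le> A" if "x \<in> closure Q"
    by (rule continuous_on_closure_norm_le[OF cont _ that]) (use f eq in \<open>simp add: modulus_bound_def\<close>)
  assume x: "x \<in> closure Q" and y: "y \<in> closure Q"
  show "norm (F x - F y) \<le> 2 * A * omega1 (dist x y)"
  proof (cases "x = y")
    case False
    obtain u v where u: "\<And>n. u n \<in> Q" "u \<longlonglongrightarrow> x" and v: "\<And>n. v n \<in> Q" "v \<longlonglongrightarrow> y"
      using x y unfolding closure_sequential by blast
    have sub: "Q \<subseteq> closure Q" by (rule closure_subset)
    have lim: "(\<lambda>n. F (u n)) \<longlonglongrightarrow> F x" "(\<lambda>n. F (v n)) \<longlonglongrightarrow> F y"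
      using cont x y u v sub unfolding continuous_on_sequentially by (auto simp: o_def subset_iff)
    then have "(\<lambda>n. norm (F (u n) - F (v n))) \<longlonglongrightarrow> norm (F x - F y)"
      by (intro tendsto_norm tendsto_diff)
    moreover have "eventually (\<lambda>n. norm (F (u n) - F (v n)) \<le> 2 * A * omega1 (dist x y)) sequentially"
    proof -
      have "(\<lambda>n. dist (u n) (v n)) \<longlonglongrightarrow> dist x y" using u v by (intro tendsto_dist)
      moreover have "dist x y < 2 * dist x y" using False by simp
      ultimately have "eventually (\<lambda>n. dist (u n) (v n) < 2 * dist x y) sequentially"
        by (rule order_tendstoD(2))
      then show ?thesis
      proof (rule eventually_mono)
        fix n assume n: "dist (u n) (v n) < 2 * dist x y"
        have "norm (F (u n) - F (v n)) \<le> A * omega1 (dist (u n) (v n))"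
          using f u(1) v(1) by (simp add: modulus_bound_def eq)
        also have "\<dots> \<le> A * (2 * omega1 (dist x y))"
          using A omega1_mono[OF less_imp_le[OF n]] omega1_mult_le[of 2 "dist x y"] by (intro mult_left_mono) auto
        finally show "norm (F (u n) - F (v n)) \<le> 2 * A * omega1 (dist x y)" by simp
      qed
    qed
    ultimately show ?thesis by (intro tendsto_upperbound) auto
  qed (use A omega1_nonneg in simp)
qed

lemma continuous_ext_lincomb:
  assumes "continuous_ext Q f F" "continuous_ext Q g G" and eq: "\<And>x. x \<in> Q \<Longrightarrow> u x = a * f x + b * g x"
  shows "continuous_ext Q u (restrict (\<lambda>x. a * F x + b * G x) (closure Q))"
  unfolding continuous_ext_def
proof (intro conjI ballI)
  have "continuous_on (closure Q) (\<lambda>x. a * F x + b * G x)"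
    using assms by (auto simp: continuous_ext_def intro!: continuous_intros)
  then show "continuous_on (closure Q) (restrict (\<lambda>x. a * F x + b * G x) (closure Q))"
    by (rule continuous_on_eq) simp
  show "restrict (\<lambda>x. a * F x + b * G x) (closure Q) x = u x" if x: "x \<in> Q" for x
  proof -
    have "x \<in> closure Q" using x closure_subset by blast
    then show ?thesis using assms x by (simp add: continuous_ext_def)
  qed
qed simp

lemma modulus_bound_lincomb:
  assumes f: "modulus_bound Q f A" and g: "modulus_bound Q g B" and eq: "\<And>x. x \<in> Q \<Longrightarrow> u x = a * f x + b * g x"
  shows "modulus_bound Q u (norm a * A + norm b * B)"
  unfolding modulus_bound_def
proof (intro conjI ballI)
  show "0 \<le> norm a * A + norm b * B" using f g by (simp add: modulus_bound_def)
  fix x assume x: "x \<in> Q"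
  show "norm (u x) \<le> norm a * A + norm b * B"
    unfolding eq[OF x] using f g x
    by (intro norm_triangle_le add_mono) (auto simp: norm_mult modulus_bound_def intro!: mult_left_mono)
  fix y assume y: "y \<in> Q"
  have "u x - u y = a * (f x - f y) + b * (g x - g y)" by (simp add: eq x y algebra_simps)
  also have "norm \<dots> \<le> norm a * (A * omega1 (dist x y)) + norm b * (B * omega1 (dist x y))"
    using f g x y by (intro norm_triangle_le add_mono) (auto simp: norm_mult modulus_bound_def intro!: mult_left_mono)
  finally show "norm (u x - u y) \<le> (norm a * A + norm b * B) * omega1 (dist x y)"
    by (simp add: algebra_simps)
qed

lemma hoelder_norm_le:
  assumes "\<And>x. x \<in> K \<Longrightarrow> norm (F x) \<le> a" "\<And>x y. x \<in> K \<Longrightarrow> y \<in> K \<Longrightarrow> norm (F x - F y) \<le> b * omega1 (dist x y)"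
    and "0 \<le> a" "0 \<le> b"
  shows "hoelder_seminorm omega1 K F \<le> ennreal b" "hoelder_norm omega1 K F \<le> ennreal (a + b)"
proof -
  have 1: "sup_norm K F \<le> ennreal a"
    unfolding sup_norm_def using assms(1) by (intro SUP_least ennreal_leI)
  show 2: "hoelder_seminorm omega1 K F \<le> ennreal b"
    unfolding hoelder_seminorm_def
  proof (rule SUP_least)
    fix z assume z: "z \<in> {(x, y). x \<in> K \<and> y \<in> K \<and> x \<noteq> y}"
    obtain x y where xy: "z = (x, y)" "x \<in> K" "y \<in> K" "x \<noteq> y" using z by auto
    then have "0 < omega1 (dist x y)" by (intro omega1_pos) simp
    then have "norm (F x - F y) / omega1 (dist x y) \<le> b"
      using assms(2)[OF xy(2,3)] by (simp add: pos_divide_le_eq)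
    then show "(case z of (x, y) \<Rightarrow> ennreal (norm (F x - F y) / omega1 (dist x y))) \<le> ennreal b"
      by (simp add: xy(1) ennreal_leI)
  qed
  show "hoelder_norm omega1 K F \<le> ennreal (a + b)"
    unfolding hoelder_norm_def using add_mono[OF 1 2] assms(3,4) by (simp add: ennreal_plus)
qed

lemma sup_norm_leD:
  assumes "sup_norm K f \<le> ennreal N" "0 \<le> N" "x \<in> K" shows "norm (f x) \<le> N"
proof -
  have "ennreal (norm (f x)) \<le> sup_norm K f" unfolding sup_norm_def using assms(3) by (rule SUP_upper)
  then have "ennreal (norm (f x)) \<le> ennreal N" using assms(1) by (rule order_trans)
  then show ?thesis using assms(2) by simp
qed

lemma lipschitz_seminorm_leD:
  assumes "hoelder_seminorm (\<lambda>r. r) K f \<le> ennreal N" "0 \<le> N" "x \<in> K" "y \<in> K"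
  shows "norm (f x - f y) \<le> N * dist x y"
proof (cases "x = y")
  case False
  have "(case (x, y) of (x, y) \<Rightarrow> ennreal (norm (f x - f y) / dist x y)) \<le> hoelder_seminorm (\<lambda>r. r) K f"
    unfolding hoelder_seminorm_def by (rule SUP_upper) (use False assms in auto)
  then have "ennreal (norm (f x - f y) / dist x y) \<le> ennreal N" using assms(1) by (simp add: order_trans)
  then have "norm (f x - f y) / dist x y \<le> N" using assms(2) by simp
  then show ?thesis using False by (simp add: pos_divide_le_eq)
qed simp

lemma sup_norm_finite: "(\<And>x. x \<in> K \<Longrightarrow> norm (f x) \<le> B) \<Longrightarrow> sup_norm K f < \<infinity>"
proof -
  assume "\<And>x. x \<in> K \<Longrightarrow> norm (f x) \<le> B"
  then have "sup_norm K f \<le> ennreal B" unfolding sup_norm_def by (intro SUP_least ennreal_leI)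
  then show ?thesis by (rule order_le_less_trans) simp
qed

lemma lipschitz_seminorm_finite:
  assumes "L-lipschitz_on K f" shows "hoelder_seminorm (\<lambda>r. r) K f < \<infinity>"
proof -
  have "hoelder_seminorm (\<lambda>r. r) K f \<le> ennreal L"
    unfolding hoelder_seminorm_def
  proof (rule SUP_least)
    fix z assume z: "z \<in> {(x, y). x \<in> K \<and> y \<in> K \<and> x \<noteq> y}"
    obtain x y where xy: "z = (x, y)" "x \<in> K" "y \<in> K" "x \<noteq> y" using z by auto
    then have "norm (f x - f y) / dist x y \<le> L"
      using lipschitz_onD[OF assms xy(2,3)] by (simp add: pos_divide_le_eq dist_norm)
    then show "(case z of (x, y) \<Rightarrow> ennreal (norm (f x - f y) / dist x y)) \<le> ennreal L"
      by (simp add: xy(1) ennreal_leI)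
  qed
  then show ?thesis by (rule order_le_less_trans) simp
qed

section \<open>Kernels and densities with finite norm\<close>

text \<open>The qualitative properties of odd kernels, stable under differences; quantitative
  regularity enters through \<open>kernel_norm\<close>. Thus f - f0 can be estimated by its norm
  directly.\<close>

definition admissible_kernel :: "('a::euclidean_space \<Rightarrow> complex) \<Rightarrow> bool" where
  "admissible_kernel k \<longleftrightarrow> (\<forall>x. x \<noteq> 0 \<longrightarrow> k differentiable (at x)) \<and>
     pos_homogeneous (- (real DIM('a) - 1)) k \<and> (\<forall>x. x \<noteq> 0 \<longrightarrow> k (- x) = - k x)"

lemma admissible_odd_kernel: "k \<in> odd_kernel_space \<Longrightarrow> admissible_kernel k"
  by (auto simp: admissible_kernel_def odd_kernel_space_def kernel_space_def C11_loc_punctured_def)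

lemma admissible_diff:
  assumes "admissible_kernel f" "admissible_kernel g" shows "admissible_kernel (\<lambda>z. f z - g z)"
  using assms unfolding admissible_kernel_def pos_homogeneous_def
  by (auto intro!: differentiable_diff simp: scaleR_diff_right)

lemma kernel_bounds_of_norm:
  fixes k :: "'a::euclidean_space \<Rightarrow> complex"
  assumes k: "admissible_kernel k" and N: "kernel_norm k \<le> ennreal N" "0 \<le> N"
  shows "kernel_bounds ((real DIM('a) + 2) * N) k"
proof (rule kernel_boundsI)
  have sn: "sup_norm (sphere 0 1) k \<le> ennreal N" "sup_norm (sphere 0 1) (total_deriv k) \<le> ennreal N"
    "hoelder_seminorm (\<lambda>r. r) (sphere 0 1) (total_deriv k) \<le> ennreal N"
    using N(1) unfolding kernel_norm_def by (auto intro: order_trans[rotated] add_increasing add_increasing2)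
  show "k (- z) = - k z" if "z \<noteq> 0" for z using k that by (simp add: admissible_kernel_def)
  show "k (t *\<^sub>R z) = (1 / t ^ (DIM('a) - 1)) *\<^sub>R k z" if t: "0 < t" and z: "z \<noteq> 0" for t z
  proof -
    have "t powr - (real DIM('a) - 1) = t powr - real (DIM('a) - 1)"
      by (simp add: of_nat_diff)
    also have "\<dots> = inverse (t powr real (DIM('a) - 1))" by (rule powr_minus)
    also have "\<dots> = 1 / t ^ (DIM('a) - 1)" using powr_realpow[OF t] by (simp only: inverse_eq_divide)
    finally show ?thesis using k t z by (simp add: admissible_kernel_def pos_homogeneous_def)
  qed
  show "(k has_derivative blinfun_apply (total_deriv k z)) (at z)" if "z \<noteq> 0" for z
  proof -
    have d: "(k has_derivative frechet_derivative k (at z)) (at z)"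
      using k that by (simp add: admissible_kernel_def frechet_derivative_works)
    then show ?thesis
      unfolding total_deriv_def by (simp add: bounded_linear_Blinfun_apply has_derivative_bounded_linear)
  qed
  show "norm (k z) \<le> N" "norm (total_deriv k z) \<le> N" if "norm z = 1" for z
    using sup_norm_leD[OF sn(1) N(2), of z] sup_norm_leD[OF sn(2) N(2), of z] that by simp_all
  show "norm (total_deriv k z - total_deriv k z') \<le> N * norm (z - z')" if "norm z = 1" "norm z' = 1" for z z'
    using lipschitz_seminorm_leD[OF sn(3) N(2), of z z'] that by (simp add: dist_norm)
qed (rule N(2))

text \<open>The suprema are finite by compactness of the sphere. Lipschitz bounds are given on
  closures of bounded open sets away from 0, hence the annulus 1/2 < |x| < 2 around the
  sphere.\<close>

lemma kernel_norm_finite: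
  fixes k :: "'a::euclidean_space \<Rightarrow> complex"
  assumes "k \<in> odd_kernel_space" shows "kernel_norm k < \<infinity>"
proof -
  have C: "C11_loc_punctured k" using assms by (simp add: odd_kernel_space_def kernel_space_def)
  have sph: "compact (sphere (0::'a) 1)" "sphere (0::'a) 1 \<subseteq> - {0}" by auto
  have bdd: "\<exists>B. \<forall>x\<in>sphere 0 1. norm (f x) \<le> B" if "continuous_on (- {0}) f" for f :: "'a \<Rightarrow> 'b::real_normed_vector"
  proof -
    have "continuous_on (sphere 0 1) f" using that sph(2) by (rule continuous_on_subset)
    then have "compact (f ` sphere 0 1)" using sph(1) by (rule compact_continuous_image)
    then show ?thesis using compact_imp_bounded by (fastforce simp: bounded_iff)
  qed
  have "continuous_on (- {0}) k"
    using C by (intro continuous_at_imp_continuous_on ballI differentiable_imp_continuous_within)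
      (simp add: C11_loc_punctured_def)
  then have 1: "sup_norm (sphere 0 1) k < \<infinity>" by (metis bdd sup_norm_finite)
  have "continuous_on (- {0}) (total_deriv k)" using C by (simp add: C11_loc_punctured_def)
  then have 2: "sup_norm (sphere 0 1) (total_deriv k) < \<infinity>" by (metis bdd sup_norm_finite)
  let ?U = "ball (0::'a) 2 - cball 0 (1 / 2)"
  have "closure ?U \<subseteq> {x. 1 / 2 \<le> norm x}"
    by (rule closure_minimal) (auto intro!: closed_Collect_le continuous_intros)
  then have "open ?U \<and> bounded ?U \<and> closure ?U \<subseteq> - {0}" by (auto intro: bounded_diff)
  then obtain L where "L-lipschitz_on (closure ?U) (total_deriv k)"
    using C unfolding C11_loc_punctured_def by blast
  moreover have "sphere 0 1 \<subseteq> closure ?U"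
    by (rule order_trans[OF _ closure_subset]) auto
  ultimately have "L-lipschitz_on (sphere 0 1) (total_deriv k)" by (rule lipschitz_on_subset)
  then have 3: "hoelder_seminorm (\<lambda>r. r) (sphere 0 1) (total_deriv k) < \<infinity>" by (rule lipschitz_seminorm_finite)
  show ?thesis using 1 2 3 by (simp add: kernel_norm_def)
qed

lemma finite_le_ennreal:
  assumes "(x :: ennreal) < \<infinity>" obtains N where "0 \<le> N" "x \<le> ennreal N"
proof
  show "0 \<le> enn2real x" by (rule enn2real_nonneg)
  show "x \<le> ennreal (enn2real x)" using assms by simp
qed

lemma odd_kernel_bounds:
  assumes "k \<in> odd_kernel_space" obtains N where "kernel_bounds N k"
proof -
  obtain N where "0 \<le> N" "kernel_norm k \<le> ennreal N" using kernel_norm_finite[OF assms] by (rule finite_le_ennreal)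
  then show ?thesis using that kernel_bounds_of_norm[OF admissible_odd_kernel[OF assms]] by blast
qed

lemma density_bounds_of_norm:
  assumes "lipschitz_norm S \<mu> \<le> ennreal M" "0 \<le> M"
  shows "density_bounds M S \<mu>"
proof -
  have "sup_norm S \<mu> \<le> ennreal M" "hoelder_seminorm (\<lambda>r. r) S \<mu> \<le> ennreal M"
    using assms(1) unfolding lipschitz_norm_def hoelder_norm_def
    by (auto intro: order_trans[rotated] add_increasing add_increasing2)
  then show ?thesis
    unfolding density_bounds_def using assms(2) by (auto intro: sup_norm_leD lipschitz_seminorm_leD)
qed

lemma lipschitz_density_bounds:
  assumes "compact S" "\<mu> \<in> lipschitz_space S" obtains M where "density_bounds M S \<mu>"
proof -
  obtain L where L: "L-lipschitz_on S \<mu>" using assms(2) by (auto simp: lipschitz_space_def)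
  have "compact (\<mu> ` S)" using lipschitz_on_continuous_on[OF L] assms(1) by (rule compact_continuous_image)
  then obtain B where "\<forall>x\<in>S. norm (\<mu> x) \<le> B" using compact_imp_bounded by (fastforce simp: bounded_iff)
  then have "sup_norm S \<mu> < \<infinity>" by (intro sup_norm_finite[of S \<mu> B]) simp
  then have "lipschitz_norm S \<mu> < \<infinity>"
    using lipschitz_seminorm_finite[OF L] by (simp add: lipschitz_norm_def hoelder_norm_def)
  then obtain M where "0 \<le> M" "lipschitz_norm S \<mu> \<le> ennreal M" by (rule finite_le_ennreal)
  then have "density_bounds M S \<mu>" by (rule density_bounds_of_norm[rotated])
  then show ?thesis by (rule that)
qed

lemma density_bounds_add:
  assumes "density_bounds M S \<mu>" "density_bounds M' S (\<lambda>z. \<nu> z - \<mu> z)"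
  shows "density_bounds (M + M') S \<nu>"
  unfolding density_bounds_def
proof (intro conjI ballI)
  show "0 \<le> M + M'" using assms by (simp add: density_bounds_def)
  fix y assume y: "y \<in> S"
  have "norm (\<mu> y + (\<nu> y - \<mu> y)) \<le> M + M'"
    using assms y by (intro norm_triangle_le add_mono) (auto simp: density_bounds_def)
  then show "norm (\<nu> y) \<le> M + M'" by simp
  fix z assume z: "z \<in> S"
  have "norm ((\<mu> y - \<mu> z) + ((\<nu> y - \<mu> y) - (\<nu> z - \<mu> z))) \<le> M * dist y z + M' * dist y z"
    using assms y z by (intro norm_triangle_le add_mono) (auto simp: density_bounds_def)
  then show "norm (\<nu> y - \<nu> z) \<le> (M + M') * dist y z" by (simp add: algebra_simps)
qed

section \<open>Bilinearity and continuity of the extended potentials\<close>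

context
  fixes \<Omega> :: "('m::finite) rn set"
  assumes bounded: "bounded \<Omega>" and opn: "open \<Omega>" and C11: "class_C11 \<Omega>"
begin

lemma potential_lincomb_kernel:
  assumes f: "kernel_bounds N f" and g: "kernel_bounds N' g" and h: "density_bounds M (frontier \<Omega>) h"
    and x: "x \<notin> frontier \<Omega>"
  shows "potential \<Omega> (\<lambda>z. a * f z + b * g z) h x = a * potential \<Omega> f h x + b * potential \<Omega> g h x"
proof -
  note I = frontier_integrable[OF bounded opn C11 f h x] frontier_integrable[OF bounded opn C11 g h x]
  have "(\<lambda>y. (a * f (x - y) + b * g (x - y)) * h y) = (\<lambda>y. a * (f (x - y) * h y) + b * (g (x - y) * h y))"
    by (simp add: algebra_simps)
  then show ?thesis
    unfolding potential_def using I by (simp add: set_integral_add set_integral_mult_right)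
qed

lemma potential_lincomb_density:
  assumes f: "kernel_bounds N f" and g: "density_bounds M (frontier \<Omega>) g"
    and h: "density_bounds M' (frontier \<Omega>) h" and x: "x \<notin> frontier \<Omega>"
  shows "potential \<Omega> f (\<lambda>z. a * g z + b * h z) x = a * potential \<Omega> f g x + b * potential \<Omega> f h x"
proof -
  note I = frontier_integrable[OF bounded opn C11 f g x] frontier_integrable[OF bounded opn C11 f h x]
  have "(\<lambda>y. f (x - y) * (a * g y + b * h y)) = (\<lambda>y. a * (f (x - y) * g y) + b * (f (x - y) * h y))"
    by (simp add: algebra_simps)
  then show ?thesis
    unfolding potential_def using I by (simp add: set_integral_add set_integral_mult_right)
qed

lemma density_bounds_exist:
  assumes "\<mu> \<in> lipschitz_space (frontier \<Omega>)" obtains M where "density_bounds M (frontier \<Omega>) \<mu>"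
  using lipschitz_density_bounds[OF compact_frontier_bounded[OF bounded] assms] .

section \<open>One side of the boundary: Q will be \<Omega> or the complement of its closure\<close>

context
  fixes Q :: "'m rn set"
  assumes Q: "Q \<inter> frontier \<Omega> = {}" and same_side: "\<And>x y. x \<in> Q \<Longrightarrow> y \<in> Q \<Longrightarrow> x \<in> \<Omega> \<longleftrightarrow> y \<in> \<Omega>"
begin

lemma off_frontier: "x \<in> Q \<Longrightarrow> x \<notin> frontier \<Omega>"
  using Q by blast

text \<open>C is chosen before kernel and density, so the bound is proportional to N and to M;
  continuity of the extended map rests on this.\<close>

lemma potential_modulus_bound:
  obtains C where "0 \<le> C"
    and "\<And>k N \<mu> M. kernel_bounds N k \<Longrightarrow> density_bounds M (frontier \<Omega>) \<mu> \<Longrightarrow>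
      modulus_bound Q (potential \<Omega> k \<mu>) (N * M * C)"
proof (rule potential_estimate[OF bounded opn C11])
  fix C assume C: "0 \<le> C"
    and 1: "\<And>k N \<mu> M x. kernel_bounds N k \<Longrightarrow> density_bounds M (frontier \<Omega>) \<mu> \<Longrightarrow> x \<notin> frontier \<Omega> \<Longrightarrow>
      norm (potential \<Omega> k \<mu> x) \<le> N * M * C"
    and 2: "\<And>k N \<mu> M x x'. kernel_bounds N k \<Longrightarrow> density_bounds M (frontier \<Omega>) \<mu> \<Longrightarrow> x \<notin> frontier \<Omega> \<Longrightarrow>
      x' \<notin> frontier \<Omega> \<Longrightarrow> (x \<in> \<Omega> \<longleftrightarrow> x' \<in> \<Omega>) \<Longrightarrow>
      norm (potential \<Omega> k \<mu> x - potential \<Omega> k \<mu> x') \<le> N * M * (C * omega1 (dist x x'))"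
  have "modulus_bound Q (potential \<Omega> k \<mu>) (N * M * C)"
    if k: "kernel_bounds N k" and \<mu>: "density_bounds M (frontier \<Omega>) \<mu>" for k N \<mu> M
    unfolding modulus_bound_def
  proof (intro conjI ballI)
    show "0 \<le> N * M * C"
      using kernel_bounds_nonneg[OF k] \<mu> C by (simp add: density_bounds_def)
    show "norm (potential \<Omega> k \<mu> x) \<le> N * M * C" if "x \<in> Q" for x
      by (rule 1[OF k \<mu> off_frontier[OF that]])
    show "norm (potential \<Omega> k \<mu> x - potential \<Omega> k \<mu> y) \<le> N * M * C * omega1 (dist x y)"
      if x: "x \<in> Q" and y: "y \<in> Q" for x y
      using 2[OF k \<mu> off_frontier[OF x] off_frontier[OF y] same_side[OF x y]] by (simp add: mult.assoc)
  qed
  then show thesis using C that by blast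
qed

lemma modulus_bound_exists:
  assumes "k \<in> odd_kernel_space" "\<mu> \<in> lipschitz_space (frontier \<Omega>)"
  obtains A where "modulus_bound Q (potential \<Omega> k \<mu>) A"
proof -
  obtain N M where "kernel_bounds N k" "density_bounds M (frontier \<Omega>) \<mu>"
    using odd_kernel_bounds[OF assms(1)] density_bounds_exist[OF assms(2)] by metis
  then show ?thesis using that potential_modulus_bound by metis
qed

section \<open>The extension operator E, later \<open>potential_plus\<close> or
  \<open>potential_minus\<close>, observed on K\<close>

context
  fixes K and E :: "('m rn \<Rightarrow> complex) \<Rightarrow> ('m rn \<Rightarrow> complex) \<Rightarrow> 'm rn \<Rightarrow> complex"
  assumes K: "K \<subseteq> closure Q"
    and E: "\<And>k \<mu> A F. modulus_bound Q (potential \<Omega> k \<mu>) A \<Longrightarrow> continuous_ext Q (potential \<Omega> k \<mu>) F \<Longrightarrow> E k \<mu> = F"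
begin

lemma extension_is_continuous_ext:
  assumes "modulus_bound Q (potential \<Omega> k \<mu>) A"
  shows "continuous_ext Q (potential \<Omega> k \<mu>) (E k \<mu>)"
proof -
  obtain F where F: "continuous_ext Q (potential \<Omega> k \<mu>) F" using continuous_ext_exists[OF assms] by blast
  show ?thesis using F E[OF assms F] by simp
qed

lemma extension_hoelder:
  assumes "k \<in> odd_kernel_space" "\<mu> \<in> lipschitz_space (frontier \<Omega>)"
  shows "hoelder_on omega1 K (E k \<mu>)"
proof -
  obtain A where A: "modulus_bound Q (potential \<Omega> k \<mu>) A" by (rule modulus_bound_exists[OF assms])
  note b = continuous_ext_bounds[OF extension_is_continuous_ext[OF A] A]
  have "hoelder_seminorm omega1 K (E k \<mu>) \<le> ennreal (2 * A)"
    using A K by (intro hoelder_norm_le[where a = A] b) (auto simp: modulus_bound_def)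
  then show ?thesis unfolding hoelder_on_def by (rule order_le_less_trans) simp
qed

text \<open>The combination of the two extensions is a continuous extension of the combined
  potential, so the assumption on E identifies it. The form of the identity covers linearity in
  either argument.\<close>

lemma extension_lincomb:
  assumes f: "modulus_bound Q (potential \<Omega> f f') A" and g: "modulus_bound Q (potential \<Omega> g g') B"
    and eq: "\<And>x. x \<in> Q \<Longrightarrow> potential \<Omega> u u' x = a * potential \<Omega> f f' x + b * potential \<Omega> g g' x"
    and x: "x \<in> K"
  shows "E u u' x = a * E f f' x + b * E g g' x"
proof -
  have "E u u' = restrict (\<lambda>x. a * E f f' x + b * E g g' x) (closure Q)"
    by (rule E[OF modulus_bound_lincomb[OF f g eq]
          continuous_ext_lincomb[OF extension_is_continuous_ext[OF f] extension_is_continuous_ext[OF g] eq]])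
  then show ?thesis using x K by auto
qed

lemma extension_bilinear: "bilinear_map_on odd_kernel_space (lipschitz_space (frontier \<Omega>)) K E"
  unfolding bilinear_map_on_def
proof (intro conjI ballI allI)
  fix f g :: "'m rn \<Rightarrow> complex" and h a b x
  assume f: "f \<in> odd_kernel_space" and g: "g \<in> odd_kernel_space" and h: "h \<in> lipschitz_space (frontier \<Omega>)"
    and x: "x \<in> K"
  obtain N N' M where b: "kernel_bounds N f" "kernel_bounds N' g" "density_bounds M (frontier \<Omega>) h"
    using odd_kernel_bounds[OF f] odd_kernel_bounds[OF g] density_bounds_exist[OF h] by metis
  obtain A B where "modulus_bound Q (potential \<Omega> f h) A" "modulus_bound Q (potential \<Omega> g h) B"
    using modulus_bound_exists[OF f h] modulus_bound_exists[OF g h] by metis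
  then show "E (\<lambda>z. a * f z + b * g z) h x = a * E f h x + b * E g h x"
    by (rule extension_lincomb) (rule potential_lincomb_kernel[OF b off_frontier], assumption, rule x)
next
  fix f :: "'m rn \<Rightarrow> complex" and g h a b x
  assume f: "f \<in> odd_kernel_space" and g: "g \<in> lipschitz_space (frontier \<Omega>)"
    and h: "h \<in> lipschitz_space (frontier \<Omega>)" and x: "x \<in> K"
  obtain N M M' where b: "kernel_bounds N f" "density_bounds M (frontier \<Omega>) g" "density_bounds M' (frontier \<Omega>) h"
    using odd_kernel_bounds[OF f] density_bounds_exist[OF g] density_bounds_exist[OF h] by metis
  obtain A B where "modulus_bound Q (potential \<Omega> f g) A" "modulus_bound Q (potential \<Omega> f h) B"
    using modulus_bound_exists[OF f g] modulus_bound_exists[OF f h] by metis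
  then show "E f (\<lambda>z. a * g z + b * h z) x = a * E f g x + b * E f h x"
    by (rule extension_lincomb) (rule potential_lincomb_density[OF b off_frontier], assumption, rule x)
qed

text \<open>E f g - E f0 g0 extends the potential of (f - f0, g) plus that of (f0, g - g0). Each
  summand contains one small factor, and g is bounded by M0 + \<delta>.\<close>

lemma extension_continuous:
  "continuous_map_on odd_kernel_space kernel_norm (lipschitz_space (frontier \<Omega>)) (lipschitz_norm (frontier \<Omega>))
     (hoelder_norm omega1 K) E"
  unfolding continuous_map_on_def
proof (intro ballI allI impI)
  fix f0 :: "'m rn \<Rightarrow> complex" and g0 and \<epsilon> :: real
  assume f0: "f0 \<in> odd_kernel_space" and g0: "g0 \<in> lipschitz_space (frontier \<Omega>)" and \<epsilon>: "0 < \<epsilon>"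
  obtain N0 M0 where N0: "kernel_bounds N0 f0" and M0: "density_bounds M0 (frontier \<Omega>) g0"
    using odd_kernel_bounds[OF f0] density_bounds_exist[OF g0] by metis
  have nn: "0 \<le> N0" "0 \<le> M0" using kernel_bounds_nonneg[OF N0] M0 by (auto simp: density_bounds_def)
  obtain C where C: "0 \<le> C"
    and mb: "\<And>k N \<mu> M. kernel_bounds N k \<Longrightarrow> density_bounds M (frontier \<Omega>) \<mu> \<Longrightarrow>
      modulus_bound Q (potential \<Omega> k \<mu>) (N * M * C)"
    using potential_modulus_bound by metis
  define c where "c = real DIM('m rn) + 2"
  \<comment> \<open>3 = 1 + 2: the supremum contributes A and the seminorm 2 A. M0 + 1 bounds the
    density g because \<delta> \<le> 1, and c is the factor that passes from
    \<open>kernel_norm\<close> to \<open>kernel_bounds\<close>.\<close>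
  define X where "X = 3 * (c * (M0 + 1) * C + N0 * C)"
  define \<delta> where "\<delta> = min 1 (\<epsilon> / (X + 1))"
  have c: "0 \<le> c" by (simp add: c_def)
  have X: "0 \<le> X" using c nn C by (simp add: X_def)
  have \<delta>: "0 < \<delta>" "\<delta> \<le> 1" "\<delta> * X < \<epsilon>"
  proof -
    show 1: "0 < \<delta>" "\<delta> \<le> 1" using \<epsilon> X by (auto simp: \<delta>_def)
    have "\<delta> * X < \<delta> * (X + 1)" using 1 by simp
    also have "\<dots> \<le> \<epsilon> / (X + 1) * (X + 1)" using X by (intro mult_right_mono) (auto simp: \<delta>_def)
    also have "\<dots> = \<epsilon>" using X by simp
    finally show "\<delta> * X < \<epsilon>" .
  qed
  show "\<exists>\<delta>>0. \<forall>f\<in>odd_kernel_space. \<forall>g\<in>lipschitz_space (frontier \<Omega>).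
      kernel_norm (\<lambda>z. f z - f0 z) < ennreal \<delta> \<and> lipschitz_norm (frontier \<Omega>) (\<lambda>z. g z - g0 z) < ennreal \<delta> \<longrightarrow>
      hoelder_norm omega1 K (\<lambda>z. E f g z - E f0 g0 z) < ennreal \<epsilon>"
  proof (intro exI[of _ \<delta>] conjI ballI impI \<delta>(1))
    fix f g assume f: "f \<in> odd_kernel_space" and g: "g \<in> lipschitz_space (frontier \<Omega>)"
      and near: "kernel_norm (\<lambda>z. f z - f0 z) < ennreal \<delta> \<and> lipschitz_norm (frontier \<Omega>) (\<lambda>z. g z - g0 z) < ennreal \<delta>"
    have df: "kernel_bounds (c * \<delta>) (\<lambda>z. f z - f0 z)"
      unfolding c_def using near \<delta>(1) admissible_odd_kernel[OF f] admissible_odd_kernel[OF f0]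
      by (intro kernel_bounds_of_norm admissible_diff) auto
    have dg: "density_bounds \<delta> (frontier \<Omega>) (\<lambda>z. g z - g0 z)"
      using near \<delta>(1) by (intro density_bounds_of_norm) auto
    have gb: "density_bounds (M0 + \<delta>) (frontier \<Omega>) g" by (rule density_bounds_add[OF M0 dg])
    obtain N where N: "kernel_bounds N f" by (rule odd_kernel_bounds[OF f])
    let ?u = "\<lambda>x. potential \<Omega> f g x - potential \<Omega> f0 g0 x"
    \<comment> \<open>First the kernel is changed with g fixed, then the density with f0 fixed. The
      coefficients 1 fit the form of \<open>modulus_bound_lincomb\<close>.\<close>
    have eq: "?u x = 1 * potential \<Omega> (\<lambda>z. f z - f0 z) g x + 1 * potential \<Omega> f0 (\<lambda>z. g z - g0 z) x"
      if "x \<in> Q" for x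
      using potential_lincomb_kernel[OF N N0 gb off_frontier[OF that], of 1 "-1"]
        potential_lincomb_density[OF N0 gb M0 off_frontier[OF that], of 1 "-1"] by simp
    have m: "modulus_bound Q ?u (norm (1::complex) * (c * \<delta> * (M0 + \<delta>) * C) + norm (1::complex) * (N0 * \<delta> * C))"
      by (rule modulus_bound_lincomb[OF mb[OF df gb] mb[OF N0 dg] eq])
    define A where "A = c * \<delta> * (M0 + \<delta>) * C + N0 * \<delta> * C"
    have A: "modulus_bound Q ?u A" using m by (simp add: A_def)
    have "c * \<delta> * (M0 + \<delta>) * C \<le> c * \<delta> * (M0 + 1) * C"
      using c C \<delta> by (intro mult_right_mono mult_left_mono) auto
    then have "A + 2 * A \<le> \<delta> * X" by (simp add: A_def X_def algebra_simps)
    then have A3: "A + 2 * A < \<epsilon>" using \<delta>(3) by linarith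
    have ext: "continuous_ext Q ?u (restrict (\<lambda>x. 1 * E f g x + (-1) * E f0 g0 x) (closure Q))"
      by (rule continuous_ext_lincomb[OF extension_is_continuous_ext[OF mb[OF N gb]]
            extension_is_continuous_ext[OF mb[OF N0 M0]]]) simp
    have r: "E f g x - E f0 g0 x = restrict (\<lambda>x. 1 * E f g x + (-1) * E f0 g0 x) (closure Q) x" if "x \<in> K" for x
      using that K by auto
    have A0: "0 \<le> A" using A by (simp add: modulus_bound_def)
    have "hoelder_norm omega1 K (\<lambda>z. E f g z - E f0 g0 z) \<le> ennreal (A + 2 * A)"
    proof (rule hoelder_norm_le(2))
      fix x assume x: "x \<in> K"
      show "norm (E f g x - E f0 g0 x) \<le> A"
        unfolding r[OF x] using x K by (intro continuous_ext_bounds(1)[OF ext A]) auto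
      fix y assume y: "y \<in> K"
      show "norm (E f g x - E f0 g0 x - (E f g y - E f0 g0 y)) \<le> 2 * A * omega1 (dist x y)"
        unfolding r[OF x] r[OF y] using x y K by (intro continuous_ext_bounds(2)[OF ext A]) auto
    qed (use A0 in auto)
    also have "\<dots> < ennreal \<epsilon>" using A3 A0 by (simp add: ennreal_less_iff)
    finally show "hoelder_norm omega1 K (\<lambda>z. E f g z - E f0 g0 z) < ennreal \<epsilon>" .
  qed
qed

end

end

text \<open>A frontier point is a limit of points above the local graph, which are exterior. Hence a
  continuous extension from the exterior is defined and unique on the whole complement of
  \<Omega>.\<close>

lemma closure_exterior: "closure (- closure \<Omega>) = - \<Omega>"
proof
  show "closure (- closure \<Omega>) \<subseteq> - \<Omega>"
    using opn closure_subset[of \<Omega>] by (intro closure_minimal) auto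
  show "- \<Omega> \<subseteq> closure (- closure \<Omega>)"
  proof
    fix x assume x: "x \<in> - \<Omega>"
    show "x \<in> closure (- closure \<Omega>)"
    proof (cases "x \<in> closure \<Omega>")
      case True
      then have "x \<in> frontier \<Omega>" using x opn by (simp add: frontier_def interior_open)
      then obtain R r \<delta> \<gamma> where lg: "local_graph \<Omega> x R r \<delta> \<gamma>" using C11 unfolding class_C11_def by metis
      have "R (x - x) = (0, \<gamma> 0)"
        using linear_0[OF orthogonal_transformation_linear[OF local_graph_basic(1)[OF lg]]]
          local_graph_basic(4)[OF lg] by (simp add: zero_prod_def)
      then show ?thesis by (rule graph_in_closures(2)[OF lg]) (rule center_in_cylinder[OF lg])
    qed (use closure_subset[of "- closure \<Omega>"] in auto)
  qed
qed

lemma interior_off_frontier: "\<Omega> \<inter> frontier \<Omega> = {}"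
  using opn by (auto simp: frontier_def interior_open)

lemma exterior_off_frontier: "- closure \<Omega> \<inter> frontier \<Omega> = {}"
  by (auto simp: frontier_def)

lemma exterior_same_side: "x \<in> - closure \<Omega> \<Longrightarrow> y \<in> - closure \<Omega> \<Longrightarrow> x \<in> \<Omega> \<longleftrightarrow> y \<in> \<Omega>"
  using closure_subset by auto

text \<open>A modulus bound passes to the closure, so a continuous extension is automatically
  Hoelder continuous; conversely Hoelder continuity implies continuity since \<open>omega1\<close>
  is dominated by a square root. Uniqueness thus reduces to that of continuous extensions.\<close>

lemma interior_ext_iff:
  assumes A: "modulus_bound \<Omega> (potential \<Omega> k \<mu>) A"
  shows "interior_ext \<Omega> k \<mu> F \<longleftrightarrow> continuous_ext \<Omega> (potential \<Omega> k \<mu>) F"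
proof
  assume F: "continuous_ext \<Omega> (potential \<Omega> k \<mu>) F"
  have "hoelder_seminorm omega1 (closure \<Omega>) F \<le> ennreal (2 * A)"
    using A by (intro hoelder_norm_le[where a = A] continuous_ext_bounds[OF F A]) (auto simp: modulus_bound_def)
  then have "hoelder_on omega1 (closure \<Omega>) F" unfolding hoelder_on_def by (rule order_le_less_trans) simp
  then show "interior_ext \<Omega> k \<mu> F" using F by (simp add: interior_ext_def continuous_ext_def)
next
  assume F: "interior_ext \<Omega> k \<mu> F"
  then have "hoelder_seminorm omega1 (closure \<Omega>) F < \<infinity>" by (simp add: interior_ext_def hoelder_on_def)
  then obtain B where B: "0 \<le> B" "hoelder_seminorm omega1 (closure \<Omega>) F \<le> ennreal B" by (rule finite_le_ennreal)
  have "norm (F x - F y) \<le> B * omega1 (dist x y)" if "x \<in> closure \<Omega>" "y \<in> closure \<Omega>" for x y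
  proof (cases "x = y")
    case False
    then have pos: "0 < omega1 (dist x y)" by (intro omega1_pos) simp
    have "(case (x, y) of (x, y) \<Rightarrow> ennreal (norm (F x - F y) / omega1 (dist x y))) \<le> hoelder_seminorm omega1 (closure \<Omega>) F"
      unfolding hoelder_seminorm_def by (rule SUP_upper) (use False that in auto)
    then have "ennreal (norm (F x - F y) / omega1 (dist x y)) \<le> ennreal B" using B(2) by (simp add: order_trans)
    then have "norm (F x - F y) / omega1 (dist x y) \<le> B" using B(1) by simp
    then show ?thesis using pos by (simp add: pos_divide_le_eq)
  qed (use B omega1_nonneg in simp)
  then have "continuous_on (closure \<Omega>) F"
    by (intro uniformly_continuous_imp_continuous omega1_uniformly_continuous[OF B(1)])
  then show "continuous_ext \<Omega> (potential \<Omega> k \<mu>) F" using F by (simp add: interior_ext_def continuous_ext_def)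
qed

lemma exterior_ext_iff: "exterior_ext \<Omega> k \<mu> F \<longleftrightarrow> continuous_ext (- closure \<Omega>) (potential \<Omega> k \<mu>) F"
  by (simp add: exterior_ext_def continuous_ext_def closure_exterior)

lemma potential_plus_eq:
  assumes "modulus_bound \<Omega> (potential \<Omega> k \<mu>) A" "continuous_ext \<Omega> (potential \<Omega> k \<mu>) F"
  shows "potential_plus \<Omega> k \<mu> = F"
  unfolding potential_plus_def interior_ext_iff[OF assms(1)]
  by (rule the_equality, rule assms(2), erule continuous_ext_unique[OF _ assms(2)])

lemma potential_minus_eq:
  assumes "continuous_ext (- closure \<Omega>) (potential \<Omega> k \<mu>) F"
  shows "potential_minus \<Omega> k \<mu> = F"
  unfolding potential_minus_def exterior_ext_iff
  by (rule the_equality, rule assms, erule continuous_ext_unique[OF _ assms])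

lemma interior_ext_unique_exists:
  assumes "k \<in> odd_kernel_space" "\<mu> \<in> lipschitz_space (frontier \<Omega>)"
  shows "\<exists>!F. interior_ext \<Omega> k \<mu> F"
proof -
  obtain A where A: "modulus_bound \<Omega> (potential \<Omega> k \<mu>) A"
    by (rule modulus_bound_exists[OF interior_off_frontier _ assms]) auto
  show ?thesis
    unfolding interior_ext_iff[OF A]
    by (rule ex_ex1I, rule continuous_ext_exists[OF A], rule continuous_ext_unique)
qed

lemma exterior_ext_unique_exists:
  assumes "k \<in> odd_kernel_space" "\<mu> \<in> lipschitz_space (frontier \<Omega>)"
  shows "\<exists>!F. exterior_ext \<Omega> k \<mu> F"
proof -
  obtain A where A: "modulus_bound (- closure \<Omega>) (potential \<Omega> k \<mu>) A"
    by (rule modulus_bound_exists[OF exterior_off_frontier exterior_same_side assms])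
  show ?thesis
    unfolding exterior_ext_iff
    by (rule ex_ex1I, rule continuous_ext_exists[OF A], rule continuous_ext_unique)
qed

end

theorem theorem4p1:
  fixes \<Omega> :: "('m::finite) rn set"
  assumes "bounded \<Omega>" and "open \<Omega>" and "class_C11 \<Omega>"
  shows
    "((\<forall>k\<in>odd_kernel_space. \<forall>\<mu>\<in>lipschitz_space (frontier \<Omega>). \<exists>!F. interior_ext \<Omega> k \<mu> F) \<and>
     bilinear_map_on odd_kernel_space (lipschitz_space (frontier \<Omega>)) (closure \<Omega>)
       (potential_plus \<Omega>) \<and>
     continuous_map_on odd_kernel_space kernel_norm
       (lipschitz_space (frontier \<Omega>)) (lipschitz_norm (frontier \<Omega>))
       (hoelder_norm omega1 (closure \<Omega>)) (potential_plus \<Omega>)) \<and>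
     ((\<forall>k\<in>odd_kernel_space. \<forall>\<mu>\<in>lipschitz_space (frontier \<Omega>). \<exists>!F. exterior_ext \<Omega> k \<mu> F) \<and>
     (\<forall>r>0. closure \<Omega> \<subseteq> ball 0 r \<longrightarrow>
       (\<forall>k\<in>odd_kernel_space. \<forall>\<mu>\<in>lipschitz_space (frontier \<Omega>).
          hoelder_on omega1 (cball 0 r - \<Omega>) (potential_minus \<Omega> k \<mu>)) \<and>
       bilinear_map_on odd_kernel_space (lipschitz_space (frontier \<Omega>)) (cball 0 r - \<Omega>)
         (potential_minus \<Omega>) \<and>
       continuous_map_on odd_kernel_space kernel_norm
         (lipschitz_space (frontier \<Omega>)) (lipschitz_norm (frontier \<Omega>))
         (hoelder_norm omega1 (cball 0 r - \<Omega>)) (potential_minus \<Omega>)))"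
proof -
  note hyp = assms
  have int_K: "closure \<Omega> \<subseteq> closure \<Omega>" by (rule order_refl)
  \<comment> \<open>The exterior estimate holds on the closure of the entire exterior and is then
    restricted to the closed ball without \<Omega>.\<close>
  have ext_K: "cball 0 r - \<Omega> \<subseteq> closure (- closure \<Omega>)" for r
    unfolding closure_exterior[OF hyp] by blast
  have minus: "potential_minus \<Omega> k \<mu> = F"
    if "modulus_bound (- closure \<Omega>) (potential \<Omega> k \<mu>) A" "continuous_ext (- closure \<Omega>) (potential \<Omega> k \<mu>) F"
    for k \<mu> A F
    by (rule potential_minus_eq[OF hyp that(2)])
  note ext = exterior_off_frontier[OF hyp] exterior_same_side[OF hyp] ext_K minus
  show ?thesis
  proof (intro conjI ballI allI impI)
    show "bilinear_map_on odd_kernel_space (lipschitz_space (frontier \<Omega>)) (closure \<Omega>) (potential_plus \<Omega>)"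
      by (rule extension_bilinear[OF hyp interior_off_frontier[OF hyp] _ int_K potential_plus_eq[OF hyp]]) auto
    show "continuous_map_on odd_kernel_space kernel_norm (lipschitz_space (frontier \<Omega>))
        (lipschitz_norm (frontier \<Omega>)) (hoelder_norm omega1 (closure \<Omega>)) (potential_plus \<Omega>)"
      by (rule extension_continuous[OF hyp interior_off_frontier[OF hyp] _ int_K potential_plus_eq[OF hyp]]) auto
    fix r
    show "bilinear_map_on odd_kernel_space (lipschitz_space (frontier \<Omega>)) (cball 0 r - \<Omega>) (potential_minus \<Omega>)"
      by (rule extension_bilinear[OF hyp ext])
    show "continuous_map_on odd_kernel_space kernel_norm (lipschitz_space (frontier \<Omega>))
        (lipschitz_norm (frontier \<Omega>)) (hoelder_norm omega1 (cball 0 r - \<Omega>)) (potential_minus \<Omega>)"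
      by (rule extension_continuous[OF hyp ext])
    fix k :: "'m rn \<Rightarrow> complex" and \<mu> assume km: "k \<in> odd_kernel_space" "\<mu> \<in> lipschitz_space (frontier \<Omega>)"
    show "\<exists>!F. interior_ext \<Omega> k \<mu> F" by (rule interior_ext_unique_exists[OF hyp km])
    show "\<exists>!F. exterior_ext \<Omega> k \<mu> F" by (rule exterior_ext_unique_exists[OF hyp km])
    show "hoelder_on omega1 (cball 0 r - \<Omega>) (potential_minus \<Omega> k \<mu>)"
      by (rule extension_hoelder[OF hyp ext km])
  qed
qed

end
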